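(* Let $W=W(D_5^{(1)})$, $\tilde W$, $\boldsymbol K=\mathbb C(a_0,\dots,a_5)$ and the skew field $\boldsymbol F=\boldsymbol K(F,G)$, $FG=qGF$, be as in the context. The automorphisms $s_j$ ($j=0,\dots,5$) of $\boldsymbol K$ extend to algebra automorphisms of $\boldsymbol F$ by putting $$s_2(F):=F\,\frac{a_0a_1^{-1}G+a_2^2}{a_0a_1^{-1}a_2^2G+1},\qquad s_j(F):=F\ (j\ne2),$$ $$s_3(G):=\frac{a_3^2a_4a_5^{-1}F+1}{a_4a_5^{-1}F+a_3^2}\,G,\qquad s_j(G):=G\ (j\neq3),$$ and these give rise to a homomorphism $W\to\mathrm{Aut}_{\text{skew field}}(\boldsymbol F)$. Moreover, the actions of the diagram automorphisms $\sigma_{01},\sigma_{45},\tau$ on $\boldsymbol K$ can be extended to involutive antiautomorphisms of $\boldsymbol F$ by $$\sigma_{01}:F\mapsto q^{-1}F^{-1},\ G\mapsto G;\qquad \sigma_{45}:F\mapsto F,\ G\mapsto q^{-1}G^{-1};\qquad \tau:F\mapsto G,\ G\mapsto F,$$ so that one has a homomorphism $\tilde W\to\mathrm{Aut}_{\mathbb C\text{-lin}}(\boldsymbol F)$ (the group of $\mathbb C$-linear bijections of $\boldsymbol F$).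
   Context: The Dynkin diagram of type $D_5^{(1)}$ is numbered so that node $2$ is joined to $0,1,3$ and node $3$ is joined to $2,4,5$ (no other edges); $[a_{ij}]_{i,j=0}^5$ is the corresponding generalized Cartan matrix ($a_{ii}=2$, $a_{ij}=-1$ if $i,j$ are joined, $0$ otherwise). $W=W(D_5^{(1)})$ is the Weyl group with generators $s_0,\dots,s_5$. It acts on $\boldsymbol K=\mathbb C(a_0,\dots,a_5)$ (commuting variables) by $s_i(a_j)=a_i^{-a_{ij}}a_j$. Further automorphisms of $\boldsymbol K$ are $$\sigma_{01}:a_0\mapsto a_1^{-1},\ a_1\mapsto a_0^{-1},\ a_j\mapsto a_j^{-1}\ (j\ne0,1);$$ $$\sigma_{45}:a_4\mapsto a_5^{-1},\ a_5\mapsto a_4^{-1},\ a_j\mapsto a_j^{-1}\ (j\neq4,5);$$ $$\tau:a_j\mapsto a_{5-j}^{-1}\ (j=0,\dots,5).$$ $\tilde W:=\langle W,\sigma_{01},\sigma_{45},\tau\rangle$ is the extended Weyl group generated by these acting on $\boldsymbol K$. $q$ is a formal central letter (or a complex parameter with $|q|<1$), fixed by all the maps considered. $\boldsymbol F=\boldsymbol K(F,G)$ is the skew field of fractions of the $\boldsymbol K$-algebra generated by $F,G$ with $FG=qGF$, where $\boldsymbol K$ and $q$ are central. A fraction $\frac{A}{B}$ with commuting $A,B$ means $AB^{-1}=B^{-1}A$. An antiautomorphism $\phi$ satisfies $\phi(xy)=\phi(y)\phi(x)$. *)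

theory Defs
  imports
    Complex_Main
    "HOL-Library.Poly_Mapping"
    "HOL-Library.Numeral_Type"
    "HOL-Computational_Algebra.Fraction_Field"
    "HOL-Algebra.Elementary_Groups"
begin

section \<open>The affine Cartan matrix and the field of parameters\<close>

text \<open>The nodes 0, \<dots>, 5 of the diagram are the six elements of the numeral type \<open>6\<close>.\<close>

type_synonym node = 6

definition joined :: "node \<Rightarrow> node \<Rightarrow> bool" where
  "joined i j \<longleftrightarrow> {i, j} \<in> {{0, 2}, {1, 2}, {2, 3}, {3, 4}, {3, 5}}"

definition cartan :: "node \<Rightarrow> node \<Rightarrow> int" where
  "cartan i j = (if i = j then 2 else if joined i j then - 1 else 0)"

text \<open>The field of rational functions in six variables over the complex numbers, as the
  fraction field of the polynomial ring (finitely supported maps from exponent vectors to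
  coefficients).\<close>

type_synonym ratfun = "((node \<Rightarrow>\<^sub>0 nat) \<Rightarrow>\<^sub>0 complex) fract"

definition const :: "complex \<Rightarrow> ratfun" where
  "const c = Fract (Poly_Mapping.single 0 c) 1"

definition a :: "node \<Rightarrow> ratfun" where
  "a j = Fract (Poly_Mapping.single (Poly_Mapping.single j 1) 1) 1"


section \<open>Automorphisms and antiautomorphisms\<close>

definition ring_automorphism :: "('r::ring_1 \<Rightarrow> 'r) \<Rightarrow> bool" where
  "ring_automorphism \<phi> \<longleftrightarrow> bij \<phi> \<and> \<phi> 1 = 1 \<and>
     (\<forall>x y. \<phi> (x + y) = \<phi> x + \<phi> y) \<and> (\<forall>x y. \<phi> (x * y) = \<phi> x * \<phi> y)"

definition ring_antiautomorphism :: "('r::ring_1 \<Rightarrow> 'r) \<Rightarrow> bool" where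
  "ring_antiautomorphism \<phi> \<longleftrightarrow> bij \<phi> \<and> \<phi> 1 = 1 \<and>
     (\<forall>x y. \<phi> (x + y) = \<phi> x + \<phi> y) \<and> (\<forall>x y. \<phi> (x * y) = \<phi> y * \<phi> x)"

definition involutive :: "('x \<Rightarrow> 'x) \<Rightarrow> bool" where
  "involutive \<phi> \<longleftrightarrow> (\<forall>x. \<phi> (\<phi> x) = x)"

text \<open>The automorphism of the rational function field over the complex numbers that takes
  prescribed values on the six variables; it is unique when it exists.\<close>

definition param_aut :: "(node \<Rightarrow> ratfun) \<Rightarrow> ratfun \<Rightarrow> ratfun" where
  "param_aut y = (THE \<phi>. ring_automorphism \<phi> \<and> (\<forall>c. \<phi> (const c) = const c) \<and> (\<forall>j. \<phi> (a j) = y j))"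

definition s :: "node \<Rightarrow> ratfun \<Rightarrow> ratfun" where
  "s i = param_aut (\<lambda>j. a i powi (- cartan i j) * a j)"

definition \<sigma>01 :: "ratfun \<Rightarrow> ratfun" where
  "\<sigma>01 = param_aut (\<lambda>j. if j = 0 then inverse (a 1) else if j = 1 then inverse (a 0)
                          else inverse (a j))"

definition \<sigma>45 :: "ratfun \<Rightarrow> ratfun" where
  "\<sigma>45 = param_aut (\<lambda>j. if j = 4 then inverse (a 5) else if j = 5 then inverse (a 4)
                          else inverse (a j))"

text \<open>Subtraction on \<open>node\<close> is modulo 6, so \<open>5 - j\<close> is the usual difference for all six nodes.\<close>

definition \<tau> :: "ratfun \<Rightarrow> ratfun" where
  "\<tau> = param_aut (\<lambda>j. inverse (a (5 - j)))"


section \<open>The Weyl group and the groups of transformations\<close>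

definition comp_group :: "('x \<Rightarrow> 'x) set \<Rightarrow> ('x \<Rightarrow> 'x) monoid" where
  "comp_group A = \<lparr>carrier = A, monoid.mult = (\<circ>), one = id\<rparr>"

definition Aut_ring :: "('r::ring_1 \<Rightarrow> 'r) monoid" where
  "Aut_ring = comp_group {\<phi>. ring_automorphism \<phi>}"

text \<open>Both groups are taken as groups of automorphisms of the parameter field. The Weyl group acts
  faithfully there: on Laurent monomials the maps \<open>s i\<close> are the simple reflections of the root
  lattice, written multiplicatively.\<close>

definition W :: "(ratfun \<Rightarrow> ratfun) monoid" where
  "W = subgroup_generated Aut_ring (range s)"

definition W_ext :: "(ratfun \<Rightarrow> ratfun) monoid" where
  "W_ext = subgroup_generated Aut_ring (carrier W \<union> {\<sigma>01, \<sigma>45, \<tau>})"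

text \<open>A ring with a map \<open>\<iota>\<close> from the parameter field is a complex vector space
  through \<open>\<iota> \<circ> const\<close>.\<close>

definition Aut_C_lin :: "(ratfun \<Rightarrow> 'f::ring_1) \<Rightarrow> ('f \<Rightarrow> 'f) monoid" where
  "Aut_C_lin \<iota> = comp_group {\<phi>. bij \<phi> \<and> (\<forall>x y. \<phi> (x + y) = \<phi> x + \<phi> y) \<and>
                               (\<forall>c x. \<phi> (\<iota> (const c) * x) = \<iota> (const c) * \<phi> x)}"

definition extends :: "(ratfun \<Rightarrow> 'f) \<Rightarrow> ('f \<Rightarrow> 'f) \<Rightarrow> (ratfun \<Rightarrow> ratfun) \<Rightarrow> bool" where
  "extends \<iota> \<phi> \<psi> \<longleftrightarrow> (\<forall>k. \<phi> (\<iota> k) = \<iota> (\<psi> k))"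


section \<open>Algebras given by generators and relations\<close>

text \<open>Elements of the free algebra over \<open>'k\<close> on letters \<open>'g\<close> are finitely supported maps from
  words to coefficients. \<open>two_sided_ideal R\<close> consists of the finite sums of terms
  \<open>c u r v\<close> with a scalar \<open>c\<close>, words \<open>u\<close>, \<open>v\<close> and \<open>r \<in> R\<close>.\<close>

definition free_eval :: "('k::field \<Rightarrow> 'f::ring_1) \<Rightarrow> ('g \<Rightarrow> 'f) \<Rightarrow> ('g list \<Rightarrow>\<^sub>0 'k) \<Rightarrow> 'f" where
  "free_eval \<iota> x p = (\<Sum>w\<in>Poly_Mapping.keys p. \<iota> (Poly_Mapping.lookup p w) * prod_list (map x w))"

definition word_mult :: "'k::field \<Rightarrow> 'g list \<Rightarrow> ('g list \<Rightarrow>\<^sub>0 'k) \<Rightarrow> 'g list \<Rightarrow> ('g list \<Rightarrow>\<^sub>0 'k)" where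
  "word_mult c u r v =
     (\<Sum>w\<in>Poly_Mapping.keys r. Poly_Mapping.single (u @ w @ v) (c * Poly_Mapping.lookup r w))"

inductive_set two_sided_ideal :: "('g list \<Rightarrow>\<^sub>0 'k::field) set \<Rightarrow> ('g list \<Rightarrow>\<^sub>0 'k) set"
  for R where
  zero: "0 \<in> two_sided_ideal R"
| add: "p \<in> two_sided_ideal R \<Longrightarrow> r \<in> R \<Longrightarrow> p + word_mult c u r v \<in> two_sided_ideal R"


section \<open>The skew field\<close>

text \<open>The letter \<open>q\<close> is either a formal central letter or is specialised to a complex number.\<close>

datatype q_kind = Formal_letter | Complex_parameter complex

datatype letter = Letter_q | Letter_F | Letter_G

abbreviation mono :: "letter list \<Rightarrow> ratfun \<Rightarrow> (letter list \<Rightarrow>\<^sub>0 ratfun)" where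
  "mono \<equiv> Poly_Mapping.single"

definition quantum_relations :: "q_kind \<Rightarrow> (letter list \<Rightarrow>\<^sub>0 ratfun) set" where
  "quantum_relations \<kappa> =
     {mono [Letter_q, Letter_F] 1 - mono [Letter_F, Letter_q] 1,
      mono [Letter_q, Letter_G] 1 - mono [Letter_G, Letter_q] 1,
      mono [Letter_F, Letter_G] 1 - mono [Letter_q, Letter_G, Letter_F] 1} \<union>
     (case \<kappa> of Formal_letter \<Rightarrow> {}
      | Complex_parameter c \<Rightarrow> {mono [Letter_q] 1 - mono [] (const c)})"

text \<open>The type \<open>'f\<close>, with the central embedding \<open>\<iota>\<close> of the parameter field and the elements \<open>q\<close>, \<open>F\<close>,
  \<open>G\<close>, is the skew field of fractions of the algebra presented by the relations above:
  the evaluation map has the ideal of relations as its kernel, so the subalgebra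
  generated by \<open>q\<close>, \<open>F\<close>, \<open>G\<close> is the presented algebra, and each element of \<open>'f\<close> is a fraction with
  numerator and denominator in it. As that algebra is an Ore domain for \<open>q \<noteq> 0\<close>, this
  determines the skew field up to unique isomorphism. For \<open>q = 0\<close> there is no such skew field, since
  then \<open>F * G = 0\<close>.\<close>

locale quantum_skew_field =
  fixes \<kappa> :: q_kind
    and \<iota> :: "ratfun \<Rightarrow> 'f::division_ring"
    and q F G :: 'f
  assumes embed_one: "\<iota> 1 = 1"
    and embed_add: "\<iota> (x + y) = \<iota> x + \<iota> y"
    and embed_mult: "\<iota> (x * y) = \<iota> x * \<iota> y"
    and embed_central: "\<iota> x * f = f * \<iota> x"
    and presentation:
      "free_eval \<iota> (case_letter q F G) p = 0 \<longleftrightarrow> p \<in> two_sided_ideal (quantum_relations \<kappa>)"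
    and fractions:
      "\<exists>A B. free_eval \<iota> (case_letter q F G) B \<noteq> 0 \<and>
         f = free_eval \<iota> (case_letter q F G) A / free_eval \<iota> (case_letter q F G) B"

end

theory Submission
  imports Defs "HOL-Computational_Algebra.Polynomial"
begin

text \<open>A map of the parameter field lifts to the skew field as soon as images \<open>F'\<close>, \<open>G'\<close> of the two
  generators are nonzero and again \<open>q\<close>-commute (in the opposite ring, for antiautomorphisms).
  Since \<open>q\<close> is not a root of unity, the monomials \<open>G'\<^sup>m F'\<^sup>n\<close> are eigenvectors with different
  eigenvalues for conjugation by \<open>F'\<close> and \<open>G'\<close>, hence independent; so the substitution is injective
  on the presented algebra and extends to fractions.

  A relation between the lifts is checked on the parameters, \<open>F\<close> and \<open>G\<close>. Conjugation with the three
  antiautomorphisms reduces the braid relations to two: the one of \<open>s\<^sub>0\<close> and \<open>s\<^sub>2\<close>, which takes place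
  in the field generated by \<open>G\<close>, and the one of \<open>s\<^sub>2\<close> and \<open>s\<^sub>3\<close>, which on \<open>F\<close> is an identity between
  arbitrary noncommuting \<open>f\<close> and \<open>g\<close> and on \<open>G\<close> follows by symmetry.

  Because \<open>W\<close> and its extension are given as groups of maps of the parameter field, one also
  needs that a word acting trivially on the parameters acts trivially on \<open>F\<close> and \<open>G\<close>. For words in
  the reflections this is Tits' argument: a nontrivial element of the lifted group takes some \<open>a\<^sub>i\<close>
  to the inverse of a monomial. A general word is a reflection word followed by one of
  eight diagram words. Four of these invert \<open>\<delta> = a\<^sub>0 a\<^sub>1 a\<^sub>2\<^sup>2 a\<^sub>3\<^sup>2 a\<^sub>4 a\<^sub>5\<close>, which every reflection
  fixes, and the other four permute the \<open>a\<^sub>i\<close>, so only the empty one can be undone by reflections.\<close>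

section \<open>Homomorphisms of division rings\<close>

text \<open>Lifting a map means comparing the kernels of two evaluations of the free algebra. Once
  words are sorted, each kernel is cut out by the vanishing of coefficients that are polynomials in
  \<open>q\<close> over the parameter field, and these coefficients do not see the images of
  \<open>F\<close> and \<open>G\<close>. It remains to show that a map of the parameters that fixes
  \<open>q\<close> preserves such vanishing. Here the two readings of \<open>q\<close> part ways: a
  formal \<open>q\<close> is transcendental over the parameters, while a complex \<open>q\<close> is
  itself a constant.

  The skew field is known only through its presentation, so statements such as
  \<open>F \<noteq> 0\<close> or the transcendence of \<open>q\<close> are obtained from small
  models of the relations.

  The factor \<open>inverse q\<close> in the images under the two sign-type antiautomorphisms is
  what compatibility with the reflections requires: an antiautomorphism reverses the product of
  \<open>F\<close> with a fraction in \<open>G\<close>, and moving \<open>F\<close> back across that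
  fraction rescales \<open>G\<close> by \<open>q\<close>.\<close>

locale division_ring_hom =
  fixes \<phi> :: "'f::division_ring \<Rightarrow> 'd::division_ring"
  assumes one: "\<phi> 1 = 1"
    and add: "\<phi> (x + y) = \<phi> x + \<phi> y"
    and mult: "\<phi> (x * y) = \<phi> x * \<phi> y"
begin

lemma zero: "\<phi> 0 = 0"
  using add[of 0 0] by simp

lemma eq_0_iff: "\<phi> x = 0 \<longleftrightarrow> x = 0"
proof
  assume "\<phi> x = 0"
  then show "x = 0"
    using mult[of x "inverse x"] one by (cases "x = 0") auto
qed (simp add: zero)

lemma inverse: "\<phi> (inverse x) = inverse (\<phi> x)"
proof (cases "x = 0")
  case False
  then show ?thesis
    using mult[of x "inverse x"] one by (simp add: inverse_unique)
qed (simp add: zero)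

lemma divide: "\<phi> (x / y) = \<phi> x / \<phi> y"
  by (simp add: divide_inverse mult inverse)

lemma power: "\<phi> (x ^ n) = \<phi> x ^ n"
  by (induction n) (auto simp: one mult)

lemma sum: "\<phi> (\<Sum>i\<in>I. g i) = (\<Sum>i\<in>I. \<phi> (g i))"
  by (induction I rule: infinite_finite_induct) (auto simp: zero add)

lemma prod_list: "\<phi> (prod_list xs) = prod_list (map \<phi> xs)"
  by (induction xs) (auto simp: one mult)

end

lemma division_ring_hom_comp:
  assumes "division_ring_hom \<phi>" "division_ring_hom \<psi>"
  shows "division_ring_hom (\<phi> \<circ> \<psi>)"
  using assms by (auto simp: division_ring_hom_def)

lemma ring_automorphism_iff_hom:
  "ring_automorphism \<phi> \<longleftrightarrow> bij \<phi> \<and> division_ring_hom \<phi>"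
  by (auto simp: ring_automorphism_def division_ring_hom_def)

section \<open>Fractions in a division ring and extension of maps to them\<close>

lemma divide_mult_mult:
  fixes a b x :: "'a::division_ring"
  assumes "b \<noteq> 0"
  shows "(a / b) * (b * x) = a * x"
proof -
  have "(a / b) * (b * x) = a * (inverse b * b) * x"
    by (simp only: divide_inverse mult.assoc)
  then show ?thesis
    using assms by simp
qed

lemma mult_divide_cancel_right:
  fixes a b x :: "'a::division_ring"
  assumes "x \<noteq> 0"
  shows "(a * x) / (b * x) = a / b"
proof (cases "b = 0")
  case False
  have "(a * x) / (b * x) = a * (x * inverse x) * inverse b"
    by (simp only: divide_inverse nonzero_inverse_mult_distrib[OF False assms] mult.assoc)
  then show ?thesis
    using assms by (simp add: divide_inverse)
qed simp

text \<open>Multiplying by \<open>b\<close> on the left and by \<open>y\<close> on the right removes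
  both inverses. This is the bridge between a left fraction rewritten as a right one and a common
  right multiple.\<close>

lemma left_fraction_eq_iff:
  fixes b d x y :: "'a::division_ring"
  assumes "b \<noteq> 0" "y \<noteq> 0"
  shows "inverse b * d = x / y \<longleftrightarrow> d * y = b * x"
proof -
  have "inverse b * d = x / y \<longleftrightarrow> b * (inverse b * d) * y = b * (x / y) * y"
    using assms by (simp del: times_divide_eq_right)
  also have "b * (inverse b * d) * y = d * y"
    by (simp only: mult.assoc[symmetric] right_inverse[OF assms(1)] mult_1_left)
  also have "b * (x / y) * y = b * x"
    by (simp only: mult.assoc divide_inverse left_inverse[OF assms(2)] mult_1_right)
  finally show ?thesis .
qed

text \<open>The fractions hypothesis contains the Ore condition: writing \<open>B\<inverse> D\<close> as a right fraction
  gives a common right multiple of \<open>B\<close> and \<open>D\<close>.\<close>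

lemma extend_to_fractions:
  fixes E :: "'p \<Rightarrow> 'f::division_ring" and E' :: "'p \<Rightarrow> 'd::division_ring"
  assumes one: "\<exists>z. E z = 1 \<and> E' z = 1"
    and add: "\<And>x y. \<exists>z. E z = E x + E y \<and> E' z = E' x + E' y"
    and diff: "\<And>x y. \<exists>z. E z = E x - E y \<and> E' z = E' x - E' y"
    and mult: "\<And>x y. \<exists>z. E z = E x * E y \<and> E' z = E' x * E' y"
    and null: "\<And>x. E x = 0 \<longleftrightarrow> E' x = 0"
    and fractions: "\<And>f. \<exists>A B. E B \<noteq> 0 \<and> f = E A / E B"
  shows "\<exists>\<phi>. division_ring_hom \<phi> \<and> (\<forall>x. \<phi> (E x) = E' x)"
proof -
  \<comment> \<open>Since the kernels agree, \<open>E'\<close> factors through \<open>E\<close>;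
    applied to products, this transfers every equation between products of values of
    \<open>E\<close> to \<open>E'\<close>.\<close>
  have eq: "E' x = E' y" if "E x = E y" for x y
    using diff[of x y] null that by (metis right_minus_eq)
  have mult_eq: "E' x * E' y = E' u * E' v" if "E x * E y = E u * E v" for x y u v
    using mult[of x y] mult[of u v] eq that by metis
  have frac_eq: "E' A / E' B = E' C / E' D"
    if "E A / E B = E C / E D" "E B \<noteq> 0" "E D \<noteq> 0" for A B C D
  proof -
    obtain X Y where Y: "E Y \<noteq> 0" and XY: "inverse (E B) * E D = E X / E Y"
      using fractions by blast
    have DY: "E D * E Y = E B * E X"
      using XY that Y left_fraction_eq_iff by blast
    then have X: "E X \<noteq> 0"
      using Y that by (metis mult_eq_0_iff)
    have "E A * E X = E A / E B * (E B * E X)"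
      by (rule divide_mult_mult[OF that(2), symmetric])
    also have "\<dots> = E C / E D * (E D * E Y)"
      unfolding that(1) DY ..
    also have "\<dots> = E C * E Y"
      by (rule divide_mult_mult[OF that(3)])
    finally have "E A * E X = E C * E Y" .
    then have "E' A * E' X = E' C * E' Y"
      by (rule mult_eq)
    moreover have "E' D * E' Y = E' B * E' X"
      using DY by (rule mult_eq)
    moreover have "E' B \<noteq> 0" "E' D \<noteq> 0" "E' X \<noteq> 0" "E' Y \<noteq> 0"
      using that X Y null by auto
    ultimately show ?thesis
      by (metis mult_divide_cancel_right)
  qed
  \<comment> \<open>The extension is defined as a relation, "some representation of \<open>f\<close>
    as a fraction has image \<open>y\<close>"; \<open>frac_eq\<close> makes it single-valued, so any
    choice of representation will do.\<close>
  define P where "P f y \<longleftrightarrow> (\<exists>A B. E B \<noteq> 0 \<and> f = E A / E B \<and> y = E' A / E' B)" for f y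
  have ex: "\<exists>y. P f y" for f
    using fractions[of f] unfolding P_def by blast
  have uniq: "y = y'" if "P f y" "P f y'" for f y y'
    using that frac_eq unfolding P_def by metis
  define \<phi> where "\<phi> f = (SOME y. P f y)" for f
  have P\<phi>: "P f (\<phi> f)" for f
    unfolding \<phi>_def using ex by (rule someI_ex)
  have \<phi>_frac: "\<phi> (E A / E B) = E' A / E' B" if "E B \<noteq> 0" for A B
    using uniq P\<phi> that unfolding P_def by blast
  have val: "\<phi> (E x) = E' x" for x
  proof -
    obtain z where "E z = 1" "E' z = 1"
      using one by blast
    then show ?thesis
      using \<phi>_frac[of z x] by simp
  qed
  have hom: "\<phi> (f + g) = \<phi> f + \<phi> g \<and> \<phi> (f * g) = \<phi> f * \<phi> g" for f g
  proof -
    obtain A B where AB: "E B \<noteq> 0" "f = E A / E B"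
      using fractions by blast
    obtain C D where CD: "E D \<noteq> 0" "g = E C / E D"
      using fractions by blast
    have \<phi>f: "\<phi> f = E' A / E' B" and \<phi>g: "\<phi> g = E' C / E' D"
      using AB CD \<phi>_frac by simp_all
    have nz: "E' B \<noteq> 0" "E' D \<noteq> 0"
      using AB CD null by auto
    obtain X Y where Y: "E Y \<noteq> 0" and XY: "inverse (E B) * E D = E X / E Y"
      using fractions by blast
    have DY: "E B * E X = E D * E Y"
      using XY AB Y left_fraction_eq_iff by metis
    have X: "E X \<noteq> 0"
      using DY Y CD by (metis mult_eq_0_iff)
    have DY': "E' B * E' X = E' D * E' Y"
      using DY by (rule mult_eq)
    obtain Z where Z: "E Z = E D * E Y" "E' Z = E' D * E' Y"
      using mult by blast
    obtain M where M: "E M = E A * E X" "E' M = E' A * E' X"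
      using mult by blast
    obtain N where N: "E N = E C * E Y" "E' N = E' C * E' Y"
      using mult by blast
    obtain K where K: "E K = E M + E N" "E' K = E' M + E' N"
      using add by blast
    have nz': "E' X \<noteq> 0" "E' Y \<noteq> 0"
      using X Y null by auto
    \<comment> \<open>Both summands are expanded to the common denominator
      \<open>E B * E X = E D * E Y\<close>.\<close>
    have "f + g = E K / E Z"
      unfolding AB(2) CD(2) mult_divide_cancel_right[OF X, of "E A" "E B", symmetric] 
      mult_divide_cancel_right[OF Y, of "E C" "E D", symmetric] K M N Z DY
      by (simp add: add_divide_distrib)
    moreover have "\<phi> f + \<phi> g = E' K / E' Z"
      unfolding \<phi>f \<phi>g mult_divide_cancel_right[OF nz'(1), of "E' A" "E' B", symmetric] 
      mult_divide_cancel_right[OF nz'(2), of "E' C" "E' D", symmetric] K M N Z DY'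
      by (simp add: add_divide_distrib)
    moreover have "E Z \<noteq> 0"
      using Z CD Y by simp
    ultimately have add: "\<phi> (f + g) = \<phi> f + \<phi> g"
      by (metis \<phi>_frac)
    \<comment> \<open>In a product the inner part \<open>inverse (E B) * E C\<close> is a left
      fraction; rewriting it as a right one makes the whole product a single right fraction.\<close>
    obtain U V where V: "E V \<noteq> 0" and UV: "inverse (E B) * E C = E U / E V"
      using fractions by blast
    have V': "E' V \<noteq> 0"
      using V null by auto
    have "E C * E V = E B * E U"
      using UV AB V left_fraction_eq_iff by blast
    then have "E' C * E' V = E' B * E' U"
      by (rule mult_eq)
    then have UV': "inverse (E' B) * E' C = E' U / E' V"
      using nz V' left_fraction_eq_iff by blast
    obtain R where R: "E R = E A * E U" "E' R = E' A * E' U"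
      using mult by blast
    obtain T where T: "E T = E D * E V" "E' T = E' D * E' V"
      using mult by blast
    have "f * g = E A * (inverse (E B) * E C) * inverse (E D)"
      by (simp add: AB CD divide_inverse mult.assoc)
    also have "\<dots> = E R / E T"
      unfolding UV R T using CD V by (simp add: divide_inverse nonzero_inverse_mult_distrib mult.assoc)
    finally have "f * g = E R / E T" .
    moreover have "\<phi> f * \<phi> g = E' R / E' T"
    proof -
      have "\<phi> f * \<phi> g = E' A * (inverse (E' B) * E' C) * inverse (E' D)"
        by (simp add: \<phi>f \<phi>g divide_inverse mult.assoc)
      also have "\<dots> = E' R / E' T"
        unfolding UV' R T using nz V'
        by (simp add: divide_inverse nonzero_inverse_mult_distrib mult.assoc)
      finally show ?thesis .
    qed
    moreover have "E T \<noteq> 0"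
      using T CD V by simp
    ultimately have "\<phi> (f * g) = \<phi> f * \<phi> g"
      by (metis \<phi>_frac)
    with add show ?thesis by blast
  qed
  have "\<phi> 1 = 1"
    using one val by metis
  with hom have "division_ring_hom \<phi>"
    unfolding division_ring_hom_def by blast
  with val show ?thesis
    by blast
qed

text \<open>An antihomomorphism into a ring is a homomorphism into its opposite ring.\<close>

datatype 'a opp = Opp (unopp: 'a)

instantiation opp :: (division_ring) ring_1
begin

definition zero_opp :: "'a opp" where "0 = Opp 0"
definition one_opp :: "'a opp" where "1 = Opp 1"
definition plus_opp :: "'a opp \<Rightarrow> 'a opp \<Rightarrow> 'a opp" where "x + y = Opp (unopp x + unopp y)"
definition minus_opp :: "'a opp \<Rightarrow> 'a opp \<Rightarrow> 'a opp" where "x - y = Opp (unopp x - unopp y)"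
definition uminus_opp :: "'a opp \<Rightarrow> 'a opp" where "- x = Opp (- unopp x)"
definition times_opp :: "'a opp \<Rightarrow> 'a opp \<Rightarrow> 'a opp" where "x * y = Opp (unopp y * unopp x)"

instance
  by standard
    (auto simp: zero_opp_def one_opp_def plus_opp_def minus_opp_def uminus_opp_def times_opp_def
      algebra_simps)

end

lemma unopp_eq_iff: "unopp x = y \<longleftrightarrow> x = Opp y"
  by (cases x) auto

instantiation opp :: (division_ring) division_ring
begin

definition inverse_opp :: "'a opp \<Rightarrow> 'a opp" where "inverse x = Opp (inverse (unopp x))"
definition divide_opp :: "'a opp \<Rightarrow> 'a opp \<Rightarrow> 'a opp" where
  "x div y = Opp (inverse (unopp y) * unopp x)"

instance
  by standard
    (auto simp: zero_opp_def one_opp_def times_opp_def inverse_opp_def divide_opp_def unopp_eq_iff)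

end

section \<open>Evaluation of polynomials\<close>

lemma sum_keys_superset:
  fixes f :: "'k \<Rightarrow> 'c::zero \<Rightarrow> 'd::comm_monoid_add"
  assumes "finite A" "Poly_Mapping.keys p \<subseteq> A" "\<And>k. f k 0 = 0"
  shows "(\<Sum>k\<in>Poly_Mapping.keys p. f k (Poly_Mapping.lookup p k)) =
    (\<Sum>k\<in>A. f k (Poly_Mapping.lookup p k))"
  using assms by (intro sum.mono_neutral_left) (auto simp: in_keys_iff)

lemma sum_keys_add:
  fixes f :: "'k \<Rightarrow> 'c::comm_monoid_add \<Rightarrow> 'd::comm_monoid_add"
  assumes "\<And>k. f k 0 = 0" "\<And>k x y. f k (x + y) = f k x + f k y"
  shows "(\<Sum>k\<in>Poly_Mapping.keys (p + r). f k (Poly_Mapping.lookup (p + r) k)) =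
    (\<Sum>k\<in>Poly_Mapping.keys p. f k (Poly_Mapping.lookup p k)) +
    (\<Sum>k\<in>Poly_Mapping.keys r. f k (Poly_Mapping.lookup r k))"
proof -
  let ?A = "Poly_Mapping.keys p \<union> Poly_Mapping.keys r"
  have "(\<Sum>k\<in>Poly_Mapping.keys (p + r). f k (Poly_Mapping.lookup (p + r) k)) =
      (\<Sum>k\<in>?A. f k (Poly_Mapping.lookup (p + r) k))"
    using keys_add[of p r] assms(1) by (intro sum_keys_superset) auto
  also have "\<dots> = (\<Sum>k\<in>?A. f k (Poly_Mapping.lookup p k)) + (\<Sum>k\<in>?A. f k (Poly_Mapping.lookup r k))"
    by (simp add: lookup_add assms sum.distrib)
  finally show ?thesis
    using assms(1) by (simp add: sum_keys_superset[of ?A])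
qed

lemma poly_mapping_expansion:
  "p = (\<Sum>k\<in>Poly_Mapping.keys p. Poly_Mapping.single k (Poly_Mapping.lookup p k))"
proof (rule poly_mapping_eqI)
  fix k
  have "(\<Sum>l\<in>Poly_Mapping.keys p. Poly_Mapping.lookup p l when l = k) = Poly_Mapping.lookup p k"
    by (auto simp: when_def sum.delta' in_keys_iff)
  then show "Poly_Mapping.lookup p k = Poly_Mapping.lookup
      (\<Sum>k\<in>Poly_Mapping.keys p. Poly_Mapping.single k (Poly_Mapping.lookup p k)) k"
    by (simp add: lookup_sum lookup_single)
qed

definition meval :: "(node \<Rightarrow> ratfun) \<Rightarrow> (node \<Rightarrow>\<^sub>0 nat) \<Rightarrow> ratfun" where
  "meval y m = (\<Prod>j\<in>UNIV. y j ^ Poly_Mapping.lookup m j)"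

definition peval :: "(node \<Rightarrow> ratfun) \<Rightarrow> ((node \<Rightarrow>\<^sub>0 nat) \<Rightarrow>\<^sub>0 complex) \<Rightarrow> ratfun" where
  "peval y p = (\<Sum>m\<in>Poly_Mapping.keys p. const (Poly_Mapping.lookup p m) * meval y m)"

lemma const_0 [simp]: "const 0 = 0"
  by (simp add: const_def Zero_fract_def)

lemma const_1 [simp]: "const 1 = 1"
  by (simp add: const_def One_fract_def)

lemma const_add: "const (c + d) = const c + const d"
  by (simp add: const_def single_add)

lemma const_mult: "const (c * d) = const c * const d"
  by (simp add: const_def mult_single)

lemma const_eq_0_iff [simp]: "const c = 0 \<longleftrightarrow> c = 0"
  using const_mult[of c "inverse c"] by (cases "c = 0") auto

lemma const_power: "const (c ^ n) = const c ^ n"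
  by (induction n) (auto simp: const_mult)

lemma meval_0 [simp]: "meval y 0 = 1"
  by (simp add: meval_def)

lemma meval_add: "meval y (m + n) = meval y m * meval y n"
  by (simp add: meval_def lookup_add power_add prod.distrib)

lemma meval_single [simp]: "meval y (Poly_Mapping.single j n) = y j ^ n"
proof -
  have "meval y (Poly_Mapping.single j n) = (\<Prod>i\<in>UNIV. if i = j then y j ^ n else 1)"
    unfolding meval_def by (intro prod.cong) (auto simp: lookup_single when_def)
  then show ?thesis by simp
qed

lemma meval_eq_0: "meval y m = 0 \<Longrightarrow> \<exists>j. y j = 0"
  by (auto simp: meval_def)

lemma peval_0 [simp]: "peval y 0 = 0"
  by (simp add: peval_def)

lemma peval_add: "peval y (p + r) = peval y p + peval y r"
  unfolding peval_def by (rule sum_keys_add) (simp_all add: const_add algebra_simps)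

lemma peval_diff: "peval y (p - r) = peval y p - peval y r"
  using peval_add[of y "p - r" r] by simp

lemma peval_sum: "peval y (\<Sum>i\<in>I. f i) = (\<Sum>i\<in>I. peval y (f i))"
  by (induction I rule: infinite_finite_induct) (auto simp: peval_add)

lemma peval_single [simp]: "peval y (Poly_Mapping.single m c) = const c * meval y m"
  by (cases "c = 0") (auto simp: peval_def)

lemma peval_1 [simp]: "peval y 1 = 1"
  by (simp flip: single_one)

lemma peval_mult: "peval y (p * r) = peval y p * peval y r"
proof -
  have "peval y (p * r) = peval y
      ((\<Sum>m\<in>Poly_Mapping.keys p. Poly_Mapping.single m (Poly_Mapping.lookup p m)) *
       (\<Sum>n\<in>Poly_Mapping.keys r. Poly_Mapping.single n (Poly_Mapping.lookup r n)))"
    by (simp flip: poly_mapping_expansion)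
  also have "\<dots> = peval y p * peval y r"
    by (simp add: sum_product peval_sum mult_single const_mult meval_add
      peval_def[of y p] peval_def[of y r] mult_ac)
  finally show ?thesis .
qed

lemma monomial_eq:
  "Poly_Mapping.single m c = Poly_Mapping.single 0 c *
     (\<Prod>j\<in>UNIV. Poly_Mapping.single (Poly_Mapping.single j 1) 1 ^ Poly_Mapping.lookup m j)"
  for m :: "node \<Rightarrow>\<^sub>0 nat" and c :: complex
proof -
  have pow: "Poly_Mapping.single (Poly_Mapping.single j 1) 1 ^ n =
      (Poly_Mapping.single (Poly_Mapping.single j n) 1 :: (node \<Rightarrow>\<^sub>0 nat) \<Rightarrow>\<^sub>0 complex)" for j n
    by (induction n) (auto simp: mult_single simp flip: single_add)
  have prod: "(\<Prod>j\<in>A. Poly_Mapping.single (f j) 1) =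
      (Poly_Mapping.single (\<Sum>j\<in>A. f j) 1 :: (node \<Rightarrow>\<^sub>0 nat) \<Rightarrow>\<^sub>0 complex)" for A :: "node set" and f
    by (induction A rule: infinite_finite_induct) (auto simp: mult_single)
  have m: "m = (\<Sum>j\<in>UNIV. Poly_Mapping.single j (Poly_Mapping.lookup m j))"
    using sum_keys_superset[of UNIV m Poly_Mapping.single] poly_mapping_expansion[of m] by simp
  have "Poly_Mapping.single m c = Poly_Mapping.single 0 c * Poly_Mapping.single m 1"
    by (simp add: mult_single)
  then show ?thesis
    by (subst (asm) (2) m) (simp only: pow prod)
qed

text \<open>Constants and variables generate the polynomial ring, so closure under sums and products
  suffices. This lets the clearing of denominators below be checked on variables only.\<close>

lemma polynomial_induct [case_names const var add mult]:
  fixes p :: "(node \<Rightarrow>\<^sub>0 nat) \<Rightarrow>\<^sub>0 complex"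
  assumes "\<And>c. P (Poly_Mapping.single 0 c)"
    and "\<And>j. P (Poly_Mapping.single (Poly_Mapping.single j 1) 1)"
    and "\<And>p r. P p \<Longrightarrow> P r \<Longrightarrow> P (p + r)"
    and "\<And>p r. P p \<Longrightarrow> P r \<Longrightarrow> P (p * r)"
  shows "P p"
proof -
  have 0: "P 0" and 1: "P 1"
    using assms(1)[of 0] assms(1)[of 1] by simp_all
  have sum: "(\<And>i. i \<in> I \<Longrightarrow> P (f i)) \<Longrightarrow> P (\<Sum>i\<in>I. f i)" for I :: "(node \<Rightarrow>\<^sub>0 nat) set" and f
    by (induction I rule: infinite_finite_induct) (auto intro: 0 assms(3))
  have prod: "(\<And>i. i \<in> I \<Longrightarrow> P (f i)) \<Longrightarrow> P (\<Prod>i\<in>I. f i)" for I :: "node set" and f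
    by (induction I rule: infinite_finite_induct) (auto intro: 1 assms(4))
  have pow: "P p \<Longrightarrow> P (p ^ n)" for p n
    by (induction n) (auto intro: 1 assms(4))
  have "P (Poly_Mapping.single m c)" for m c
    by (subst monomial_eq) (intro assms(4) assms(1) prod pow assms(2))
  then show ?thesis
    by (subst poly_mapping_expansion) (intro sum)
qed

lemma Fract_1_eq_peval: "Fract p 1 = peval a p"
proof (induction p rule: polynomial_induct)
  case (add p r)
  have "Fract (p + r) 1 = Fract p 1 + Fract r 1"
    by simp
  then show ?case
    by (simp only: add peval_add)
next
  case (mult p r)
  have "Fract (p * r) 1 = Fract p 1 * Fract r 1"
    by simp
  then show ?case
    by (simp only: mult peval_mult)
qed (simp_all add: const_def a_def)

lemma a_nonzero [simp]: "a j \<noteq> 0"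
  by (simp add: a_def Zero_fract_def eq_fract) (metis lookup_single_eq lookup_zero zero_neq_one)

lemma peval_a_eq_0_iff: "peval a p = 0 \<longleftrightarrow> p = 0"
  by (simp add: Zero_fract_def eq_fract flip: Fract_1_eq_peval)

lemma ratfun_fraction: "\<exists>p r. peval a r \<noteq> 0 \<and> f = peval a p / peval a r"
proof (cases f)
  case (Fract p r)
  then have "f = Fract p 1 / Fract r 1"
    by simp
  with Fract show ?thesis
    unfolding Fract_1_eq_peval peval_a_eq_0_iff by blast
qed

section \<open>Automorphisms of the parameter field\<close>

lemma hom_peval:
  assumes "division_ring_hom \<phi>" "\<And>c. \<phi> (const c) = const c"
  shows "\<phi> (peval y p) = peval (\<phi> \<circ> y) p"
proof -
  interpret division_ring_hom \<phi> by fact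
  have "\<phi> (\<Prod>j\<in>A. g j) = (\<Prod>j\<in>A. \<phi> (g j))" for A :: "node set" and g
    by (induction A rule: infinite_finite_induct) (auto simp: one mult)
  then show ?thesis
    by (simp add: peval_def meval_def sum mult assms(2) power)
qed

lemma ratfun_hom_eqI:
  assumes "division_ring_hom \<phi>" "division_ring_hom \<psi>"
    and "\<And>c. \<phi> (const c) = const c" "\<And>c. \<psi> (const c) = const c"
    and "\<And>j. \<phi> (a j) = \<psi> (a j)"
  shows "\<phi> = \<psi>"
proof
  fix f
  have "\<phi> (peval a p) = \<psi> (peval a p)" for p
    using assms by (simp add: hom_peval comp_def)
  then show "\<phi> f = \<psi> f"
    using ratfun_fraction[of f] division_ring_hom.divide[OF assms(1)]
      division_ring_hom.divide[OF assms(2)] by metis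
qed

text \<open>The hypothesis says that substituting \<open>y\<close> twice gives the identity, with the denominators of
  the \<open>y j\<close> cleared. The same holds for every polynomial, so the substitution is injective
  and extends to rational functions.\<close>

lemma param_aut_involution:
  assumes nz: "\<And>j. y j \<noteq> 0"
    and inv: "\<And>j. \<exists>\<mu> \<nu>. y j * meval a \<mu> = meval a \<nu> \<and> meval y \<nu> = a j * meval y \<mu>"
  shows "ring_automorphism (param_aut y)" "param_aut y (const c) = const c"
    "param_aut y (a j) = y j" "param_aut y \<circ> param_aut y = id"
proof -
  have clear: "\<exists>\<mu> p'. peval y p * meval a \<mu> = peval a p' \<and> peval y p' = peval a p * meval y \<mu>" for p
  proof (induction p rule: polynomial_induct)
    case (const c)
    show ?case
      by (intro exI[of _ 0] exI[of _ "Poly_Mapping.single 0 c"]) simp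
  next
    case (var j)
    obtain \<mu> \<nu> where "y j * meval a \<mu> = meval a \<nu>" "meval y \<nu> = a j * meval y \<mu>"
      using inv by blast
    then show ?case
      by (intro exI[of _ \<mu>] exI[of _ "Poly_Mapping.single \<nu> 1"]) simp
  next
    case (add p r)
    then obtain \<mu> p' \<nu> r' where p: "peval y p * meval a \<mu> = peval a p'" "peval y p' = peval a p * meval y \<mu>"
      and r: "peval y r * meval a \<nu> = peval a r'" "peval y r' = peval a r * meval y \<nu>"
      by blast
    let ?p = "p' * Poly_Mapping.single \<nu> 1 + r' * Poly_Mapping.single \<mu> 1"
    have "peval y (p + r) * meval a (\<mu> + \<nu>) = peval a ?p"
      by (simp add: peval_add peval_mult meval_add flip: p(1) r(1); simp add: algebra_simps)
    moreover have "peval y ?p = peval a (p + r) * meval y (\<mu> + \<nu>)"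
      by (simp add: peval_add peval_mult meval_add p(2) r(2); simp add: algebra_simps)
    ultimately show ?case
      by blast
  next
    case (mult p r)
    then obtain \<mu> p' \<nu> r' where p: "peval y p * meval a \<mu> = peval a p'" "peval y p' = peval a p * meval y \<mu>"
      and r: "peval y r * meval a \<nu> = peval a r'" "peval y r' = peval a r * meval y \<nu>"
      by blast
    have "peval y (p * r) * meval a (\<mu> + \<nu>) = peval a (p' * r')"
      by (simp add: peval_mult meval_add flip: p(1) r(1); simp add: algebra_simps)
    moreover have "peval y (p' * r') = peval a (p * r) * meval y (\<mu> + \<nu>)"
      by (simp add: peval_mult meval_add p(2) r(2); simp add: algebra_simps)
    ultimately show ?case
      by blast
  qed
  have mnz: "meval y \<mu> \<noteq> 0" "meval a \<mu> \<noteq> 0" for \<mu>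
    using meval_eq_0 nz a_nonzero by metis+
  have null: "peval a p = 0 \<longleftrightarrow> peval y p = 0" for p
  proof -
    obtain \<mu> p' where p: "peval y p * meval a \<mu> = peval a p'" "peval y p' = peval a p * meval y \<mu>"
      using clear by blast
    have "peval y p = 0 \<Longrightarrow> p' = 0"
      using p(1) by (simp add: peval_a_eq_0_iff[of p', symmetric])
    then show ?thesis
      using p(2) mnz by (auto simp: peval_a_eq_0_iff)
  qed
  have "\<exists>\<phi>. division_ring_hom \<phi> \<and> (\<forall>p. \<phi> (peval a p) = peval y p)"
    by (rule extend_to_fractions)
      (use null ratfun_fraction peval_1 peval_add peval_diff peval_mult in blast)+
  then obtain \<phi> where \<phi>: "division_ring_hom \<phi>" "\<And>p. \<phi> (peval a p) = peval y p"
    by blast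
  interpret division_ring_hom \<phi> by fact
  have c: "\<phi> (const c) = const c" for c
    using \<phi>(2)[of "Poly_Mapping.single 0 c"] by simp
  have m: "\<phi> (meval a \<mu>) = meval y \<mu>" for \<mu>
    using \<phi>(2)[of "Poly_Mapping.single \<mu> 1"] by simp
  have aj: "\<phi> (a j) = y j" for j
    using m[of "Poly_Mapping.single j 1"] by simp
  have "\<phi> \<circ> \<phi> = id"
  proof (rule ratfun_hom_eqI)
    fix j
    obtain \<mu> \<nu> where "y j * meval a \<mu> = meval a \<nu>" "meval y \<nu> = a j * meval y \<mu>"
      using inv by blast
    \<comment> \<open>Applying \<open>\<phi>\<close> to the first equation turns monomials in
      \<open>a\<close> into monomials in \<open>y\<close>; the second equation then identifies the
      result with \<open>a j\<close>.\<close>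
    then have "\<phi> (y j) * meval y \<mu> = a j * meval y \<mu>"
      by (metis m mult)
    then show "(\<phi> \<circ> \<phi>) (a j) = id (a j)"
      using mnz by (simp add: aj)
  qed (use c \<phi> in \<open>auto intro: division_ring_hom_comp simp: division_ring_hom_def\<close>)
  then have "bij \<phi>"
    by (rule o_bij) fact
  then have aut: "ring_automorphism \<phi>"
    using \<phi> by (simp add: ring_automorphism_iff_hom)
  have "param_aut y = \<phi>"
    unfolding param_aut_def
    by (rule the_equality) (use aut c aj \<phi> in \<open>auto simp: ring_automorphism_iff_hom intro: ratfun_hom_eqI\<close>)
  then show "ring_automorphism (param_aut y)" "param_aut y (const c) = const c"
    "param_aut y (a j) = y j" "param_aut y \<circ> param_aut y = id"
    using aut c aj \<open>\<phi> \<circ> \<phi> = id\<close> by simp_all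
qed

section \<open>The generators acting on the parameters, and the null root\<close>

lemma node_cases:
  obtains "j = (0::node)" | "j = 1" | "j = 2" | "j = 3" | "j = 4" | "j = 5"
proof (cases j)
  case (of_int z)
  then have "z \<in> {0, 1, 2, 3, 4, 5}" by auto
  with of_int that show ?thesis by auto
qed

lemma meval_a_eq_iff: "meval a m = meval a n \<longleftrightarrow> m = n"
proof
  assume "meval a m = meval a n"
  then have "peval a (Poly_Mapping.single m 1 - Poly_Mapping.single n 1) = 0"
    by (simp add: peval_diff)
  then have "Poly_Mapping.single m (1::complex) = Poly_Mapping.single n 1"
    by (simp add: peval_a_eq_0_iff)
  then show "m = n"
    by (metis lookup_single_eq lookup_single_not_eq zero_neq_one)
qed simp

lemma a_eq_meval: "a j = meval a (Poly_Mapping.single j 1)"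
  by simp

lemma a_inject [simp]: "a i = a j \<longleftrightarrow> i = j"
proof
  assume "a i = a j"
  then have "Poly_Mapping.single i (1::nat) = Poly_Mapping.single j 1"
    by (simp add: a_eq_meval meval_a_eq_iff del: meval_single)
  then show "i = j"
    by (metis lookup_single_eq lookup_single_not_eq zero_neq_one)
qed simp

text \<open>Distinct monomials have distinct values, and this one has a positive exponent. Both uses
  of positivity end here: \<open>\<delta>\<close> is not its own inverse, and no \<open>a j\<close>
  is the inverse of a monomial.\<close>

lemma a_mult_meval_neq_1: "a j * meval a m \<noteq> 1"
proof
  assume "a j * meval a m = 1"
  then have "meval a (Poly_Mapping.single j 1 + m) = meval a 0"
    by (simp add: meval_add)
  then have "Poly_Mapping.lookup (Poly_Mapping.single j 1 + m) j = 0"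
    unfolding meval_a_eq_iff by simp
  then show False
    by (simp add: lookup_add)
qed

lemma s_props:
  shows ring_automorphism_s: "ring_automorphism (s i)"
    and s_const: "s i (const c) = const c"
    and s_a: "s i (a j) = (if i = j then inverse (a j) else if joined i j then a i * a j else a j)"
    and s_s: "s i \<circ> s i = id"
proof -
  define y where "y = (\<lambda>j. a i powi (- cartan i j) * a j)"
  have y: "y j = (if i = j then inverse (a j) else if joined i j then a i * a j else a j)" for j
    by (simp add: y_def cartan_def power_int_def nat_numeral power2_eq_square)
  have "y j \<noteq> 0" for j
    by (simp add: y)
  moreover have "\<exists>\<mu> \<nu>. y j * meval a \<mu> = meval a \<nu> \<and> meval y \<nu> = a j * meval y \<mu>" for j
  proof -
    consider "i = j" | "i \<noteq> j" "joined i j" | "i \<noteq> j" "\<not> joined i j"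
      by blast
    then show ?thesis
    proof cases
      case 1
      then show ?thesis
        by (intro exI[of _ "Poly_Mapping.single j 1"] exI[of _ 0]) (simp add: y)
    next
      case 2
      then show ?thesis
        \<comment> \<open>Here \<open>y j\<close> is already the monomial \<open>a i * a j\<close>;
          substituting \<open>y\<close> into it gives \<open>inverse (a i) * (a i * a j)\<close>,
          which is \<open>a j\<close>.\<close>
        by (intro exI[of _ 0] exI[of _ "Poly_Mapping.single i 1 + Poly_Mapping.single j 1"])
          (simp add: y meval_add)
    next
      case 3
      then show ?thesis
        by (intro exI[of _ 0] exI[of _ "Poly_Mapping.single j 1"]) (simp add: y)
    qed
  qed
  ultimately show "ring_automorphism (s i)" "s i (const c) = const c"
    "s i (a j) = (if i = j then inverse (a j) else if joined i j then a i * a j else a j)"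
    "s i \<circ> s i = id"
    unfolding s_def y_def[symmetric] y[symmetric] by (intro param_aut_involution; simp)+
qed

text \<open>The three diagram maps all invert the variables along an involution of the nodes, so one
  witness serves them: multiplying \<open>y j\<close> by \<open>a (\<pi> j)\<close> gives the
  constant monomial.\<close>

lemma inverse_permutation_props:
  assumes "\<And>j. \<pi> (\<pi> j) = j"
  defines "\<phi> \<equiv> param_aut (\<lambda>j. inverse (a (\<pi> j)))"
  shows "ring_automorphism \<phi>" "\<phi> (const c) = const c" "\<phi> (a j) = inverse (a (\<pi> j))"
    "\<phi> \<circ> \<phi> = id"
proof -
  let ?y = "\<lambda>j. inverse (a (\<pi> j))"
  have inv: "\<exists>\<mu> \<nu>. ?y j * meval a \<mu> = meval a \<nu> \<and> meval ?y \<nu> = a j * meval ?y \<mu>" for j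
    by (intro exI[of _ "Poly_Mapping.single (\<pi> j) 1"] exI[of _ 0]) (simp add: assms(1))
  show "ring_automorphism \<phi>" "\<phi> (const c) = const c" "\<phi> (a j) = inverse (a (\<pi> j))"
    "\<phi> \<circ> \<phi> = id"
    unfolding \<phi>_def by (rule param_aut_involution[where y = ?y]; use inv in simp)+
qed

lemma \<sigma>01_props:
  shows ring_automorphism_\<sigma>01: "ring_automorphism \<sigma>01"
    and \<sigma>01_const: "\<sigma>01 (const c) = const c"
    and \<sigma>01_a: "\<sigma>01 (a j) = inverse (a (if j = 0 then 1 else if j = 1 then 0 else j))"
    and \<sigma>01_\<sigma>01: "\<sigma>01 \<circ> \<sigma>01 = id"
proof -
  let ?\<pi> = "\<lambda>j::node. if j = 0 then 1 else if j = 1 then 0 else j"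
  have "\<sigma>01 = param_aut (\<lambda>j. inverse (a (?\<pi> j)))"
    unfolding \<sigma>01_def by (rule arg_cong[where f = param_aut]) auto
  then show "ring_automorphism \<sigma>01" "\<sigma>01 (const c) = const c"
    "\<sigma>01 (a j) = inverse (a (?\<pi> j))" "\<sigma>01 \<circ> \<sigma>01 = id"
    using inverse_permutation_props[of ?\<pi>] by simp_all
qed

lemma \<sigma>45_props:
  shows ring_automorphism_\<sigma>45: "ring_automorphism \<sigma>45"
    and \<sigma>45_const: "\<sigma>45 (const c) = const c"
    and \<sigma>45_a: "\<sigma>45 (a j) = inverse (a (if j = 4 then 5 else if j = 5 then 4 else j))"
    and \<sigma>45_\<sigma>45: "\<sigma>45 \<circ> \<sigma>45 = id"
proof -
  let ?\<pi> = "\<lambda>j::node. if j = 4 then 5 else if j = 5 then 4 else j"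
  have "\<sigma>45 = param_aut (\<lambda>j. inverse (a (?\<pi> j)))"
    unfolding \<sigma>45_def by (rule arg_cong[where f = param_aut]) auto
  then show "ring_automorphism \<sigma>45" "\<sigma>45 (const c) = const c"
    "\<sigma>45 (a j) = inverse (a (?\<pi> j))" "\<sigma>45 \<circ> \<sigma>45 = id"
    using inverse_permutation_props[of ?\<pi>] by simp_all
qed

lemma \<tau>_props:
  shows ring_automorphism_\<tau>: "ring_automorphism \<tau>"
    and \<tau>_const: "\<tau> (const c) = const c"
    and \<tau>_a: "\<tau> (a j) = inverse (a (5 - j))"
    and \<tau>_\<tau>: "\<tau> \<circ> \<tau> = id"
  unfolding \<tau>_def by (rule inverse_permutation_props[where \<pi> = "\<lambda>j. 5 - j"]; simp)+

text \<open>The null root of the affine diagram, written multiplicatively: twice the exponent at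
  each node is the sum of the exponents at its neighbours, which is why reflections fix it.\<close>

definition \<delta> :: ratfun where
  "\<delta> = a 0 * a 1 * (a 2)\<^sup>2 * (a 3)\<^sup>2 * a 4 * a 5"

lemma s_\<delta>: "s i \<delta> = \<delta>"
proof -
  interpret division_ring_hom "s i"
    using ring_automorphism_s by (simp add: ring_automorphism_iff_hom)
  have "s i \<delta> = s i (a 0) * s i (a 1) * (s i (a 2))\<^sup>2 * (s i (a 3))\<^sup>2 * s i (a 4) * s i (a 5)"
    by (simp add: \<delta>_def mult power)
  then show ?thesis
    by (cases i rule: node_cases)
      (simp_all add: \<delta>_def s_a joined_def doubleton_eq_iff field_simps power2_eq_square)
qed

lemma \<delta>_nonzero: "\<delta> \<noteq> 0"
  by (simp add: \<delta>_def)

lemma \<delta>_neq_inverse: "inverse \<delta> \<noteq> \<delta>"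
proof
  assume "inverse \<delta> = \<delta>"
  then have "\<delta> * \<delta> = 1"
    using \<delta>_nonzero by (metis right_inverse)
  moreover have "\<delta> = a 0 * meval a (Poly_Mapping.single 1 1 + Poly_Mapping.single 2 2 +
      Poly_Mapping.single 3 2 + Poly_Mapping.single 4 1 + Poly_Mapping.single 5 1)" (is "_ = _ * meval a ?m")
    by (simp add: \<delta>_def meval_add mult_ac)
  ultimately have "a 0 * meval a (Poly_Mapping.single 0 1 + ?m + ?m) = 1"
    by (simp add: meval_add mult_ac)
  then show False
    using a_mult_meval_neq_1 by blast
qed

section \<open>Evaluation of the free algebra\<close>

text \<open>The target is merely a ring, so that commutative models of the relations, such as
  polynomials over the parameters, are covered together with the skew field and its
  opposite.\<close>

locale central_embedding =
  fixes \<eta> :: "'k::field \<Rightarrow> 'd::ring_1"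
  assumes one: "\<eta> 1 = 1"
    and add: "\<eta> (x + y) = \<eta> x + \<eta> y"
    and mult: "\<eta> (x * y) = \<eta> x * \<eta> y"
    and central: "\<eta> x * f = f * \<eta> x"
begin

lemma zero: "\<eta> 0 = 0"
  using add[of 0 0] by simp

lemma sum: "\<eta> (\<Sum>i\<in>I. g i) = (\<Sum>i\<in>I. \<eta> (g i))"
  by (induction I rule: infinite_finite_induct) (auto simp: zero add)

lemma power: "\<eta> (x ^ n) = \<eta> x ^ n"
  by (induction n) (auto simp: one mult)

lemma eq_0_iff: "\<eta> x = 0 \<longleftrightarrow> x = 0"
proof
  assume "\<eta> x = 0"
  then show "x = 0"
    using mult[of x "inverse x"] one by (cases "x = 0") auto
qed (simp add: zero)

lemma eq_iff: "\<eta> x = \<eta> y \<longleftrightarrow> x = y"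
  using add[of "x - y" y] eq_0_iff[of "x - y"] by auto

lemma free_eval_0: "free_eval \<eta> x 0 = 0"
  by (simp add: free_eval_def)

lemma free_eval_add: "free_eval \<eta> x (p + r) = free_eval \<eta> x p + free_eval \<eta> x r"
  unfolding free_eval_def by (rule sum_keys_add) (simp_all add: zero add algebra_simps)

lemma free_eval_diff: "free_eval \<eta> x (p - r) = free_eval \<eta> x p - free_eval \<eta> x r"
  using free_eval_add[of x "p - r" r] by simp

lemma free_eval_sum: "free_eval \<eta> x (\<Sum>i\<in>I. f i) = (\<Sum>i\<in>I. free_eval \<eta> x (f i))"
  by (induction I rule: infinite_finite_induct) (auto simp: free_eval_0 free_eval_add)

lemma free_eval_single: "free_eval \<eta> x (Poly_Mapping.single w c) = \<eta> c * prod_list (map x w)"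
  by (cases "c = 0") (auto simp: free_eval_def zero)

lemma free_eval_word_mult:
  "free_eval \<eta> x (word_mult c u r v) =
    \<eta> c * prod_list (map x u) * free_eval \<eta> x r * prod_list (map x v)"
proof -
  have "\<eta> (c * d) * (U * (w * V)) = \<eta> c * U * (\<eta> d * w) * V" for d U w V
    by (simp add: mult mult.assoc central[of d U] central[of d "U * _"])
      (metis central mult.assoc)
  then show ?thesis
    by (simp add: word_mult_def free_eval_sum free_eval_single free_eval_def[of \<eta> x r]
        sum_distrib_left sum_distrib_right)
qed

text \<open>The sum is the product of \<open>p\<close> and \<open>r\<close> by concatenation of
  words. It supplies the witness for closure under multiplication in
  \<open>extend_to_fractions\<close>.\<close>

lemma free_eval_product:
  "free_eval \<eta> x (\<Sum>w\<in>Poly_Mapping.keys p. word_mult (Poly_Mapping.lookup p w) w r []) =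
    free_eval \<eta> x p * free_eval \<eta> x r"
  by (simp add: free_eval_sum free_eval_word_mult free_eval_def[of \<eta> x p] sum_distrib_right)

lemma free_eval_ideal:
  assumes "p \<in> two_sided_ideal R" "\<And>r. r \<in> R \<Longrightarrow> free_eval \<eta> x r = 0"
  shows "free_eval \<eta> x p = 0"
  using assms by (induction rule: two_sided_ideal.induct)
    (auto simp: free_eval_0 free_eval_add free_eval_word_mult)

end

lemma two_sided_ideal_generator: "r \<in> R \<Longrightarrow> r \<in> two_sided_ideal R"
  using two_sided_ideal.add[OF two_sided_ideal.zero, of r R 1 "[]" "[]"]
  by (simp add: word_mult_def flip: poly_mapping_expansion)

text \<open>One half of the universal property of the presented algebra: in any ring, elements that
  satisfy the relations annihilate the ideal.\<close>

lemma free_eval_quantum_ideal: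
  fixes \<eta> :: "ratfun \<Rightarrow> 'd::ring_1"
  assumes "central_embedding \<eta>" "p \<in> two_sided_ideal (quantum_relations \<kappa>)"
    and "Q * X = X * Q" "Q * Y = Y * Q" "X * Y = Q * Y * X"
    and "\<And>c. \<kappa> = Complex_parameter c \<Longrightarrow> Q = \<eta> (const c)"
  shows "free_eval \<eta> (case_letter Q X Y) p = 0"
proof -
  interpret central_embedding \<eta> by fact
  have "X * Y = Q * (Y * X)"
    using assms(5) by (simp add: mult.assoc)
  with assms(3,4,6) show ?thesis
    by (intro free_eval_ideal[OF assms(2)])
      (auto simp: quantum_relations_def free_eval_diff free_eval_single one split: q_kind.splits)
qed

text \<open>The classical elimination, for twisted eigenvectors: replacing \<open>x i\<close> by
  \<open>(c i - c k) * x i\<close> removes the vector \<open>x k\<close>. The other vectors keep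
  their eigenvalues because the scalars \<open>c i\<close> commute with \<open>g\<close> and with
  each other.\<close>

lemma eigenvectors_independent:
  fixes x c :: "'i \<Rightarrow> 'd::division_ring"
  assumes "finite A" "(\<Sum>i\<in>A. x i) = 0" "g \<noteq> 0" "inj_on c A"
    and "\<And>i. i \<in> A \<Longrightarrow> x i * g = c i * g * x i"
    and "\<And>i. i \<in> A \<Longrightarrow> c i * g = g * c i"
    and "\<And>i j. i \<in> A \<Longrightarrow> j \<in> A \<Longrightarrow> c i * c j = c j * c i"
    and "i \<in> A"
  shows "x i = 0"
  using assms
proof (induction A arbitrary: x i rule: finite_induct)
  case (insert k A)
  define y where "y i = (c i - c k) * x i" for i
  \<comment> \<open>Both terms vanish, and their difference is \<open>g\<close> times the sum of the
    \<open>y i\<close>, in which \<open>y k\<close> is zero.\<close>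
  have "0 = (\<Sum>i\<in>insert k A. x i) * g - c k * g * (\<Sum>i\<in>insert k A. x i)"
    using insert.prems by simp
  also have "\<dots> = (\<Sum>i\<in>insert k A. x i * g - c k * g * x i)"
    by (simp only: sum_distrib_right sum_distrib_left sum_subtractf)
  also have "\<dots> = (\<Sum>i\<in>insert k A. g * y i)"
  proof (rule sum.cong)
    fix i
    assume "i \<in> insert k A"
    then have "x i * g - c k * g * x i = g * c i * x i - g * c k * x i"
      using insert.prems(4)[of i] insert.prems(5)[of i] insert.prems(5)[of k] by simp
    then show "x i * g - c k * g * x i = g * y i"
      by (simp add: y_def left_diff_distrib right_diff_distrib mult.assoc)
  qed simp
  also have "\<dots> = g * (\<Sum>i\<in>A. y i)"
    using insert.hyps by (simp add: y_def sum_distrib_left)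
  finally have sum_y: "(\<Sum>i\<in>A. y i) = 0"
    using insert.prems by simp
  have "y i = 0" if "i \<in> A" for i
  proof (rule insert.IH[OF sum_y])
    show "y j * g = c j * g * y j" if "j \<in> A" for j
    proof -
      have "y j * g = (c j - c k) * (c j * g * x j)"
        using insert.prems that by (simp add: y_def mult.assoc)
      also have "\<dots> = ((c j - c k) * c j * g) * x j"
        by (simp add: mult.assoc)
      also have "(c j - c k) * c j * g = c j * g * (c j - c k)"
      proof -
        have "c k * c j * g = c j * (c k * g)"
          using insert.prems(6)[of j k] that by (simp add: mult.assoc[symmetric])
        moreover have "g * c k = c k * g" "g * c j = c j * g"
          using insert.prems(5)[of j] insert.prems(5)[of k] that by simp_all
        ultimately have "c k * c j * g = c j * g * c k" "c j * c j * g = c j * g * c j"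
          by (simp_all add: mult.assoc)
        then show ?thesis
          by (simp only: left_diff_distrib right_diff_distrib)
      qed
      finally show ?thesis
        by (simp add: y_def mult.assoc)
    qed
  qed (use insert.prems that in \<open>auto simp: inj_on_def\<close>)
  then have *: "x i = 0" if "i \<in> A" for i
    using that insert.prems(3) insert.hyps by (auto simp: y_def inj_on_def)
  then have "x k = 0"
    using insert.prems(1) insert.hyps by simp
  with * insert.prems show ?case
    by blast
qed simp

section \<open>The kernel of an evaluation at a q-commuting pair\<close>

text \<open>The exponent of \<open>q\<close> after sorting a word into the order \<open>q\<close>,
  \<open>G\<close>, \<open>F\<close>: every letter \<open>q\<close> counts, and so does every pair
  of an \<open>F\<close> standing to the left of a \<open>G\<close>.\<close>

primrec q_degree :: "letter list \<Rightarrow> nat" where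
  "q_degree [] = 0"
| "q_degree (l # w) = q_degree w +
    (case l of Letter_q \<Rightarrow> 1 | Letter_F \<Rightarrow> count_list w Letter_G | Letter_G \<Rightarrow> 0)"

text \<open>Besides the original letters, this describes the images of the letters under a
  prospective lift, with a twisted embedding of the parameters; for antiautomorphisms the target is
  the opposite ring.\<close>

locale quantum_torus = central_embedding \<eta> for \<eta> :: "ratfun \<Rightarrow> 'd::division_ring" +
  fixes Q X Y :: 'd
  assumes QX: "Q * X = X * Q" and QY: "Q * Y = Y * Q" and XY: "X * Y = Q * Y * X"
    and X_nonzero: "X \<noteq> 0" and Y_nonzero: "Y \<noteq> 0"
    and Q_not_root: "n > 0 \<Longrightarrow> Q ^ n \<noteq> 1"
begin

lemma Q_nonzero: "Q \<noteq> 0"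
  using XY X_nonzero Y_nonzero by auto

lemma inj_Q_power: "inj (\<lambda>n. Q ^ n)"
proof (rule injI)
  have "Q ^ m \<noteq> Q ^ n" if "m < n" for m n
  proof -
    have "Q ^ n = Q ^ m * Q ^ (n - m)"
      using that by (simp flip: power_add)
    then show ?thesis
      using Q_not_root[of "n - m"] that Q_nonzero by auto
  qed
  then show "m = n" if "Q ^ m = Q ^ n" for m n
    using that by (metis linorder_neq_iff)
qed

lemma commute_power: "A ^ n * B = B * A ^ n" if "A * B = B * A" for A B :: 'd
  using that by (induction n) (simp_all add: mult.assoc, metis mult.assoc)

lemma X_Y_power: "X * Y ^ n = Q ^ n * Y ^ n * X"
proof (induction n)
  case (Suc n)
  have "X * Y ^ Suc n = Q * Y * (X * Y ^ n)"
    using XY by (simp add: mult.assoc[symmetric])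
  also have "\<dots> = Q * (Y * Q ^ n) * Y ^ n * X"
    unfolding Suc by (simp add: mult.assoc)
  also have "Y * Q ^ n = Q ^ n * Y"
    using commute_power[OF QY] by simp
  finally show ?case
    by (simp add: mult.assoc)
qed simp

lemma X_power_Y: "X ^ n * Y = Q ^ n * Y * X ^ n"
proof (induction n)
  case (Suc n)
  have "X ^ Suc n * Y = X * (Q ^ n * Y) * X ^ n"
    using Suc by (simp add: mult.assoc)
  also have "X * (Q ^ n * Y) = Q ^ n * (X * Y)"
    using commute_power[OF QX] by (metis mult.assoc)
  finally show ?case
    by (simp add: XY mult.assoc[symmetric] power_commutes)
qed simp

lemma word_normal_form:
  "prod_list (map (case_letter Q X Y) w) =
    Q ^ q_degree w * Y ^ count_list w Letter_G * X ^ count_list w Letter_F"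
proof (induction w)
  case (Cons l w)
  let ?e = "q_degree w" and ?m = "count_list w Letter_G" and ?n = "count_list w Letter_F"
  show ?case
  proof (cases l)
    case Letter_q
    then show ?thesis
      using Cons by (simp add: mult.assoc)
  next
    case Letter_F
    have "X * (Q ^ ?e * Y ^ ?m * X ^ ?n) = Q ^ ?e * (X * Y ^ ?m) * X ^ ?n"
      using commute_power[OF QX] by (metis mult.assoc)
    also have "\<dots> = Q ^ (?e + ?m) * Y ^ ?m * X ^ Suc ?n"
      by (simp add: X_Y_power power_add mult.assoc)
    finally show ?thesis
      using Letter_F Cons by simp
  next
    case Letter_G
    have "Y * (Q ^ ?e * Y ^ ?m * X ^ ?n) = Q ^ ?e * Y ^ Suc ?m * X ^ ?n"
      using commute_power[OF QY, of ?e] by (simp add: mult.assoc[symmetric])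
    then show ?thesis
      using Letter_G Cons by simp
  qed
qed simp

text \<open>The coefficient of \<open>Y ^ m * X ^ n\<close> in the sorted form of \<open>p\<close>,
  a polynomial expression in \<open>Q\<close>. Neither \<open>X\<close> nor \<open>Y\<close> enters,
  which makes kernels for different pairs comparable.\<close>

definition coeff_sum :: "(letter list \<Rightarrow>\<^sub>0 ratfun) \<Rightarrow> nat \<Rightarrow> nat \<Rightarrow> 'd" where
  "coeff_sum p m n = (\<Sum>w\<in>{w \<in> Poly_Mapping.keys p. count_list w Letter_G = m \<and> count_list w Letter_F = n}.
     \<eta> (Poly_Mapping.lookup p w) * Q ^ q_degree w)"

lemma coeff_sum_commute:
  assumes "Q * Z = Z * Q"
  shows "coeff_sum p m n * Z = Z * coeff_sum p m n"
proof -
  have "\<eta> c * Q ^ e * Z = Z * (\<eta> c * Q ^ e)" for c e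
    using commute_power[OF assms, of e] central[of c Z] by (metis mult.assoc)
  then show ?thesis
    by (simp add: coeff_sum_def sum_distrib_left sum_distrib_right)
qed

lemma free_eval_normal_form:
  obtains N where "free_eval \<eta> (case_letter Q X Y) p =
      (\<Sum>n\<le>N. (\<Sum>m\<le>N. coeff_sum p m n * Y ^ m) * X ^ n)"
    and "\<And>m n. m > N \<or> n > N \<Longrightarrow> coeff_sum p m n = 0"
proof -
  let ?K = "Poly_Mapping.keys p"
  let ?t = "\<lambda>w. \<eta> (Poly_Mapping.lookup p w) * Q ^ q_degree w"
  \<comment> \<open>Letter counts are bounded by word lengths, so the sorted sum fits into a square.
    The inserted 0 keeps the maximum defined when \<open>p\<close> is zero.\<close>
  define N where "N = Max (insert 0 (length ` ?K))"
  have N: "count_list w l \<le> N" if "w \<in> ?K" for w l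
  proof -
    have "length w \<le> N"
      unfolding N_def using that by (intro Max_ge) auto
    then show ?thesis
      using count_le_length[of w l] by simp
  qed
  have "free_eval \<eta> (case_letter Q X Y) p =
      (\<Sum>w\<in>?K. ?t w * Y ^ count_list w Letter_G * X ^ count_list w Letter_F)"
    by (simp add: free_eval_def word_normal_form mult.assoc)
  also have "\<dots> = (\<Sum>n\<le>N. \<Sum>w\<in>{w \<in> ?K. count_list w Letter_F = n}.
      ?t w * Y ^ count_list w Letter_G * X ^ count_list w Letter_F)"
    by (rule sum.group[symmetric]) (auto simp: N)
  also have "\<dots> = (\<Sum>n\<le>N. (\<Sum>m\<le>N. coeff_sum p m n * Y ^ m) * X ^ n)"
  proof (rule sum.cong)
    fix n
    let ?Kn = "{w \<in> ?K. count_list w Letter_F = n}"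
    have "(\<Sum>w\<in>?Kn. ?t w * Y ^ count_list w Letter_G) =
        (\<Sum>m\<le>N. \<Sum>w\<in>{w \<in> ?Kn. count_list w Letter_G = m}. ?t w * Y ^ count_list w Letter_G)"
      by (rule sum.group[symmetric]) (auto simp: N)
    also have "\<dots> = (\<Sum>m\<le>N. coeff_sum p m n * Y ^ m)"
      unfolding coeff_sum_def sum_distrib_right by (intro sum.cong) auto
    finally show "(\<Sum>w\<in>?Kn. ?t w * Y ^ count_list w Letter_G * X ^ count_list w Letter_F) =
        (\<Sum>m\<le>N. coeff_sum p m n * Y ^ m) * X ^ n"
      by (simp add: sum_distrib_right[symmetric])
  qed simp
  finally show ?thesis
  proof (rule that)
    fix m n
    assume "m > N \<or> n > N"
    then have "{w \<in> ?K. count_list w Letter_G = m \<and> count_list w Letter_F = n} = {}"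
      using N by (auto simp: not_le[symmetric])
    then show "coeff_sum p m n = 0"
      unfolding coeff_sum_def by (simp only: sum.empty)
  qed
qed

text \<open>Independence is applied twice. Against \<open>Y\<close>, the terms
  \<open>r n * X ^ n\<close> have eigenvalues \<open>Q ^ n\<close>, which separates the powers of
  \<open>X\<close> while the coefficients are still polynomials in \<open>Y\<close>. Against
  \<open>X\<close>, the remaining terms have eigenvalues \<open>inverse (Q ^ m)\<close>, which
  separates the powers of \<open>Y\<close>.\<close>

lemma free_eval_eq_0_iff:
  "free_eval \<eta> (case_letter Q X Y) p = 0 \<longleftrightarrow> (\<forall>m n. coeff_sum p m n = 0)"
proof -
  obtain N where nf: "free_eval \<eta> (case_letter Q X Y) p =
      (\<Sum>n\<le>N. (\<Sum>m\<le>N. coeff_sum p m n * Y ^ m) * X ^ n)"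
    and N: "\<And>m n. m > N \<or> n > N \<Longrightarrow> coeff_sum p m n = 0"
    by (rule free_eval_normal_form[of p]) blast
  have "coeff_sum p m n = 0" if "free_eval \<eta> (case_letter Q X Y) p = 0" "m \<le> N" "n \<le> N" for m n
  proof -
    define r where "r n = (\<Sum>m\<le>N. coeff_sum p m n * Y ^ m)" for n
    have Q_powers: "Q ^ i * Q ^ j = Q ^ j * Q ^ i" for i j
      by (simp flip: power_add add: add.commute)
    have Y_r: "r i * Y = Y * r i" for i
    proof -
      have "coeff_sum p m i * Y ^ m * Y = Y * (coeff_sum p m i * Y ^ m)" for m
        using coeff_sum_commute[OF QY, of p m i] by (metis mult.assoc power_commutes)
      then show ?thesis
        by (simp add: r_def sum_distrib_left sum_distrib_right)
    qed
    have Q_r: "r i * Q ^ j = Q ^ j * r i" for i j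
    proof -
      have "coeff_sum p m i * Q ^ j = Q ^ j * coeff_sum p m i" for m
        by (rule coeff_sum_commute) (simp add: power_commutes)
      moreover have "Y ^ m * Q ^ j = Q ^ j * Y ^ m" for m
        using commute_power[OF commute_power[OF QY, symmetric]] by simp
      ultimately have "coeff_sum p m i * Y ^ m * Q ^ j = Q ^ j * (coeff_sum p m i * Y ^ m)" for m
        by (metis mult.assoc)
      then show ?thesis
        by (simp add: r_def sum_distrib_left sum_distrib_right)
    qed
    have eigen_r: "(r i * X ^ i) * Y = Q ^ i * Y * (r i * X ^ i)" for i
    proof -
      have "(r i * X ^ i) * Y = r i * Q ^ i * Y * X ^ i"
        by (simp only: mult.assoc X_power_Y)
      also have "\<dots> = Q ^ i * (r i * Y) * X ^ i"
        by (simp only: Q_r mult.assoc)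
      finally show ?thesis
        by (simp only: Y_r mult.assoc)
    qed
    have "r n * X ^ n = 0"
      by (rule eigenvectors_independent[where A = "{..N}" and x = "\<lambda>n. r n * X ^ n" and i = n
            and g = Y and c = "\<lambda>n. Q ^ n", OF finite_atMost _ Y_nonzero
            inj_on_subset[OF inj_Q_power subset_UNIV] eigen_r commute_power[OF QY] Q_powers])
        (use nf that in \<open>simp_all add: r_def\<close>)
    then have "r n = 0"
      using X_nonzero by simp
    have comm: "inverse (Q ^ i) * Z = Z * inverse (Q ^ i)" if "Q * Z = Z * Q" for i Z
    proof -
      have "inverse (Q ^ i) * Z = inverse (Q ^ i) * (Z * Q ^ i) * inverse (Q ^ i)"
        using Q_nonzero by (simp add: mult.assoc)
      also have "\<dots> = (inverse (Q ^ i) * Q ^ i) * Z * inverse (Q ^ i)"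
        by (simp only: commute_power[OF that, symmetric] mult.assoc)
      finally show ?thesis
        using Q_nonzero by simp
    qed
    have Q_inverses: "inverse (Q ^ i) * inverse (Q ^ j) = inverse (Q ^ j) * inverse (Q ^ i)" for i j
      using Q_nonzero by (simp add: Q_powers flip: nonzero_inverse_mult_distrib)
    have eigen_c: "(coeff_sum p i n * Y ^ i) * X = inverse (Q ^ i) * X * (coeff_sum p i n * Y ^ i)" for i
    proof -
      have "inverse (Q ^ i) * X * (coeff_sum p i n * Y ^ i) =
          inverse (Q ^ i) * (X * coeff_sum p i n) * Y ^ i"
        by (simp only: mult.assoc)
      also have "\<dots> = (inverse (Q ^ i) * coeff_sum p i n) * (X * Y ^ i)"
        by (simp only: coeff_sum_commute[OF QX, symmetric] mult.assoc)
      also have "inverse (Q ^ i) * coeff_sum p i n = coeff_sum p i n * inverse (Q ^ i)"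
        by (rule comm) (simp add: coeff_sum_commute)
      also have "coeff_sum p i n * inverse (Q ^ i) * (X * Y ^ i) =
          coeff_sum p i n * (inverse (Q ^ i) * Q ^ i) * (Y ^ i * X)"
        by (simp only: X_Y_power mult.assoc)
      finally show ?thesis
        using Q_nonzero by (simp add: mult.assoc)
    qed
    have inj: "inj_on (\<lambda>m. inverse (Q ^ m)) {..N}"
      using inj_Q_power by (auto simp: inj_on_def)
    have "coeff_sum p m n * Y ^ m = 0"
      by (rule eigenvectors_independent[where A = "{..N}" and x = "\<lambda>m. coeff_sum p m n * Y ^ m"
            and i = m and g = X and c = "\<lambda>m. inverse (Q ^ m)", OF finite_atMost _ X_nonzero
            inj eigen_c comm[OF QX] Q_inverses])
        (use \<open>r n = 0\<close> that in \<open>simp_all add: r_def\<close>)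
    then show ?thesis
      using Y_nonzero by simp
  qed
  then show ?thesis
    using nf N by (auto simp: not_le[symmetric])
qed

end

section \<open>Extending maps from the parameter field to the skew field\<close>

locale skew_field = quantum_skew_field \<kappa> \<iota> q F G
  for \<kappa> \<iota> and q F G :: "'f::division_ring" +
  assumes q_small: "\<kappa> = Complex_parameter c \<Longrightarrow> norm c < 1"
begin

sublocale iota: central_embedding \<iota>
  by standard (fact embed_one embed_add embed_mult embed_central)+

abbreviation eval :: "(letter list \<Rightarrow>\<^sub>0 ratfun) \<Rightarrow> 'f" where
  "eval \<equiv> free_eval \<iota> (case_letter q F G)"

lemma eval_relation:
  assumes "r \<in> quantum_relations \<kappa>"
  shows "eval r = 0"
  using assms by (simp add: presentation two_sided_ideal_generator)

lemma qF: "q * F = F * q"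
  using eval_relation[of "mono [Letter_q, Letter_F] 1 - mono [Letter_F, Letter_q] 1"]
  by (simp add: quantum_relations_def iota.free_eval_diff iota.free_eval_single embed_one)

lemma qG: "q * G = G * q"
  using eval_relation[of "mono [Letter_q, Letter_G] 1 - mono [Letter_G, Letter_q] 1"]
  by (simp add: quantum_relations_def iota.free_eval_diff iota.free_eval_single embed_one)

lemma FG: "F * G = q * G * F"
  using eval_relation[of "mono [Letter_F, Letter_G] 1 - mono [Letter_q, Letter_G, Letter_F] 1"]
  by (simp add: quantum_relations_def iota.free_eval_diff iota.free_eval_single embed_one mult.assoc)

lemma q_complex: "q = \<iota> (const c)" if "\<kappa> = Complex_parameter c"
  using eval_relation[of "mono [Letter_q] 1 - mono [] (const c)"] that
  by (simp add: quantum_relations_def iota.free_eval_diff iota.free_eval_single embed_one)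

text \<open>The ideal vanishes in every model of the relations. A model in which \<open>p\<close>
  has nonzero value therefore keeps \<open>p\<close> out of the ideal, and
  \<open>presentation\<close> carries this over to the skew field.\<close>

lemma eval_nonzero_by_model:
  fixes \<eta> :: "ratfun \<Rightarrow> 'd::ring_1"
  assumes "central_embedding \<eta>" "Q * X = X * Q" "Q * Y = Y * Q" "X * Y = Q * Y * X"
    and "\<And>c. \<kappa> = Complex_parameter c \<Longrightarrow> Q = \<eta> (const c)"
    and "free_eval \<eta> (case_letter Q X Y) p \<noteq> 0"
  shows "eval p \<noteq> 0"
  using free_eval_quantum_ideal[OF assms(1) _ assms(2-5)] assms(6) presentation by blast

lemma central_embedding_id: "central_embedding (id :: ratfun \<Rightarrow> ratfun)"
  by standard (simp_all add: algebra_simps)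

lemma F_nonzero: "F \<noteq> 0"
proof -
  interpret central_embedding "id :: ratfun \<Rightarrow> ratfun"
    by (rule central_embedding_id)
  have "eval (mono [Letter_F] 1) \<noteq> 0"
    \<comment> \<open>In the parameter field itself the relations hold with \<open>F\<close> equal
      to 1 and \<open>G\<close> equal to 0, whatever value is taken for \<open>q\<close>.\<close>
    by (rule eval_nonzero_by_model[of id "case \<kappa> of Formal_letter \<Rightarrow> 0 | Complex_parameter c \<Rightarrow> const c" 1 0])
      (simp_all add: central_embedding_id free_eval_single)
  then show ?thesis
    by (simp add: iota.free_eval_single embed_one)
qed

lemma G_nonzero: "G \<noteq> 0"
proof -
  interpret central_embedding "id :: ratfun \<Rightarrow> ratfun"
    by (rule central_embedding_id)
  have "eval (mono [Letter_G] 1) \<noteq> 0"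
    by (rule eval_nonzero_by_model[of id "case \<kappa> of Formal_letter \<Rightarrow> 0 | Complex_parameter c \<Rightarrow> const c" 0 1])
      (simp_all add: central_embedding_id free_eval_single)
  then show ?thesis
    by (simp add: iota.free_eval_single embed_one)
qed

lemma q_nonzero: "q \<noteq> 0"
  using FG F_nonzero G_nonzero by auto

text \<open>The model is the polynomial ring in one indeterminate over the parameters, with
  \<open>q\<close> as the indeterminate and \<open>F\<close>, \<open>G\<close> equal to 0. Several
  indices may share an exponent, so the coefficients are grouped by \<open>e\<close>.\<close>

lemma q_transcendental:
  assumes "\<kappa> = Formal_letter" "finite A"
  shows "(\<Sum>w\<in>A. \<iota> (c w) * q ^ e w) = 0 \<longleftrightarrow> (\<forall>n. (\<Sum>w\<in>{w \<in> A. e w = n}. c w) = 0)"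
proof
  assume lhs: "(\<Sum>w\<in>A. \<iota> (c w) * q ^ e w) = 0"
  let ?\<eta> = "\<lambda>k::ratfun. [:k:]"
  have \<eta>: "central_embedding ?\<eta>"
    by standard (simp_all add: algebra_simps)
  interpret central_embedding ?\<eta> by fact
  let ?p = "\<Sum>w\<in>A. mono (replicate (e w) Letter_q) (c w)"
  have "eval ?p = 0"
    using lhs by (simp add: iota.free_eval_sum iota.free_eval_single)
  then have "free_eval ?\<eta> (case_letter [:0, 1:] 0 0) ?p = 0"
    using eval_nonzero_by_model[OF \<eta>, of "[:0, 1:]" 0 0 ?p] assms(1) by auto
  then have "(\<Sum>w\<in>A. monom (c w) (e w)) = 0"
    by (simp add: free_eval_sum free_eval_single monom_altdef)
  then have "coeff (\<Sum>w\<in>A. monom (c w) (e w)) n = 0" for n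
    by simp
  then show "\<forall>n. (\<Sum>w\<in>{w \<in> A. e w = n}. c w) = 0"
    using assms(2) by (simp add: coeff_sum if_distrib sum.If_cases Int_def)
next
  assume *: "\<forall>n. (\<Sum>w\<in>{w \<in> A. e w = n}. c w) = 0"
  have "(\<Sum>w\<in>A. \<iota> (c w) * q ^ e w) =
      (\<Sum>n\<in>e ` A. \<Sum>w\<in>{w \<in> A. e w = n}. \<iota> (c w) * q ^ e w)"
    using assms(2) by (intro sum.group[symmetric]) auto
  also have "\<dots> = (\<Sum>n\<in>e ` A. \<iota> (\<Sum>w\<in>{w \<in> A. e w = n}. c w) * q ^ n)"
    by (intro sum.cong refl) (simp add: iota.sum sum_distrib_right)
  finally show "(\<Sum>w\<in>A. \<iota> (c w) * q ^ e w) = 0"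
    using * by (simp add: iota.zero)
qed

text \<open>For a formal \<open>q\<close>, vanishing is a condition on each coefficient, and
  \<open>\<psi>\<close> is injective. For a complex \<open>q\<close>, the sum is the image of an
  element of the parameter field, and twisting the coefficients applies \<open>\<psi>\<close> to
  that element because \<open>\<psi>\<close> fixes constants.\<close>

lemma twisted_coefficients:
  assumes "division_ring_hom \<psi>" "\<And>c. \<psi> (const c) = const c" "finite A"
  shows "(\<Sum>w\<in>A. \<iota> (\<psi> (c w)) * q ^ e w) = 0 \<longleftrightarrow> (\<Sum>w\<in>A. \<iota> (c w) * q ^ e w) = 0"
proof (cases \<kappa>)
  case Formal_letter
  interpret division_ring_hom \<psi> by fact
  show ?thesis
    using Formal_letter assms(3) by (simp add: q_transcendental eq_0_iff flip: sum)
next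
  case (Complex_parameter z)
  interpret division_ring_hom \<psi> by fact
  have "(\<Sum>w\<in>A. \<iota> (c w) * q ^ e w) = \<iota> (\<Sum>w\<in>A. c w * const z ^ e w)" for c
    by (simp add: q_complex[OF Complex_parameter] iota.sum embed_mult iota.power)
  moreover have "(\<Sum>w\<in>A. \<psi> (c w) * const z ^ e w) = \<psi> (\<Sum>w\<in>A. c w * const z ^ e w)"
    by (simp add: sum mult power assms(2))
  ultimately show ?thesis
    by (simp add: iota.eq_0_iff eq_0_iff)
qed

lemma q_not_root:
  assumes "n > 0"
  shows "q ^ n \<noteq> 1"
proof (cases \<kappa>)
  case Formal_letter
  show ?thesis
  proof
    assume "q ^ n = 1"
    then have "(\<Sum>w\<in>{0, n}. \<iota> (if w = n then 1 else - 1) * q ^ w) = 0"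
      using assms iota.add[of 1 "-1"] by (simp add: embed_one iota.zero add.commute)
    then have "(\<Sum>w\<in>{w \<in> {0, n}. w = n}. if w = n then 1 else - 1) = (0::ratfun)"
      using q_transcendental[OF Formal_letter, of "{0, n}" "\<lambda>w. if w = n then 1 else - 1" "\<lambda>w. w"]
      by blast
    moreover have "{w \<in> {0, n}. w = n} = {n}"
      by auto
    ultimately show False
      by simp
  qed
next
  case (Complex_parameter z)
  show ?thesis
  proof
    assume "q ^ n = 1"
    then have "\<iota> (const (z ^ n + - 1)) = 0"
      by (simp only: const_add embed_add const_power iota.power q_complex[OF Complex_parameter, symmetric])
        (simp add: embed_one[symmetric] embed_add[symmetric] iota.zero del: embed_one flip: const_1 const_add)
    then have "z ^ n = 1"
      by (simp add: iota.eq_0_iff)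
    \<comment> \<open>For a complex parameter, roots of unity are excluded by their absolute
      value.\<close>
    then have "norm z ^ n = 1"
      by (metis norm_one norm_power)
    moreover have "norm z ^ n < 1"
      using q_small[OF Complex_parameter] assms by (simp add: power_less_one_iff)
    ultimately show False
      by simp
  qed
qed

sublocale base: quantum_torus \<iota> q F G
  by standard (use qF qG FG F_nonzero G_nonzero q_not_root in auto)

text \<open>Through \<open>coeff_sum\<close>, the hypothesis on coefficients says that both
  evaluations have the same kernel. An inclusion would not be enough: nonzero denominators have to
  remain nonzero.\<close>

lemma hom_exists:
  fixes \<eta> :: "ratfun \<Rightarrow> 'd::division_ring"
  assumes "quantum_torus \<eta> Q X Y"
    and coefficients: "\<And>(A :: letter list set) c e. finite A \<Longrightarrow>
      (\<Sum>w\<in>A. \<eta> (c w) * Q ^ e w) = 0 \<longleftrightarrow> (\<Sum>w\<in>A. \<iota> (c w) * q ^ e w) = 0"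
  shows "\<exists>\<phi>. division_ring_hom \<phi> \<and> (\<forall>k. \<phi> (\<iota> k) = \<eta> k) \<and> \<phi> q = Q \<and> \<phi> F = X \<and> \<phi> G = Y"
proof -
  interpret quantum_torus \<eta> Q X Y by fact
  let ?E' = "free_eval \<eta> (case_letter Q X Y)"
  have "coeff_sum p m n = 0 \<longleftrightarrow> base.coeff_sum p m n = 0" for p m n
    unfolding coeff_sum_def base.coeff_sum_def by (rule coefficients[of _ "Poly_Mapping.lookup p" q_degree]) simp
  then have "eval p = 0 \<longleftrightarrow> ?E' p = 0" for p
    unfolding base.free_eval_eq_0_iff free_eval_eq_0_iff by blast
  then have "\<exists>\<phi>. division_ring_hom \<phi> \<and> (\<forall>p. \<phi> (eval p) = ?E' p)"
  proof (intro extend_to_fractions)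
    show "\<exists>z. eval z = 1 \<and> ?E' z = 1"
      by (rule exI[of _ "mono [] 1"])
        (simp add: free_eval_single iota.free_eval_single embed_one one)
    show "\<exists>z. eval z = eval x + eval y \<and> ?E' z = ?E' x + ?E' y" for x y
      by (rule exI[of _ "x + y"]) (simp only: free_eval_add iota.free_eval_add)
    show "\<exists>z. eval z = eval x - eval y \<and> ?E' z = ?E' x - ?E' y" for x y
      by (rule exI[of _ "x - y"]) (simp only: free_eval_diff iota.free_eval_diff)
    show "\<exists>z. eval z = eval x * eval y \<and> ?E' z = ?E' x * ?E' y" for x y
      by (rule exI, rule conjI, rule iota.free_eval_product, rule free_eval_product)
    show "\<exists>A B. eval B \<noteq> 0 \<and> f = eval A / eval B" for f
      by (rule fractions)
  qed blast
  then obtain \<phi> where \<phi>: "division_ring_hom \<phi>" "\<And>p. \<phi> (eval p) = ?E' p"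
    by blast
  have "\<phi> (\<iota> k) = \<eta> k" "\<phi> q = Q" "\<phi> F = X" "\<phi> G = Y" for k
    using \<phi>(2)[of "mono [] k"] \<phi>(2)[of "mono [Letter_q] 1"] \<phi>(2)[of "mono [Letter_F] 1"]
      \<phi>(2)[of "mono [Letter_G] 1"]
    by (simp_all add: free_eval_single iota.free_eval_single embed_one one)
  with \<phi> show ?thesis
    by blast
qed

lemma hom_eqI:
  assumes \<phi>: "division_ring_hom \<phi>" and \<psi>: "division_ring_hom \<psi>"
    and "\<And>k. \<phi> (\<iota> k) = \<psi> (\<iota> k)" "\<phi> q = \<psi> q" "\<phi> F = \<psi> F" "\<phi> G = \<psi> G"
  shows "\<phi> = \<psi>"
proof
  fix f
  have letters: "\<phi> (case_letter q F G l) = \<psi> (case_letter q F G l)" for l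
    using assms by (cases l) auto
  interpret \<phi>: division_ring_hom \<phi> by fact
  interpret \<psi>: division_ring_hom \<psi> by fact
  have "\<phi> (eval p) = \<psi> (eval p)" for p
    by (simp add: free_eval_def \<phi>.sum \<psi>.sum \<phi>.mult \<psi>.mult \<phi>.prod_list \<psi>.prod_list assms letters comp_def)
  then show "\<phi> f = \<psi> f"
    using fractions[of f] \<phi>.divide \<psi>.divide by metis
qed

definition antihom :: "('f \<Rightarrow> 'f) \<Rightarrow> bool" where
  "antihom \<phi> \<longleftrightarrow> \<phi> 1 = 1 \<and> (\<forall>x y. \<phi> (x + y) = \<phi> x + \<phi> y) \<and> (\<forall>x y. \<phi> (x * y) = \<phi> y * \<phi> x)"

lemma antihom_iff: "antihom \<phi> \<longleftrightarrow> division_ring_hom (Opp \<circ> \<phi>)"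
  by (auto simp: antihom_def division_ring_hom_def one_opp_def plus_opp_def times_opp_def)

lemma antihom_eqI:
  assumes "antihom \<phi>" "antihom \<psi>"
    and "\<And>k. \<phi> (\<iota> k) = \<psi> (\<iota> k)" "\<phi> q = \<psi> q" "\<phi> F = \<psi> F" "\<phi> G = \<psi> G"
  shows "\<phi> = \<psi>"
proof -
  have "Opp \<circ> \<phi> = Opp \<circ> \<psi>"
    using assms by (intro hom_eqI) (auto simp: antihom_iff)
  then show ?thesis
    by (auto simp: fun_eq_iff)
qed

lemma endomorphism_exists:
  assumes "division_ring_hom \<psi>" "\<And>c. \<psi> (const c) = const c"
    and "X \<noteq> 0" "Y \<noteq> 0" "q * X = X * q" "q * Y = Y * q" "X * Y = q * Y * X"
  shows "\<exists>\<phi>. division_ring_hom \<phi> \<and> (\<forall>k. \<phi> (\<iota> k) = \<iota> (\<psi> k)) \<and> \<phi> q = q \<and> \<phi> F = X \<and> \<phi> G = Y"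
proof -
  interpret \<psi>: division_ring_hom \<psi> by fact
  have torus: "quantum_torus (\<iota> \<circ> \<psi>) q X Y"
    by standard
      (simp_all only: comp_def \<psi>.one \<psi>.add \<psi>.mult embed_one embed_add embed_mult,
        (fact embed_central assms q_not_root)+)
  have "(\<Sum>w\<in>A. (\<iota> \<circ> \<psi>) (c w) * q ^ e w) = 0 \<longleftrightarrow> (\<Sum>w\<in>A. \<iota> (c w) * q ^ e w) = 0"
    if "finite A" for A :: "letter list set" and c e
    using twisted_coefficients[OF assms(1,2) that] by simp
  from hom_exists[OF torus this] show ?thesis
    by simp
qed

text \<open>Products are reversed in the opposite ring, hence the relation between \<open>X\<close>
  and \<open>Y\<close> is required in the order \<open>Y * X = q * X * Y\<close>. The scalars are
  central and \<open>q\<close> commutes with both, so the coefficients are those of the homomorphism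
  case.\<close>

lemma antiendomorphism_exists:
  assumes "division_ring_hom \<psi>" "\<And>c. \<psi> (const c) = const c"
    and "X \<noteq> 0" "Y \<noteq> 0" "q * X = X * q" "q * Y = Y * q" "Y * X = q * X * Y"
  shows "\<exists>\<phi>. antihom \<phi> \<and> (\<forall>k. \<phi> (\<iota> k) = \<iota> (\<psi> k)) \<and> \<phi> q = q \<and> \<phi> F = X \<and> \<phi> G = Y"
proof -
  interpret \<psi>: division_ring_hom \<psi> by fact
  have pow: "Opp x ^ n = Opp (x ^ n)" for x :: 'f and n
    by (induction n) (simp_all add: one_opp_def times_opp_def power_commutes)
  have torus: "quantum_torus (Opp \<circ> \<iota> \<circ> \<psi>) (Opp q) (Opp X) (Opp Y)"
  proof
    have "X * Y * q = q * X * Y"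
      using assms(5,6) by (metis mult.assoc)
    then show "Opp X * Opp Y = Opp q * Opp Y * Opp X"
      using assms(7) by (simp add: times_opp_def mult.assoc)
    show "(Opp \<circ> \<iota> \<circ> \<psi>) x * f = f * (Opp \<circ> \<iota> \<circ> \<psi>) x" for x f
      using embed_central[of "\<psi> x" "unopp f"] by (simp add: times_opp_def)
    show "Opp q ^ n \<noteq> 1" if "n > 0" for n
      using q_not_root[OF that] by (simp add: pow one_opp_def)
    show "(Opp \<circ> \<iota> \<circ> \<psi>) (x * y) = (Opp \<circ> \<iota> \<circ> \<psi>) x * (Opp \<circ> \<iota> \<circ> \<psi>) y" for x y
      using embed_central[of "\<psi> x" "\<iota> (\<psi> y)"] by (simp add: \<psi>.mult embed_mult times_opp_def)
    show "Opp q * Opp X = Opp X * Opp q" "Opp q * Opp Y = Opp Y * Opp q"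
      using assms(5,6) by (simp_all add: times_opp_def)
  qed (simp_all add: assms(3,4) \<psi>.one \<psi>.add embed_one embed_add one_opp_def plus_opp_def
      zero_opp_def)
  have "(\<Sum>w\<in>A. Opp (g w)) = Opp (\<Sum>w\<in>A. g w)" for A :: "letter list set" and g :: "letter list \<Rightarrow> 'f"
    by (induction A rule: infinite_finite_induct) (simp_all add: zero_opp_def plus_opp_def)
  moreover have "(Opp \<circ> \<iota> \<circ> \<psi>) k * Opp q ^ e = Opp (\<iota> (\<psi> k) * q ^ e)" for k e
    using embed_central[of "\<psi> k" "q ^ e"] by (simp add: pow times_opp_def)
  ultimately have "(\<Sum>w\<in>A. (Opp \<circ> \<iota> \<circ> \<psi>) (c w) * Opp q ^ e w) = 0 \<longleftrightarrow>
      (\<Sum>w\<in>A. \<iota> (c w) * q ^ e w) = 0" if "finite A" for A :: "letter list set" and c e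
    using twisted_coefficients[OF assms(1,2) that] by (simp add: zero_opp_def)
  from hom_exists[OF torus this] obtain \<phi> where \<phi>: "division_ring_hom \<phi>"
    "\<And>k. \<phi> (\<iota> k) = Opp (\<iota> (\<psi> k))" "\<phi> q = Opp q" "\<phi> F = Opp X" "\<phi> G = Opp Y"
    by auto
  have "Opp \<circ> (unopp \<circ> \<phi>) = \<phi>"
    by (simp add: fun_eq_iff)
  with \<phi> show ?thesis
    by (intro exI[of _ "unopp \<circ> \<phi>"]) (simp add: antihom_iff)
qed

end

section \<open>The noncommutative identity behind the braid relation of the two middle nodes\<close>

lemma mult_commuting_fraction:
  fixes c g p d :: "'a::division_ring"
  assumes "c * p = p * c" "p \<noteq> 0"
  shows "p * (c * inverse p * g + d) = c * g + p * d"
proof -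
  have "p * (c * inverse p * g + d) = (p * c) * inverse p * g + p * d"
    by (simp only: distrib_left mult.assoc)
  also have "p * c * inverse p = c"
    using assms by (simp flip: assms(1) add: mult.assoc)
  finally show ?thesis .
qed

text \<open>Writing \<open>u = P\<inverse> N\<close> and \<open>u' = h\<inverse> N\<close> with the same numerator \<open>N\<close>, and using that \<open>v\<close> and \<open>v'\<close> are
  affine in \<open>u\<close> and \<open>u'\<close>, the claim for the inverses becomes polynomial after multiplication by
  \<open>N\<close> from the left and by \<open>b g + 1\<close> from the right.\<close>

lemma division_ring_braid:
  fixes f g b d :: "'a::division_ring"
  assumes comm: "f * b = b * f" "f * d = d * f" "g * b = b * g" "g * d = d * g" "d * b = b * d"
  defines "R \<equiv> (g + b) * inverse (b * g + 1)"
  defines "u \<equiv> (b * d * (f * R) + 1) * inverse (f * R + b * d) * g + d"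
    and "u' \<equiv> (d * f + 1) * inverse (f + d) * g + b * d"
  defines "v \<equiv> d * ((b * d * (f * R) + 1) * inverse (f * R + b * d) * g) + 1"
    and "v' \<equiv> b * d * ((d * f + 1) * inverse (f + d) * g) + 1"
  assumes nz: "g + b \<noteq> 0" "b * g + 1 \<noteq> 0" "f + d \<noteq> 0" "f * R + b * d \<noteq> 0"
    "u \<noteq> 0" "v \<noteq> 0" "u' \<noteq> 0" "v' \<noteq> 0"
  shows "R * (u * inverse v) = u' * inverse v'"
proof -
  define D where "D = b * g + 1"
  define P where "P = f * R + b * d"
  define h where "h = f + d"
  define N where "N = (d * f + 1) * g + b * d * (f + d)"
  \<comment> \<open>These rules sort \<open>b\<close> and \<open>d\<close> to the front and never
    exchange \<open>f\<close> with \<open>g\<close>, so \<open>normal\<close> decides equality of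
    noncommutative polynomials.\<close>
  have left: "f * (b * z) = b * (f * z)" "f * (d * z) = d * (f * z)" "g * (b * z) = b * (g * z)"
    "g * (d * z) = d * (g * z)" "d * (b * z) = b * (d * z)" for z
    using comm by (metis mult.assoc)+
  note normal = algebra_simps mult.assoc comm left
  have RD: "R * D = g + b"
    using nz(2) by (simp add: R_def D_def mult.assoc)
  have RD': "R * (D * z) = (g + b) * z" for z
    by (simp add: RD flip: mult.assoc)
  have comm_R: "x * R = R * x" if "x * b = b * x" "x * g = g * x" for x
  proof -
    have "x * D = D * x"
      using that by (simp add: D_def distrib_left distrib_right) (metis mult.assoc)
    then have "inverse D * x = x * inverse D"
      by (intro mult_commute_imp_mult_inverse_commute) simp
    moreover have "x * (g + b) = (g + b) * x"
      using that by (simp add: algebra_simps)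
    ultimately show ?thesis
      unfolding R_def D_def[symmetric] by (metis mult.assoc)
  qed
  have dR: "R * d = d * R" "R * b = b * R" "R * g = g * R"
    using comm_R[of d] comm_R[of b] comm_R[of g] comm by simp_all
  have Rleft: "R * (d * z) = d * (R * z)" "R * (b * z) = b * (R * z)" "R * (g * z) = g * (R * z)" for z
    using dR by (metis mult.assoc)+
  have PD: "P * D = f * (g + b) + b * d * D"
    by (simp add: P_def distrib_right mult.assoc RD)
  \<comment> \<open>\<open>R\<close> drops out of the numerator: the terms containing it combine to
    \<open>d * f * R * (b * g + 1)\<close>, and \<open>R * (b * g + 1)\<close> is
    \<open>g + b\<close>. This is why \<open>u\<close> and \<open>u'\<close> share
    \<open>N\<close>.\<close>
  have Pu: "P * u = N"
  proof -
    have "(b * d * (f * R) + 1) * P = P * (b * d * (f * R) + 1)"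
      by (simp add: P_def normal dR Rleft)
    then have "P * u = (b * d * (f * R) + 1) * g + P * d"
      unfolding u_def using nz(4) unfolding P_def[symmetric] by (rule mult_commuting_fraction)
    moreover have "(b * d * (f * R) + 1) * g * D = b * d * (f * (g * (g + b))) + g * D"
      by (simp add: distrib_right mult.assoc Rleft RD)
    moreover have "P * d = d * P"
      by (simp add: P_def normal dR)
    ultimately have "P * u * D = b * d * (f * (g * (g + b))) + g * D + d * (P * D)"
      by (simp add: distrib_right mult.assoc)
    also have "\<dots> = N * D"
      unfolding PD by (simp add: N_def D_def normal)
    finally have "P * u * D = N * D" .
    then show ?thesis
      using nz(2) by (simp add: D_def)
  qed
  have hu': "h * u' = N"
  proof -
    have "(d * f + 1) * h = h * (d * f + 1)"
      by (simp add: h_def normal)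
    then have "h * u' = (d * f + 1) * g + h * (b * d)"
      unfolding u'_def using nz(3) unfolding h_def[symmetric] by (rule mult_commuting_fraction)
    then show ?thesis
      by (simp add: N_def h_def normal)
  qed
  \<comment> \<open>The target is \<open>v * inverse u = v' * inverse u' * R\<close>. Since
    \<open>v\<close> is \<open>d * u + (1 - d * d)\<close> and \<open>inverse u\<close> is
    \<open>inverse N * P\<close>, multiplying its left side by \<open>N\<close> gives
    \<open>d * N + (1 - d * d) * P\<close>; the other side is treated alike. The factor
    \<open>D\<close> clears the denominator of \<open>R\<close>.\<close>
  have "(d * N + (1 - d * d) * P) * D = d * (N * D) + (1 - d * d) * (P * D)"
    by (simp add: distrib_right mult.assoc)
  also have "\<dots> = (b * d * N + (1 - b * b * d * d) * h) * (g + b)"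
    unfolding PD by (simp add: N_def D_def h_def normal)
  also have "\<dots> = (b * d * N + (1 - b * b * d * d) * h) * R * D"
    by (simp add: mult.assoc RD)
  finally have key: "d * N + (1 - d * d) * P = (b * d * N + (1 - b * b * d * d) * h) * R"
    using nz(2) by (simp add: D_def)
  have N: "N \<noteq> 0"
    using Pu nz(4,5) by (auto simp: P_def)
  have inv_u: "inverse u = inverse N * P"
    using nz(4,5) N by (simp add: P_def[symmetric] nonzero_inverse_mult_distrib mult.assoc flip: Pu)
  have inv_u': "inverse u' = inverse N * h"
    using nz(3,7) N by (simp add: h_def[symmetric] nonzero_inverse_mult_distrib mult.assoc flip: hu')
  have cN: "d * N = N * d" "b * N = N * b"
    by (simp_all add: N_def normal)
  have iN: "inverse N * d = d * inverse N" "inverse N * b = b * inverse N"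
    by (rule mult_commute_imp_mult_inverse_commute; simp add: cN)+
  have iN_left: "inverse N * (d * z) = d * (inverse N * z)" "inverse N * (b * z) = b * (inverse N * z)" for z
    using iN by (metis mult.assoc)+
  have "v = d * u + (1 - d * d)"
    by (simp add: v_def u_def algebra_simps)
  then have "v * inverse u = d + (1 - d * d) * (inverse N * P)"
    using nz(5) by (simp add: distrib_right mult.assoc inv_u[symmetric])
  also have "\<dots> = inverse N * (d * N + (1 - d * d) * P)"
    using N by (simp add: algebra_simps mult.assoc iN_left)
  also have "\<dots> = inverse N * (b * d * N + (1 - b * b * d * d) * h) * R"
    by (simp only: key mult.assoc)
  also have "inverse N * (b * d * N + (1 - b * b * d * d) * h) = b * d + (1 - b * b * d * d) * inverse u'"
    using N by (simp add: inv_u' algebra_simps mult.assoc iN_left)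
  also have "\<dots> = v' * inverse u'"
  proof -
    have "v' = b * d * u' + (1 - b * b * d * d)"
      by (simp add: v'_def u'_def normal)
    then show ?thesis
      using nz(7) by (simp add: distrib_right mult.assoc)
  qed
  finally have eq: "v * inverse u = v' * inverse u' * R" .
  have R: "R \<noteq> 0"
    using RD nz(1) by auto
  have "inverse (v * inverse u) = inverse (v' * inverse u' * R)"
    by (simp only: eq)
  then have "u * inverse v = inverse R * (u' * inverse v')"
    using nz R by (simp add: nonzero_inverse_mult_distrib)
  then show ?thesis
    using R by (simp flip: mult.assoc)
qed

section \<open>Relations between the generators on the parameter field\<close>

lemma joined_sym: "joined i j \<longleftrightarrow> joined j i"
  by (simp add: joined_def insert_commute)

lemma joined_irrefl: "\<not> joined i i"
  by (cases i rule: node_cases) (simp_all add: joined_def doubleton_eq_iff)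

lemma s_hom: "division_ring_hom (s i)"
  using ring_automorphism_s by (simp add: ring_automorphism_iff_hom)

lemma \<sigma>01_hom: "division_ring_hom \<sigma>01" and \<sigma>45_hom: "division_ring_hom \<sigma>45"
  and \<tau>_hom: "division_ring_hom \<tau>"
  using ring_automorphism_\<sigma>01 ring_automorphism_\<sigma>45 ring_automorphism_\<tau>
  by (simp_all add: ring_automorphism_iff_hom)

lemmas s_mult = division_ring_hom.mult[OF s_hom]
lemmas s_inverse = division_ring_hom.inverse[OF s_hom]

lemma s_commute:
  assumes "\<not> joined i j"
  shows "s i \<circ> s j = s j \<circ> s i"
proof (cases "i = j")
  case False
  have "\<not> joined j i"
    using assms joined_sym by blast
  show ?thesis
  proof (rule ratfun_hom_eqI)
    show "(s i \<circ> s j) (a k) = (s j \<circ> s i) (a k)" for k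
      using assms False \<open>\<not> joined j i\<close>
      by (auto simp: s_a s_mult s_inverse)
  qed (simp_all add: division_ring_hom_comp s_hom s_const)
qed simp

lemma s_braid:
  assumes "joined i j"
  shows "s i \<circ> s j \<circ> s i = s j \<circ> s i \<circ> s j"
proof (rule ratfun_hom_eqI)
  have "joined j i" "i \<noteq> j"
    using assms joined_sym joined_irrefl by blast+
  then show "(s i \<circ> s j \<circ> s i) (a k) = (s j \<circ> s i \<circ> s j) (a k)" for k
    using assms by (auto simp add: s_a s_mult s_inverse)
qed (simp_all add: division_ring_hom_comp s_hom s_const)

text \<open>Reflections are multiplicative, so inverting all variables commutes with them; a
  symmetry of the diagram then merely renames the reflections.\<close>

lemma s_conj_inverse_permutation:
  assumes "division_ring_hom \<phi>" "\<And>c. \<phi> (const c) = const c" "\<And>j. \<phi> (a j) = inverse (a (\<pi> j))"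
    and "\<And>i j. joined (\<pi> i) (\<pi> j) \<longleftrightarrow> joined i j" "\<And>i j. \<pi> i = \<pi> j \<longleftrightarrow> i = j"
  shows "\<phi> \<circ> s i = s (\<pi> i) \<circ> \<phi>"
proof (rule ratfun_hom_eqI)
  interpret division_ring_hom \<phi> by fact
  show "(\<phi> \<circ> s i) (a k) = (s (\<pi> i) \<circ> \<phi>) (a k)" for k
    by (simp add: s_a s_inverse mult inverse assms(3-5))
qed (simp_all add: division_ring_hom_comp s_hom s_const assms)

definition swap01 :: "node \<Rightarrow> node" where
  "swap01 j = (if j = 0 then 1 else if j = 1 then 0 else j)"

definition swap45 :: "node \<Rightarrow> node" where
  "swap45 j = (if j = 4 then 5 else if j = 5 then 4 else j)"

lemma joined_swap45: "joined (swap45 i) (swap45 j) \<longleftrightarrow> joined i j"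
  by (cases i rule: node_cases; cases j rule: node_cases)
    (simp_all add: swap45_def joined_def doubleton_eq_iff)

lemma joined_reverse: "joined (5 - i) (5 - j) \<longleftrightarrow> joined i j"
  by (cases i rule: node_cases; cases j rule: node_cases)
    (simp_all add: joined_def doubleton_eq_iff)

lemma \<sigma>45_s: "\<sigma>45 \<circ> s i = s (swap45 i) \<circ> \<sigma>45"
  by (rule s_conj_inverse_permutation) (simp_all add: \<sigma>45_hom \<sigma>45_const \<sigma>45_a joined_swap45,
    simp_all add: swap45_def)

lemma \<tau>_s: "\<tau> \<circ> s i = s (5 - i) \<circ> \<tau>"
  by (rule s_conj_inverse_permutation[where \<pi> = "\<lambda>j. 5 - j"])
    (simp_all add: \<tau>_hom \<tau>_const \<tau>_a joined_reverse)

lemma \<sigma>01_\<sigma>45: "\<sigma>01 \<circ> \<sigma>45 = \<sigma>45 \<circ> \<sigma>01"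
  by (rule ratfun_hom_eqI)
    (simp_all add: division_ring_hom_comp \<sigma>01_hom \<sigma>45_hom \<sigma>01_const \<sigma>45_const \<sigma>01_a \<sigma>45_a
      division_ring_hom.inverse[OF \<sigma>01_hom] division_ring_hom.inverse[OF \<sigma>45_hom])

lemma \<tau>_\<sigma>01: "\<tau> \<circ> \<sigma>01 = \<sigma>45 \<circ> \<tau>"
proof (rule ratfun_hom_eqI)
  show "(\<tau> \<circ> \<sigma>01) (a j) = (\<sigma>45 \<circ> \<tau>) (a j)" for j
    by (cases j rule: node_cases)
      (simp_all add: \<tau>_a \<sigma>01_a \<sigma>45_a
        division_ring_hom.inverse[OF \<tau>_hom] division_ring_hom.inverse[OF \<sigma>45_hom])
qed (simp_all add: division_ring_hom_comp \<tau>_hom \<sigma>01_hom \<sigma>45_hom \<sigma>01_const \<sigma>45_const \<tau>_const)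

lemma commuting_fractions:
  fixes x y z :: "'a::division_ring"
  assumes "x \<noteq> 0" "y * x = x * y" "y * z = z * y" "z * x = x * z"
  shows "x * inverse y * (z * inverse x) = z * inverse y"
proof -
  have "inverse y * x = x * inverse y" and z: "inverse y * z = z * inverse y"
    by (rule mult_commute_imp_mult_inverse_commute, fact)+
  then have "x * inverse y * (z * inverse x) = inverse y * (x * z) * inverse x"
    by (metis mult.assoc)
  also have "\<dots> = inverse y * z * (x * inverse x)"
    by (simp only: assms(4)[symmetric] mult.assoc)
  finally show ?thesis
    using assms(1) z by simp
qed

section \<open>The linear fractional expressions\<close>

context skew_field
begin

text \<open>The shape common to both formulas of the action: the right factor of the image of
  \<open>F\<close> under the reflection at 2, and the inverse of the left factor of the image of
  \<open>G\<close> under the one at 3. Homomorphisms and antihomomorphisms extending a parameter map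
  preserve this shape.\<close>

definition mob :: "ratfun \<Rightarrow> ratfun \<Rightarrow> 'f \<Rightarrow> 'f" where
  "mob x b g = (\<iota> x * g + \<iota> b) / (\<iota> (x * b) * g + 1)"

lemma linear_nonzero:
  assumes "g \<notin> range \<iota>" "k \<noteq> 0"
  shows "\<iota> k * g + \<iota> l \<noteq> 0"
proof
  assume "\<iota> k * g + \<iota> l = 0"
  then have "\<iota> (inverse k) * (\<iota> k * g + \<iota> l) = 0"
    by simp
  then have "\<iota> (inverse k * k) * g + \<iota> (inverse k * l) = 0"
    by (simp add: distrib_left embed_mult mult.assoc)
  then have "g + \<iota> (inverse k * l) + \<iota> (- (inverse k * l)) = \<iota> (- (inverse k * l))"
    using assms(2) by (simp add: embed_one)
  then have "g = \<iota> (- (inverse k * l))"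
    by (simp add: add.assoc iota.zero flip: embed_add)
  then show False
    using assms(1) by blast
qed

lemma linear_nonzero_1: "g \<notin> range \<iota> \<Longrightarrow> k \<noteq> 0 \<Longrightarrow> \<iota> k * g + 1 \<noteq> 0"
  using linear_nonzero[of g k 1] by (simp add: embed_one)

text \<open>Scalars are central, whereas \<open>F\<close> and \<open>G\<close> do not commute
  because \<open>q\<close> is not 1.\<close>

lemma FG_not_scalar: "F \<notin> range \<iota>" "G \<notin> range \<iota>"
proof -
  have "F * G \<noteq> G * F"
    using FG q_not_root[of 1] F_nonzero G_nonzero by (simp add: mult.assoc)
  then show "F \<notin> range \<iota>" "G \<notin> range \<iota>"
    using embed_central by fastforce+
qed

lemma mob_nonzero: "g \<notin> range \<iota> \<Longrightarrow> x \<noteq> 0 \<Longrightarrow> b \<noteq> 0 \<Longrightarrow> mob x b g \<noteq> 0"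
  by (simp add: mob_def divide_inverse linear_nonzero linear_nonzero_1)

lemma linear_scale: "(\<iota> k * g + \<iota> l) * \<iota> m = \<iota> (k * m) * g + \<iota> (l * m)"
proof -
  have "\<iota> k * g * \<iota> m = \<iota> (k * m) * g"
    by (simp only: mult.assoc embed_mult embed_central[of m g])
  then show ?thesis
    by (simp add: distrib_right embed_mult)
qed

lemma linear_scale_1: "(\<iota> k * g + 1) * \<iota> m = \<iota> (k * m) * g + \<iota> m"
  using linear_scale[of k g 1 m] by (simp add: embed_one)

text \<open>The coefficients are central, so an intertwining relation passes from \<open>g\<close>
  to every fraction in \<open>g\<close>. With \<open>g'\<close> equal to \<open>g\<close> this gives
  commutation; with \<open>q * G\<close> and \<open>G\<close> it moves \<open>F\<close> across a
  fraction in \<open>G\<close>.\<close>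

lemma mob_intertwine:
  assumes "g' * z = z * g"
  shows "mob x b g' * z = z * mob x b g"
proof -
  have lin: "(\<iota> k * g' + l) * z = z * (\<iota> k * g + l)" if "l * z = z * l" for k l
  proof -
    have "\<iota> k * g' * z = z * (\<iota> k * g)"
      using assms embed_central[of k z] by (metis mult.assoc)
    then show ?thesis
      using that by (simp add: distrib_left distrib_right)
  qed
  let ?B' = "\<iota> (x * b) * g' + 1" and ?B = "\<iota> (x * b) * g + 1"
  have B: "?B' * z = z * ?B"
    by (rule lin) simp
  have inv: "inverse ?B' * z = z * inverse ?B"
  proof (cases "z = 0")
    case False
    show ?thesis
    proof (cases "?B = 0")
      case True
      then have "?B' = 0"
        using B False by simp
      with True show ?thesis by simp
    next
      case B_nz: False
      then have "?B' \<noteq> 0"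
        using B False by (metis mult_eq_0_iff)
      have "inverse ?B' * z = inverse ?B' * (z * ?B) * inverse ?B"
        using B_nz by (simp add: mult.assoc)
      also have "\<dots> = inverse ?B' * (?B' * z) * inverse ?B"
        by (simp only: B)
      also have "\<dots> = z * inverse ?B"
        using \<open>?B' \<noteq> 0\<close> by (simp flip: mult.assoc)
      finally show ?thesis .
    qed
  qed simp
  have "mob x b g' * z = (\<iota> x * g' + \<iota> b) * z * inverse ?B"
    by (simp only: mob_def divide_inverse mult.assoc inv)
  also have "(\<iota> x * g' + \<iota> b) * z = z * (\<iota> x * g + \<iota> b)"
    by (rule lin) (rule embed_central)
  finally show ?thesis
    by (simp only: mob_def divide_inverse mult.assoc)
qed

lemma mob_commute: "g * z = z * g \<Longrightarrow> mob x b g * z = z * mob x b g"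
  by (rule mob_intertwine)

lemma scalar_mult_scalar: "(\<iota> k * y) * (\<iota> m * z) = \<iota> (k * m) * (y * z)"
proof -
  have "(\<iota> k * y) * (\<iota> m * z) = \<iota> k * (y * \<iota> m) * z"
    by (simp only: mult.assoc)
  then show ?thesis
    by (simp only: embed_central[of m y, symmetric] embed_mult mult.assoc)
qed

lemma linear_commute:
  "(\<iota> k * g + \<iota> l) * (\<iota> m * g + \<iota> n) = (\<iota> m * g + \<iota> n) * (\<iota> k * g + \<iota> l)"
proof -
  have "\<iota> k * g * (\<iota> m * g) = \<iota> (k * m) * (g * g)" for k m
    by (metis embed_central embed_mult mult.assoc)
  moreover have "\<iota> k * g * \<iota> m = \<iota> (k * m) * g" "\<iota> m * (\<iota> k * g) = \<iota> (k * m) * g" for k m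
    by (metis embed_central embed_mult mult.assoc)+
  ultimately show ?thesis
    by (simp add: distrib_left distrib_right embed_mult[symmetric] mult.commute add_ac)
qed

text \<open>Inverting \<open>b\<close> interchanges numerator and denominator up to the common
  scalar \<open>b\<close>. This applies whenever a map inverts the square of \<open>a 2\<close> or
  of \<open>a 3\<close>.\<close>

lemma mob_inverse:
  assumes "g \<notin> range \<iota>" "x \<noteq> 0" "b \<noteq> 0"
  shows "mob x (inverse b) g = inverse (mob x b g)"
proof -
  have "mob x (inverse b) g =
      ((\<iota> x * g + \<iota> (inverse b)) * \<iota> b) / ((\<iota> (x * inverse b) * g + 1) * \<iota> b)"
    unfolding mob_def using assms(3) by (simp only: mult_divide_cancel_right iota.eq_0_iff not_False_eq_True)
  also have "(\<iota> x * g + \<iota> (inverse b)) * \<iota> b = \<iota> (x * b) * g + 1"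
    using assms(3) by (simp add: linear_scale embed_one)
  also have "(\<iota> (x * inverse b) * g + 1) * \<iota> b = \<iota> x * g + \<iota> b"
    using assms(3) by (simp add: linear_scale_1 mult.assoc)
  finally show ?thesis
    by (simp add: mob_def divide_inverse nonzero_inverse_mult_distrib linear_nonzero linear_nonzero_1 assms)
qed

text \<open>Expanded by \<open>b\<close>, the second fraction has the numerator of the first as its
  denominator. The factors commute, so it cancels. This is the braid relation of \<open>S 0\<close>
  and \<open>S 2\<close> on \<open>F\<close>.\<close>

lemma mob_mult:
  assumes "g \<notin> range \<iota>" "x \<noteq> 0" "b \<noteq> 0" "c \<noteq> 0"
  shows "mob x b g * mob (x / (c * b)) c g = mob (x / c) (c * b) g"
proof -
  let ?A = "\<iota> x * g + \<iota> b" and ?B = "\<iota> (x * b) * g + \<iota> 1" and ?C = "\<iota> (x / c) * g + \<iota> (c * b)"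
  have "mob (x / (c * b)) c g =
      ((\<iota> (x / (c * b)) * g + \<iota> c) * \<iota> b) / ((\<iota> (x / (c * b) * c) * g + 1) * \<iota> b)"
    unfolding mob_def using assms(3) by (simp only: mult_divide_cancel_right iota.eq_0_iff not_False_eq_True)
  also have "(\<iota> (x / (c * b)) * g + \<iota> c) * \<iota> b = ?C"
  proof -
    have "x / (c * b) * b = x / c"
      using assms by simp
    then show ?thesis
      by (simp only: linear_scale)
  qed
  also have "(\<iota> (x / (c * b) * c) * g + 1) * \<iota> b = ?A"
  proof -
    have "x / (c * b) * c * b = x"
      using assms by simp
    then show ?thesis
      by (simp only: linear_scale_1)
  qed
  finally have "mob x b g * mob (x / (c * b)) c g = ?A * inverse ?B * (?C * inverse ?A)"
    by (simp add: mob_def divide_inverse embed_one)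
  also have "\<dots> = ?C * inverse ?B"
  proof -
    have nz: "?A \<noteq> 0"
      using assms linear_nonzero by simp
    show ?thesis
      by (rule commuting_fractions) (rule nz linear_commute)+
  qed
  also have "\<dots> = mob (x / c) (c * b) g"
  proof -
    have "x / c * (c * b) = x * b"
      using assms by simp
    then show ?thesis
      by (simp only: mob_def embed_one divide_inverse[where 'a = 'f])
  qed
  finally show ?thesis .
qed

text \<open>Expanding the fraction by \<open>x * b * q * g\<close> removes the reciprocal. It
  describes the effect of \<open>S45\<close> on the factor \<open>R\<close>.\<close>

lemma mob_reciprocal:
  assumes "g \<noteq> 0" "x \<noteq> 0" "b \<noteq> 0" "q * g = g * q"
  shows "mob (inverse x) (inverse b) (inverse q * inverse g) = mob x b (q * g)"
proof -
  let ?h = "inverse q * inverse g"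
  let ?Z = "\<iota> (x * b) * (q * g)"
  have h: "?h * (q * g) = 1"
  proof -
    have "?h * (q * g) = inverse q * (inverse g * g) * q"
      by (simp only: assms(4) mult.assoc)
    then show ?thesis
      using assms(1) q_nonzero by simp
  qed
  have kh: "\<iota> k * ?h * ?Z = \<iota> (k * (x * b))" for k
    by (simp only: scalar_mult_scalar h mult_1_right)
  have kZ: "\<iota> k * ?Z = \<iota> (k * (x * b)) * (q * g)" for k
    by (simp only: embed_mult mult.assoc)
  have Z: "?Z \<noteq> 0"
    using assms q_nonzero by (simp add: iota.eq_0_iff)
  have "mob (inverse x) (inverse b) ?h =
      ((\<iota> (inverse x) * ?h + \<iota> (inverse b)) * ?Z) / ((\<iota> (inverse x * inverse b) * ?h + 1) * ?Z)"
    unfolding mob_def mult_divide_cancel_right[OF Z] ..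
  also have "(\<iota> (inverse x) * ?h + \<iota> (inverse b)) * ?Z = \<iota> x * (q * g) + \<iota> b"
  proof -
    have "inverse x * (x * b) = b" "inverse b * (x * b) = x"
      using assms by (simp_all add: field_simps)
    then show ?thesis
      by (simp only: distrib_right kh kZ add.commute)
  qed
  also have "(\<iota> (inverse x * inverse b) * ?h + 1) * ?Z = ?Z + 1"
  proof -
    have "inverse x * inverse b * (x * b) = 1"
      using assms by (simp add: field_simps)
    then show ?thesis
      by (simp only: distrib_right kh mult_1_left embed_one add.commute)
  qed
  finally show ?thesis
    by (simp add: mob_def)
qed

lemma hom_mob:
  assumes "division_ring_hom \<phi>" "\<And>k. \<phi> (\<iota> k) = \<iota> (\<psi> k)" "division_ring_hom \<psi>"
  shows "\<phi> (mob x b g) = mob (\<psi> x) (\<psi> b) (\<phi> g)"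
proof -
  interpret division_ring_hom \<phi> by fact
  show ?thesis
    by (simp add: mob_def divide add mult assms(2) one division_ring_hom.mult[OF assms(3)])
qed

lemma antihom_inverse: "antihom \<phi> \<Longrightarrow> \<phi> (inverse x) = inverse (\<phi> x)"
  using division_ring_hom.inverse[of "Opp \<circ> \<phi>" x] by (simp add: antihom_iff inverse_opp_def)

text \<open>The reversal of products is invisible here, since numerator and denominator are linear
  in the same element with central coefficients and hence commute.\<close>

lemma antihom_mob:
  assumes "antihom \<phi>" "\<And>k. \<phi> (\<iota> k) = \<iota> (\<psi> k)" "division_ring_hom \<psi>"
  shows "\<phi> (mob x b g) = mob (\<psi> x) (\<psi> b) (\<phi> g)"
proof -
  let ?A = "\<iota> (\<psi> x) * \<phi> g + \<iota> (\<psi> b)" and ?B = "\<iota> (\<psi> x * \<psi> b) * \<phi> g + \<iota> 1"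
  have anti: "\<phi> (x * y) = \<phi> y * \<phi> x" for x y
    using assms(1) by (simp add: antihom_def)
  have lin: "\<phi> (\<iota> k * g + l) = \<iota> (\<psi> k) * \<phi> g + \<phi> l" for k l
    using assms(1,2) embed_central[of "\<psi> k" "\<phi> g"] by (simp add: antihom_def)
  have "\<phi> (mob x b g) = inverse (\<phi> (\<iota> (x * b) * g + 1)) * \<phi> (\<iota> x * g + \<iota> b)"
    by (simp only: mob_def divide_inverse antihom_inverse[OF assms(1), symmetric] anti)
  also have "\<dots> = inverse ?B * ?A"
    using assms(1) unfolding lin by (simp add: assms(2) division_ring_hom.mult[OF assms(3)] embed_one antihom_def)
  also have "\<dots> = ?A * inverse ?B"
    by (rule mult_commute_imp_mult_inverse_commute, rule linear_commute)
  finally show ?thesis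
    by (simp add: mob_def divide_inverse embed_one)
qed

end

section \<open>The lifted generators and their relations\<close>

lemma inverse_intertwine:
  fixes x y z :: "'a::division_ring"
  assumes "x * y = z * x" "x \<noteq> 0"
  shows "y * inverse x = inverse x * z"
proof -
  have "inverse x * (x * y) * inverse x = y * inverse x"
    using assms(2) by (simp flip: mult.assoc)
  moreover have "inverse x * (z * x) * inverse x = inverse x * z"
    using assms(2) by (simp add: mult.assoc)
  ultimately show ?thesis
    by (simp only: assms(1))
qed

context skew_field
begin

abbreviation R where "R \<equiv> mob (a 0 * inverse (a 1)) ((a 2)\<^sup>2) G"
abbreviation L where "L \<equiv> mob (a 4 * inverse (a 5)) ((a 3)\<^sup>2) F"

lemma R_nonzero: "R \<noteq> 0" and L_nonzero: "L \<noteq> 0"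
  by (simp_all add: mob_nonzero FG_not_scalar)

definition S :: "node \<Rightarrow> 'f \<Rightarrow> 'f" where
  "S j = (SOME \<phi>. division_ring_hom \<phi> \<and> (\<forall>k. \<phi> (\<iota> k) = \<iota> (s j k)) \<and> \<phi> q = q \<and>
     \<phi> F = (if j = 2 then F * R else F) \<and> \<phi> G = (if j = 3 then inverse L * G else G))"

text \<open>Each \<open>S j\<close> changes at most one of the generators, and the new factor
  commutes with the other one: \<open>R\<close> is a fraction in \<open>G\<close>, and
  \<open>L\<close> is a fraction in \<open>F\<close>. So the images still
  \<open>q\<close>-commute.\<close>

lemma S_props:
  shows S_hom: "division_ring_hom (S j)" and S_\<iota>: "S j (\<iota> k) = \<iota> (s j k)" and S_q: "S j q = q"
    and S_F: "S j F = (if j = 2 then F * R else F)"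
    and S_G: "S j G = (if j = 3 then inverse L * G else G)"
proof -
  let ?F = "if j = 2 then F * R else F" and ?G = "if j = 3 then inverse L * G else G"
  have qR: "q * R = R * q" and GR: "R * G = G * R" and qL: "q * L = L * q" and FL: "L * F = F * L"
    using mob_commute[of G q] mob_commute[of G G] mob_commute[of F q] mob_commute[of F F] qG qF
    by simp_all
  have qL': "q * inverse L = inverse L * q" and FL': "F * inverse L = inverse L * F"
    using mult_commute_imp_mult_inverse_commute[of L q] mult_commute_imp_mult_inverse_commute[of L F]
      qL FL by simp_all
  have "q * ?F = ?F * q"
    using qR qF by (simp add: mult.assoc[symmetric]) (simp add: mult.assoc)
  moreover have "q * ?G = ?G * q"
    using qL' qG by (simp add: mult.assoc[symmetric]) (simp add: mult.assoc)
  moreover have "?F * ?G = q * ?G * ?F"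
  proof -
    have "F * R * G = q * G * (F * R)"
      by (simp only: mult.assoc GR) (simp only: mult.assoc[symmetric] FG)
    moreover have "F * (inverse L * G) = q * (inverse L * G) * F"
    proof -
      have "F * (inverse L * G) = inverse L * (F * G)"
        by (simp only: mult.assoc[symmetric] FL')
      also have "\<dots> = inverse L * q * G * F"
        by (simp only: FG mult.assoc)
      finally show ?thesis
        by (simp only: qL'[symmetric] mult.assoc)
    qed
    ultimately show ?thesis
      using FG by simp
  qed
  moreover have "?F \<noteq> 0" "?G \<noteq> 0"
    using F_nonzero G_nonzero R_nonzero L_nonzero by auto
  ultimately have "\<exists>\<phi>. division_ring_hom \<phi> \<and> (\<forall>k. \<phi> (\<iota> k) = \<iota> (s j k)) \<and> \<phi> q = q \<and> \<phi> F = ?F \<and> \<phi> G = ?G"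
    by (intro endomorphism_exists) (simp_all only: s_hom s_const not_False_eq_True)
  from someI_ex[OF this, folded S_def] show "division_ring_hom (S j)" "S j (\<iota> k) = \<iota> (s j k)"
    "S j q = q" "S j F = ?F" "S j G = ?G"
    by blast+
qed

definition S01 :: "'f \<Rightarrow> 'f" where
  "S01 = (SOME \<phi>. antihom \<phi> \<and> (\<forall>k. \<phi> (\<iota> k) = \<iota> (\<sigma>01 k)) \<and> \<phi> q = q \<and>
     \<phi> F = inverse q * inverse F \<and> \<phi> G = G)"

definition S45 :: "'f \<Rightarrow> 'f" where
  "S45 = (SOME \<phi>. antihom \<phi> \<and> (\<forall>k. \<phi> (\<iota> k) = \<iota> (\<sigma>45 k)) \<and> \<phi> q = q \<and>
     \<phi> F = F \<and> \<phi> G = inverse q * inverse G)"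

definition T :: "'f \<Rightarrow> 'f" where
  "T = (SOME \<phi>. antihom \<phi> \<and> (\<forall>k. \<phi> (\<iota> k) = \<iota> (\<tau> k)) \<and> \<phi> q = q \<and> \<phi> F = G \<and> \<phi> G = F)"

lemma q_inverse_commute:
  assumes "q * x = x * q"
  shows "q * (inverse q * inverse x) = inverse q * inverse x * q"
proof -
  have "inverse x * q = q * inverse x"
    using assms by (intro mult_commute_imp_mult_inverse_commute) simp
  then have "inverse q * inverse x * q = inverse q * q * inverse x"
    by (simp only: mult.assoc)
  then show ?thesis
    using q_nonzero by (simp flip: mult.assoc)
qed

lemma S01_props:
  shows S01_antihom: "antihom S01" and S01_\<iota>: "S01 (\<iota> k) = \<iota> (\<sigma>01 k)" and S01_q: "S01 q = q"
    and S01_F: "S01 F = inverse q * inverse F" and S01_G: "S01 G = G"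
proof -
  have "G * (inverse q * inverse F) = q * (inverse q * inverse F) * G"
  proof -
    have "G * inverse F = inverse F * q * G"
      using inverse_intertwine[OF FG F_nonzero] by (simp only: mult.assoc)
    moreover have "inverse F * q = q * inverse F"
      using qF by (intro mult_commute_imp_mult_inverse_commute) simp
    ultimately have "G * inverse F = q * inverse F * G"
      by simp
    moreover have "G * inverse q = inverse q * G"
      using qG by (intro mult_commute_imp_mult_inverse_commute[symmetric]) simp
    ultimately have "G * (inverse q * inverse F) = inverse q * (q * inverse F * G)"
      by (metis mult.assoc)
    then show ?thesis
      using q_nonzero by (simp flip: mult.assoc)
  qed
  then have "\<exists>\<phi>. antihom \<phi> \<and> (\<forall>k. \<phi> (\<iota> k) = \<iota> (\<sigma>01 k)) \<and> \<phi> q = q \<and> \<phi> F = inverse q * inverse F \<and> \<phi> G = G"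
    using q_inverse_commute[OF qF] qG F_nonzero G_nonzero q_nonzero
    by (intro antiendomorphism_exists) (simp_all add: \<sigma>01_hom \<sigma>01_const)
  from someI_ex[OF this, folded S01_def] show "antihom S01" "S01 (\<iota> k) = \<iota> (\<sigma>01 k)" "S01 q = q"
    "S01 F = inverse q * inverse F" "S01 G = G"
    by blast+
qed

lemma S45_props:
  shows S45_antihom: "antihom S45" and S45_\<iota>: "S45 (\<iota> k) = \<iota> (\<sigma>45 k)" and S45_q: "S45 q = q"
    and S45_F: "S45 F = F" and S45_G: "S45 G = inverse q * inverse G"
proof -
  have "inverse q * inverse G * F = q * F * (inverse q * inverse G)"
  proof -
    have "G * (q * F) = F * G"
      by (simp only: FG qG mult.assoc[symmetric])
    then have "inverse G * F = q * F * inverse G"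
      by (rule inverse_intertwine[symmetric, OF _ G_nonzero])
    moreover have "F * inverse q = inverse q * F"
      using qF by (intro mult_commute_imp_mult_inverse_commute[symmetric]) simp
    ultimately have "inverse q * inverse G * F = F * inverse G"
      using q_nonzero by (metis left_inverse mult.assoc mult_1_left)
    moreover have "q * F * (inverse q * inverse G) = F * inverse G"
      using q_nonzero by (simp add: qF mult.assoc) (simp flip: mult.assoc)
    ultimately show ?thesis
      by simp
  qed
  then have "\<exists>\<phi>. antihom \<phi> \<and> (\<forall>k. \<phi> (\<iota> k) = \<iota> (\<sigma>45 k)) \<and> \<phi> q = q \<and> \<phi> F = F \<and> \<phi> G = inverse q * inverse G"
    using q_inverse_commute[OF qG] qF F_nonzero G_nonzero q_nonzero
    by (intro antiendomorphism_exists) (simp_all add: \<sigma>45_hom \<sigma>45_const)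
  from someI_ex[OF this, folded S45_def] show "antihom S45" "S45 (\<iota> k) = \<iota> (\<sigma>45 k)" "S45 q = q"
    "S45 F = F" "S45 G = inverse q * inverse G"
    by blast+
qed

lemma T_props:
  shows T_antihom: "antihom T" and T_\<iota>: "T (\<iota> k) = \<iota> (\<tau> k)" and T_q: "T q = q"
    and T_F: "T F = G" and T_G: "T G = F"
proof -
  have "\<exists>\<phi>. antihom \<phi> \<and> (\<forall>k. \<phi> (\<iota> k) = \<iota> (\<tau> k)) \<and> \<phi> q = q \<and> \<phi> F = G \<and> \<phi> G = F"
    using qF qG FG F_nonzero G_nonzero
    by (intro antiendomorphism_exists) (simp_all only: \<tau>_hom \<tau>_const not_False_eq_True)
  from someI_ex[OF this, folded T_def] show "antihom T" "T (\<iota> k) = \<iota> (\<tau> k)" "T q = q"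
    "T F = G" "T G = F"
    by blast+
qed

lemma hom_comp:
  "division_ring_hom \<phi> \<Longrightarrow> division_ring_hom \<psi> \<Longrightarrow> division_ring_hom (\<phi> \<circ> \<psi>)"
  "antihom \<phi> \<Longrightarrow> antihom \<psi> \<Longrightarrow> division_ring_hom (\<phi> \<circ> \<psi>)"
  "division_ring_hom \<phi> \<Longrightarrow> antihom \<psi> \<Longrightarrow> antihom (\<phi> \<circ> \<psi>)"
  "antihom \<phi> \<Longrightarrow> division_ring_hom \<psi> \<Longrightarrow> antihom (\<phi> \<circ> \<psi>)"
  for \<phi> \<psi> :: "'f \<Rightarrow> 'f"
  by (auto simp: antihom_def division_ring_hom_def)

lemma hom_id: "division_ring_hom (id :: 'f \<Rightarrow> 'f)"
  by (simp add: division_ring_hom_def)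

lemmas S_mult = division_ring_hom.mult[OF S_hom]
lemmas S_inverse = division_ring_hom.inverse[OF S_hom]
lemmas S_mob = hom_mob[OF S_hom S_\<iota> s_hom]

lemma antihom_mult: "antihom \<phi> \<Longrightarrow> \<phi> (x * y) = \<phi> y * \<phi> x" for \<phi> :: "'f \<Rightarrow> 'f"
  by (simp add: antihom_def)

lemma K_eq: "\<phi> \<circ> \<psi> = \<phi>' \<circ> \<psi>' \<Longrightarrow> \<phi> (\<psi> x) = \<phi>' (\<psi>' x)"
  by (metis comp_apply)

lemma s_s_apply: "s j (s j k) = k"
  using s_s[of j] by (metis comp_apply id_apply)

section \<open>Involutivity and conjugation by the diagram antiautomorphisms\<close>

lemma S_S: "S j \<circ> S j = id"
proof (rule hom_eqI)
  \<comment> \<open>Under \<open>S 2\<close> the ratio is fixed and the square of \<open>a 2\<close>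
    is inverted, so \<open>R\<close> goes to its inverse and \<open>F * R\<close> returns to
    \<open>F\<close>; likewise for \<open>L\<close> below.\<close>
  have "s j (a 0 * inverse (a 1)) = a 0 * inverse (a 1)" "s j ((a 2)\<^sup>2) = inverse ((a 2)\<^sup>2)" if "j = 2"
    using that by (simp_all add: s_mult s_inverse power2_eq_square s_a joined_def doubleton_eq_iff)
  then show "(S j \<circ> S j) F = id F"
    using R_nonzero by (auto simp: S_F S_mult S_mob S_G mob_inverse FG_not_scalar mult.assoc)
  have "s j (a 4 * inverse (a 5)) = a 4 * inverse (a 5)" "s j ((a 3)\<^sup>2) = inverse ((a 3)\<^sup>2)" if "j = 3"
    using that by (simp_all add: s_mult s_inverse power2_eq_square s_a joined_def doubleton_eq_iff)
  then show "(S j \<circ> S j) G = id G"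
    using L_nonzero by (auto simp: S_F S_mult S_inverse S_mob S_G mob_inverse FG_not_scalar simp flip: mult.assoc)
qed (simp_all add: hom_comp hom_id S_hom S_\<iota> S_q s_s_apply)

lemma S01_S01: "S01 \<circ> S01 = id"
proof (rule hom_eqI)
  have "\<sigma>01 (\<sigma>01 k) = k" for k
    using \<sigma>01_\<sigma>01 by (metis comp_apply id_apply)
  then show "(S01 \<circ> S01) (\<iota> k) = id (\<iota> k)" for k
    by (simp add: S01_\<iota>)
  have "S01 (inverse q * inverse F) = inverse (inverse q * inverse F) * inverse q"
    by (simp add: antihom_mult[OF S01_antihom] antihom_inverse[OF S01_antihom] S01_F S01_q)
  also have "\<dots> = F * (q * inverse q)"
    using q_nonzero F_nonzero by (simp add: nonzero_inverse_mult_distrib mult.assoc)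
  finally show "(S01 \<circ> S01) F = id F"
    using q_nonzero by (simp add: S01_F)
qed (simp_all add: hom_comp hom_id S01_antihom S01_q S01_G)

lemma T_T: "T \<circ> T = id"
proof (rule hom_eqI)
  have "\<tau> (\<tau> k) = k" for k
    using \<tau>_\<tau> by (metis comp_apply id_apply)
  then show "(T \<circ> T) (\<iota> k) = id (\<iota> k)" for k
    by (simp add: T_\<iota>)
qed (simp_all add: hom_comp hom_id T_antihom T_q T_F T_G)

lemma T_S01: "T \<circ> S01 = S45 \<circ> T"
proof (rule hom_eqI)
  show "(T \<circ> S01) (\<iota> k) = (S45 \<circ> T) (\<iota> k)" for k
    using K_eq[OF \<tau>_\<sigma>01] by (simp add: T_\<iota> S01_\<iota> S45_\<iota>)
  have "inverse G * inverse q = inverse q * inverse G"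
    using qG by (intro mult_commute_imp_mult_inverse_commute mult_commute_imp_mult_inverse_commute[symmetric]) simp
  then show "(T \<circ> S01) F = (S45 \<circ> T) F"
    by (simp add: S01_F T_F S45_G antihom_mult[OF T_antihom] antihom_inverse[OF T_antihom] T_q)
qed (simp_all add: hom_comp T_antihom S01_antihom S45_antihom T_q S01_q S45_q T_G S01_G S45_F)

lemma S45_S45: "S45 \<circ> S45 = id"
  using T_S01 S01_S01 T_T by (metis comp_assoc comp_id id_comp)

lemma S01_S45: "S01 \<circ> S45 = S45 \<circ> S01"
proof (rule hom_eqI)
  show "(S01 \<circ> S45) (\<iota> k) = (S45 \<circ> S01) (\<iota> k)" for k
    using K_eq[OF \<sigma>01_\<sigma>45] by (simp add: S01_\<iota> S45_\<iota>)
  have "inverse F * inverse q = inverse q * inverse F"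
    using qF by (intro mult_commute_imp_mult_inverse_commute mult_commute_imp_mult_inverse_commute[symmetric]) simp
  then show "(S01 \<circ> S45) F = (S45 \<circ> S01) F"
    by (simp add: S01_F S45_F antihom_mult[OF S45_antihom] antihom_inverse[OF S45_antihom] S45_q)
  have "inverse G * inverse q = inverse q * inverse G"
    using qG by (intro mult_commute_imp_mult_inverse_commute mult_commute_imp_mult_inverse_commute[symmetric]) simp
  then show "(S01 \<circ> S45) G = (S45 \<circ> S01) G"
    by (simp add: S01_G S45_G antihom_mult[OF S01_antihom] antihom_inverse[OF S01_antihom] S01_q)
qed (simp_all add: hom_comp S01_antihom S45_antihom S01_q S45_q)

text \<open>\<open>T\<close> carries \<open>R\<close> to \<open>inverse L\<close>:
  \<open>\<tau>\<close> sends one ratio to the other and the square of \<open>a 2\<close> to the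
  inverse of the square of \<open>a 3\<close>. The reversal of products puts the new factor on the
  left of \<open>G\<close>.\<close>

lemma T_S: "T \<circ> S j = S (5 - j) \<circ> T"
proof (rule antihom_eqI)
  show "(T \<circ> S j) (\<iota> k) = (S (5 - j) \<circ> T) (\<iota> k)" for k
    using K_eq[OF \<tau>_s] by (simp add: T_\<iota> S_\<iota>)
  have x: "\<tau> (a 0 * inverse (a 1)) = a 4 * inverse (a 5)" "\<tau> ((a 2)\<^sup>2) = inverse ((a 3)\<^sup>2)"
    by (simp_all add: division_ring_hom.mult[OF \<tau>_hom] division_ring_hom.inverse[OF \<tau>_hom] \<tau>_a power2_eq_square)
  have y: "\<tau> (a 4 * inverse (a 5)) = a 0 * inverse (a 1)" "\<tau> ((a 3)\<^sup>2) = inverse ((a 2)\<^sup>2)"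
    by (simp_all add: division_ring_hom.mult[OF \<tau>_hom] division_ring_hom.inverse[OF \<tau>_hom] \<tau>_a power2_eq_square)
  have j: "5 - j = 3 \<longleftrightarrow> j = 2" "5 - j = 2 \<longleftrightarrow> j = 3"
    by (cases j rule: node_cases; simp)+
  show "(T \<circ> S j) F = (S (5 - j) \<circ> T) F"
    using x by (simp add: S_F S_G T_F antihom_mult[OF T_antihom] antihom_mob[OF T_antihom T_\<iota> \<tau>_hom] T_G j
        mob_inverse FG_not_scalar)
  show "(T \<circ> S j) G = (S (5 - j) \<circ> T) G"
    using y by (simp add: S_F S_G T_F antihom_mult[OF T_antihom] antihom_inverse[OF T_antihom]
        antihom_mob[OF T_antihom T_\<iota> \<tau>_hom] T_G j mob_inverse FG_not_scalar)
qed (simp_all add: hom_comp T_antihom S_hom T_q S_q)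

lemma S45_S: "S45 \<circ> S j = S (swap45 j) \<circ> S45"
proof (rule antihom_eqI)
  show "(S45 \<circ> S j) (\<iota> k) = (S (swap45 j) \<circ> S45) (\<iota> k)" for k
    using K_eq[OF \<sigma>45_s] by (simp add: S45_\<iota> S_\<iota>)
  have j: "swap45 j = 2 \<longleftrightarrow> j = 2" "swap45 j = 3 \<longleftrightarrow> j = 3"
    by (simp_all add: swap45_def)
  have x: "\<sigma>45 (a 0 * inverse (a 1)) = inverse (a 0 * inverse (a 1))" "\<sigma>45 ((a 2)\<^sup>2) = inverse ((a 2)\<^sup>2)"
    "\<sigma>45 (a 4 * inverse (a 5)) = a 4 * inverse (a 5)" "\<sigma>45 ((a 3)\<^sup>2) = inverse ((a 3)\<^sup>2)"
    by (simp_all add: division_ring_hom.mult[OF \<sigma>45_hom] division_ring_hom.inverse[OF \<sigma>45_hom] \<sigma>45_a power2_eq_square mult.commute)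
  \<comment> \<open>The left side is the image of \<open>F * R\<close> under \<open>S45\<close>. The
    factor \<open>inverse q\<close> in \<open>S45 G\<close> produces \<open>q * G\<close> in the
    fraction, and \<open>q * G * F = F * G\<close> moves \<open>F\<close> back in front, leaving
    \<open>R\<close> unchanged.\<close>
  have "mob (a 0 * inverse (a 1)) ((a 2)\<^sup>2) (q * G) * F = F * R"
    using FG by (intro mob_intertwine) (simp add: mult.assoc)
  then show "(S45 \<circ> S j) F = (S (swap45 j) \<circ> S45) F"
    using mob_reciprocal[OF G_nonzero _ _ qG, of "a 0 * inverse (a 1)" "(a 2)\<^sup>2"]
    by (simp add: S_F S45_F antihom_mult[OF S45_antihom] antihom_mob[OF S45_antihom S45_\<iota> \<sigma>45_hom] x S45_G j
        del: inverse_mult_distrib)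
  have L: "S45 (inverse L) = L"
    by (simp add: antihom_inverse[OF S45_antihom] antihom_mob[OF S45_antihom S45_\<iota> \<sigma>45_hom] x S45_F
        mob_inverse FG_not_scalar)
  have "inverse q * inverse G * L = inverse q * inverse (inverse L * G)"
    using L_nonzero G_nonzero by (simp add: nonzero_inverse_mult_distrib mult.assoc)
  then show "(S45 \<circ> S j) G = (S (swap45 j) \<circ> S45) G"
    using L by (simp add: S_G S45_G antihom_mult[OF S45_antihom] S_mult S_inverse S_q j)
qed (simp_all add: hom_comp S45_antihom S_hom S45_q S_q)

lemma S01_S: "S01 \<circ> S j = S (swap01 j) \<circ> S01"
proof -
  have S01: "S01 = T \<circ> S45 \<circ> T"
    using T_S01 T_T S01_S01 by (metis comp_assoc id_comp)
  have j: "5 - swap45 (5 - j) = swap01 j"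
    by (cases j rule: node_cases) (simp_all add: swap45_def swap01_def)
  have "S01 \<circ> S j = T \<circ> (S45 \<circ> S (5 - j)) \<circ> T"
    by (simp only: S01 comp_assoc T_S)
  also have "\<dots> = S (5 - swap45 (5 - j)) \<circ> (T \<circ> S45 \<circ> T)"
    by (simp only: S45_S) (simp only: comp_assoc[symmetric] T_S)
  finally show ?thesis
    by (simp only: S01 j)
qed

section \<open>Commutation and braid relations of the lifted reflections\<close>

lemma S_S_apply: "S j (S j x) = x"
  using S_S[of j] by (metis comp_apply id_apply)

lemma S_not_scalar: "g \<notin> range \<iota> \<Longrightarrow> S j g \<notin> range \<iota>"
proof
  assume "g \<notin> range \<iota>" "S j g \<in> range \<iota>"
  then obtain k where "S j g = \<iota> k"
    by blast
  then have "g = \<iota> (s j k)"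
    using S_S_apply[of j g] by (simp add: S_\<iota>)
  with \<open>g \<notin> range \<iota>\<close> show False
    by blast
qed

lemma S_commute:
  assumes "\<not> joined i j"
  shows "S i \<circ> S j = S j \<circ> S i"
proof -
  have R: "S j R = R" if "j \<noteq> 2" "\<not> joined 2 j" for j
    using that by (cases j rule: node_cases)
      (simp_all add: S_mob s_mult s_inverse power2_eq_square s_a S_G joined_def doubleton_eq_iff)
  have L: "S j L = L" if "j \<noteq> 3" "\<not> joined 3 j" for j
    using that by (cases j rule: node_cases)
      (simp_all add: S_mob s_mult s_inverse power2_eq_square s_a S_F joined_def doubleton_eq_iff)
  have "\<not> joined j i"
    using assms joined_sym by blast
  show ?thesis
  proof (cases "i = j")
    case False
    show ?thesis
    proof (rule hom_eqI)
      show "(S i \<circ> S j) (\<iota> k) = (S j \<circ> S i) (\<iota> k)" for k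
        using K_eq[OF s_commute[OF assms]] by (simp add: S_\<iota>)
      show "(S i \<circ> S j) F = (S j \<circ> S i) F"
        using False assms \<open>\<not> joined j i\<close> by (auto simp: S_F S_mult R)
      show "(S i \<circ> S j) G = (S j \<circ> S i) G"
        using False assms \<open>\<not> joined j i\<close> by (auto simp: S_G S_mult S_inverse L)
    qed (simp_all add: hom_comp S_hom S_q)
  qed simp
qed

lemma S_braid_conj:
  assumes "D \<circ> D = id" "\<And>j. D \<circ> S j = S (\<pi> j) \<circ> D" "S i \<circ> S j \<circ> S i = S j \<circ> S i \<circ> S j"
  shows "S (\<pi> i) \<circ> S (\<pi> j) \<circ> S (\<pi> i) = S (\<pi> j) \<circ> S (\<pi> i) \<circ> S (\<pi> j)"
proof -
  have "D \<circ> (S i \<circ> S j \<circ> S i) \<circ> D = S (\<pi> i) \<circ> S (\<pi> j) \<circ> S (\<pi> i)" for i j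
    by (metis assms(1,2) comp_assoc comp_id)
  then show ?thesis
    using assms(3) by metis
qed

lemma S_braid_0_2: "S 0 \<circ> S 2 \<circ> S 0 = S 2 \<circ> S 0 \<circ> S 2"
proof (rule hom_eqI)
  have "joined 0 2"
    by (simp add: joined_def)
  then show "(S 0 \<circ> S 2 \<circ> S 0) (\<iota> k) = (S 2 \<circ> S 0 \<circ> S 2) (\<iota> k)" for k
    using fun_cong[OF s_braid[of 0 2], of k] by (simp add: S_\<iota>)
  let ?x = "a 0 * inverse (a 1)" and ?b = "(a 2)\<^sup>2" and ?c = "(a 0)\<^sup>2"
  \<comment> \<open>Inverting \<open>a 0\<close> divides the ratio by \<open>?c\<close>, and
    multiplying \<open>a 2\<close> by \<open>a 0\<close> multiplies its square by \<open>?c\<close>.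
    These are the parameters occurring in \<open>mob_mult\<close>.\<close>
  have s0: "s 0 ?x = ?x / ?c" "s 0 ?b = ?c * ?b"
    by (simp_all add: division_ring_hom.divide[OF s_hom] division_ring_hom.one[OF s_hom] s_mult s_inverse s_a joined_def
        doubleton_eq_iff power2_eq_square field_simps)
  have s2: "s 2 (?x / ?c) = ?x / (?c * ?b)" "s 2 (?c * ?b) = ?c"
    by (simp_all add: division_ring_hom.divide[OF s_hom] division_ring_hom.one[OF s_hom] s_mult s_inverse s_a joined_def
        doubleton_eq_iff power2_eq_square field_simps)
  have "R * mob (?x / (?c * ?b)) ?c G = mob (?x / ?c) (?c * ?b) G"
    by (rule mob_mult) (simp_all add: FG_not_scalar)
  then show "(S 0 \<circ> S 2 \<circ> S 0) F = (S 2 \<circ> S 0 \<circ> S 2) F"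
    by (simp add: S_F S_mult S_mob S_G s0 s2 mult.assoc)
qed (simp_all add: hom_comp S_hom S_q S_G)

text \<open>The two ratios of outer parameters are fixed by both reflections, so they are absorbed
  into \<open>f\<close> and \<open>g\<close>. What remains, after removing \<open>F\<close> on the
  left, is \<open>division_ring_braid\<close> with the squares of \<open>a 2\<close> and
  \<open>a 3\<close> as the central elements.\<close>

lemma S_braid_2_3_F: "(S 2 \<circ> S 3 \<circ> S 2) F = (S 3 \<circ> S 2 \<circ> S 3) F"
proof -
  let ?x = "a 0 * inverse (a 1)" and ?y = "a 4 * inverse (a 5)" and ?b = "(a 2)\<^sup>2" and ?d = "(a 3)\<^sup>2"
  define f where "f = \<iota> ?y * F"
  define g where "g = \<iota> ?x * G"
  have s2: "s 2 ?y = ?y" "s 2 ?x = ?x" "s 2 ?d = ?b * ?d" "s 2 (?b * ?d) = ?d"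
    by (simp_all add: division_ring_hom.divide[OF s_hom] division_ring_hom.one[OF s_hom] s_mult s_inverse s_a joined_def
        doubleton_eq_iff power2_eq_square field_simps)
  have s3: "s 3 ?x = ?x" "s 3 ?b = ?b * ?d"
    by (simp_all add: division_ring_hom.divide[OF s_hom] division_ring_hom.one[OF s_hom] s_mult s_inverse s_a joined_def
        doubleton_eq_iff power2_eq_square field_simps)
  have x_left: "\<iota> (?x * c) * (z * G) = \<iota> c * (z * g)" for c z
    using scalar_mult_scalar[of c z ?x G] by (simp add: g_def mult.commute mult.assoc)
  have y_left: "\<iota> (?y * c) * (F * z) = \<iota> c * (f * z)" for c z
    using scalar_mult_scalar[of c 1 ?y "F * z"] by (simp add: f_def mult.commute mult.assoc)
  have R: "R = (g + \<iota> ?b) * inverse (\<iota> ?b * g + 1)"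
    using x_left[of ?b 1] by (simp add: mob_def divide_inverse g_def)
  have L: "inverse L = (\<iota> ?d * f + 1) * inverse (f + \<iota> ?d)"
    using y_left[of ?d 1] linear_nonzero[OF FG_not_scalar(1), of ?y ?d]
      linear_nonzero_1[OF FG_not_scalar(1), of "?y * ?d"]
    by (simp add: mob_def divide_inverse f_def nonzero_inverse_mult_distrib)
  have FR: "F * R \<notin> range \<iota>"
    using S_not_scalar[OF FG_not_scalar(1), of 2] by (simp add: S_F)
  have L2: "S 2 (inverse L) = (\<iota> ?b * \<iota> ?d * (f * R) + 1) * inverse (f * R + \<iota> ?b * \<iota> ?d)"
  proof -
    have "S 2 (inverse L) = inverse (mob ?y (?b * ?d) (F * R))"
      by (simp add: S_inverse S_mob s2 S_F)
    then show ?thesis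
      using y_left[of "?b * ?d" R] y_left[of 1 R] linear_nonzero[OF FR, of ?y "?b * ?d"]
        linear_nonzero_1[OF FR, of "?y * (?b * ?d)"]
      by (simp add: mob_def divide_inverse nonzero_inverse_mult_distrib embed_mult embed_one)
  qed
  have S23: "S 2 (S 3 F) = F * R" "S 3 (S 2 F) = F * mob ?x (?b * ?d) (inverse L * G)"
    "S 2 (S 3 (S 2 F)) = F * (R * mob ?x ?d (S 2 (inverse L) * G))"
    by (simp_all add: S_F S_mult S_mob S_G s3 s2 mult.assoc)
  \<comment> \<open>These elements are \<open>S 3 G\<close> and \<open>S 2 (S 3 G)\<close>. As
    images of a nonscalar element they are nonscalar, which keeps all numerators and denominators
    below nonzero.\<close>
  have nonscalar: "inverse L * G \<notin> range \<iota>" "S 2 (inverse L) * G \<notin> range \<iota>"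
    using S_not_scalar[OF FG_not_scalar(2), of 3]
      S_not_scalar[OF S_not_scalar[OF FG_not_scalar(2), of 3], of 2] by (simp_all add: S_G S_mult)
  have mob_u: "mob ?x c (z * G) = (z * g + \<iota> c) * inverse (\<iota> c * (z * g) + 1)" for c z
    using x_left[of 1 z] by (simp add: mob_def divide_inverse x_left embed_one)
  have lin_u: "z * g + \<iota> c \<noteq> 0" "c \<noteq> 0 \<Longrightarrow> \<iota> c * (z * g) + 1 \<noteq> 0" if "z * G \<notin> range \<iota>" for z c
    using linear_nonzero[OF that, of ?x c] linear_nonzero_1[OF that, of "?x * c"] x_left[of 1 z]
    by (simp_all add: x_left embed_one)
  have "R * mob ?x ?d (S 2 (inverse L) * G) = mob ?x (?b * ?d) (inverse L * G)"
    unfolding mob_u L2 unfolding L R embed_mult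
  proof (rule division_ring_braid)
    show "g + \<iota> ?b \<noteq> 0" "\<iota> ?b * g + 1 \<noteq> 0"
      using lin_u[of 1] FG_not_scalar(2) by simp_all
    show "f + \<iota> ?d \<noteq> 0"
      using linear_nonzero[OF FG_not_scalar(1), of ?y ?d] by (simp add: f_def)
    show "f * ((g + \<iota> ?b) * inverse (\<iota> ?b * g + 1)) + \<iota> ?b * \<iota> ?d \<noteq> 0"
      using y_left[of 1 R] linear_nonzero[OF FR, of ?y "?b * ?d"] by (simp add: R embed_mult embed_one)
    show "(\<iota> ?b * \<iota> ?d * (f * ((g + \<iota> ?b) * inverse (\<iota> ?b * g + 1))) + 1) *
        inverse (f * ((g + \<iota> ?b) * inverse (\<iota> ?b * g + 1)) + \<iota> ?b * \<iota> ?d) * g + \<iota> ?d \<noteq> 0"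
      using lin_u(1)[OF nonscalar(2), of ?d] by (simp only: L2 R not_False_eq_True)
    show "\<iota> ?d * ((\<iota> ?b * \<iota> ?d * (f * ((g + \<iota> ?b) * inverse (\<iota> ?b * g + 1))) + 1) *
        inverse (f * ((g + \<iota> ?b) * inverse (\<iota> ?b * g + 1)) + \<iota> ?b * \<iota> ?d) * g) + 1 \<noteq> 0"
      using lin_u(2)[OF nonscalar(2), of ?d] by (simp only: L2 R) simp
    show "(\<iota> ?d * f + 1) * inverse (f + \<iota> ?d) * g + \<iota> ?b * \<iota> ?d \<noteq> 0"
      using lin_u(1)[OF nonscalar(1), of "?b * ?d"] by (simp only: L embed_mult not_False_eq_True)
    show "\<iota> ?b * \<iota> ?d * ((\<iota> ?d * f + 1) * inverse (f + \<iota> ?d) * g) + 1 \<noteq> 0"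
      using lin_u(2)[OF nonscalar(1), of "?b * ?d"] by (simp only: L embed_mult) simp
  qed (rule embed_central[symmetric] embed_central)+
  then show ?thesis
    using S23 by (simp add: S_F)
qed

lemma S_braid_2_3: "S 2 \<circ> S 3 \<circ> S 2 = S 3 \<circ> S 2 \<circ> S 3"
proof (rule hom_eqI)
  have "joined 2 3"
    by (simp add: joined_def)
  then show "(S 2 \<circ> S 3 \<circ> S 2) (\<iota> k) = (S 3 \<circ> S 2 \<circ> S 3) (\<iota> k)" for k
    using fun_cong[OF s_braid[of 2 3], of k] by (simp add: S_\<iota>)
  have T_apply: "T (S j x) = S (5 - j) (T x)" "T (T x) = x" for j x
    using fun_cong[OF T_S[of j], of x] fun_cong[OF T_T, of x] by simp_all
  have "S 2 (S 3 (S 2 G)) = T (S 3 (S 2 (S 3 F)))"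
    by (simp add: T_apply T_F)
  also have "\<dots> = T (S 2 (S 3 (S 2 F)))"
    using S_braid_2_3_F by simp
  finally show "(S 2 \<circ> S 3 \<circ> S 2) G = (S 3 \<circ> S 2 \<circ> S 3) G"
    by (simp add: T_apply T_F)
qed (use S_braid_2_3_F in \<open>simp_all add: hom_comp S_hom S_q\<close>)

lemma S_braid:
  assumes "joined i j"
  shows "S i \<circ> S j \<circ> S i = S j \<circ> S i \<circ> S j"
proof -
  have b12: "S 1 \<circ> S 2 \<circ> S 1 = S 2 \<circ> S 1 \<circ> S 2"
    using S_braid_conj[OF S01_S01 S01_S S_braid_0_2] by (simp add: swap01_def)
  have b35: "S 5 \<circ> S 3 \<circ> S 5 = S 3 \<circ> S 5 \<circ> S 3"
    using S_braid_conj[OF T_T T_S S_braid_0_2] by simp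
  have b34: "S 4 \<circ> S 3 \<circ> S 4 = S 3 \<circ> S 4 \<circ> S 3"
    using S_braid_conj[OF T_T T_S b12] by simp
  have "{i, j} \<in> {{0, 2}, {1, 2}, {2, 3}, {3, 4}, {3, 5}}"
    using assms by (simp add: joined_def)
  then show ?thesis
    using S_braid_0_2 S_braid_2_3 b12 b34 b35 by (auto simp: doubleton_eq_iff)
qed

end

section \<open>Words in a family of maps\<close>

definition word_act :: "('i \<Rightarrow> 'x \<Rightarrow> 'x) \<Rightarrow> 'i list \<Rightarrow> 'x \<Rightarrow> 'x" where
  "word_act g w = foldr (\<lambda>i. (\<circ>) (g i)) w id"

lemma word_act_Nil [simp]: "word_act g [] = id"
  and word_act_Cons [simp]: "word_act g (i # w) = g i \<circ> word_act g w"
  by (simp_all add: word_act_def)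

lemma word_act_append: "word_act g (u @ v) = word_act g u \<circ> word_act g v"
  by (induction u) (auto simp: comp_assoc)

lemma word_act_map: "word_act g (map h w) = word_act (g \<circ> h) w"
  by (induction w) auto

lemma word_act_rev:
  assumes "\<And>i. g i \<circ> g i = id"
  shows "word_act g (rev w) \<circ> word_act g w = id"
proof (induction w)
  case (Cons i w)
  have "word_act g (rev (i # w)) \<circ> word_act g (i # w) =
      word_act g (rev w) \<circ> (g i \<circ> g i) \<circ> word_act g w"
    by (simp only: rev.simps word_act_append word_act_Cons word_act_Nil comp_id comp_assoc)
  then show ?case
    by (simp only: assms comp_id Cons)
qed simp

lemma word_act_intertwine:
  assumes "\<And>i. \<phi> \<circ> g i = g (\<pi> i) \<circ> \<phi>"
  shows "\<phi> \<circ> word_act g w = word_act g (map \<pi> w) \<circ> \<phi>"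
proof (induction w)
  case (Cons i w)
  have "\<phi> \<circ> word_act g (i # w) = g (\<pi> i) \<circ> (\<phi> \<circ> word_act g w)"
    by (simp only: word_act_Cons assms comp_assoc[symmetric])
  then show ?case
    by (simp only: Cons word_act_Cons list.map comp_assoc)
qed simp

section \<open>Positivity in simply laced reflection groups\<close>

text \<open>Tits' argument on faithfulness of the geometric representation, applied directly to the
  group generated by the maps \<open>f i\<close>; roots are written multiplicatively as the images of
  \<open>e i\<close>, and \<open>P\<close> contains the positive ones.\<close>

locale simply_laced_action =
  fixes f :: "'i \<Rightarrow> 'y \<Rightarrow> 'y::division_ring" and e :: "'i \<Rightarrow> 'y"
    and adj :: "'i \<Rightarrow> 'i \<Rightarrow> bool" and P :: "'y set"
  assumes hom: "division_ring_hom (f i)"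
    and involution: "f i \<circ> f i = id"
    and commute: "\<not> adj i j \<Longrightarrow> f i \<circ> f j = f j \<circ> f i"
    and braid: "adj i j \<Longrightarrow> f i \<circ> f j \<circ> f i = f j \<circ> f i \<circ> f j"
    and e_nonzero: "e i \<noteq> 0" and e_commute: "e i * e j = e j * e i"
    and f_e_same: "f i (e i) = inverse (e i)"
    and f_e_adj: "adj i j \<Longrightarrow> f j (e i) = e i * e j"
    and f_e_other: "i \<noteq> j \<Longrightarrow> \<not> adj i j \<Longrightarrow> f j (e i) = e i"
    and adj_sym: "adj i j \<Longrightarrow> adj j i"
    and e_P: "e i \<in> P" and mult_P: "x \<in> P \<Longrightarrow> y \<in> P \<Longrightarrow> x * y \<in> P"
begin

abbreviation G where "G \<equiv> range (word_act f)"

definition len :: "('y \<Rightarrow> 'y) \<Rightarrow> nat" where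
  "len \<phi> = (LEAST n. \<exists>w. length w = n \<and> word_act f w = \<phi>)"

lemma len_le: "len (word_act f w) \<le> length w"
  unfolding len_def by (rule Least_le) blast

lemma len_word:
  assumes "\<phi> \<in> G"
  obtains w where "word_act f w = \<phi>" "length w = len \<phi>"
proof -
  have "\<exists>n w. length w = n \<and> word_act f w = \<phi>"
    using assms by blast
  then have "\<exists>w. length w = len \<phi> \<and> word_act f w = \<phi>"
    unfolding len_def by (rule LeastI_ex)
  then show ?thesis
    using that by blast
qed

lemma comp_in_G: "\<phi> \<in> G \<Longrightarrow> \<phi> \<circ> f i \<in> G"
proof -
  assume "\<phi> \<in> G"
  then obtain w where "\<phi> = word_act f w"
    by blast
  then have "\<phi> \<circ> f i = word_act f (w @ [i])"
    by (simp add: word_act_append)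
  then show ?thesis
    by blast
qed

lemma len_comp_le:
  assumes "\<phi> \<in> G"
  shows "len (\<phi> \<circ> f i) \<le> len \<phi> + 1"
proof -
  obtain w where w: "word_act f w = \<phi>" "length w = len \<phi>"
    using assms by (rule len_word)
  then have "\<phi> \<circ> f i = word_act f (w @ [i])"
    by (simp add: word_act_append)
  then show ?thesis
    using len_le[of "w @ [i]"] w(2) by simp
qed

lemma cancel: "\<phi> \<circ> f i \<circ> f i = \<phi>"
  by (simp add: comp_assoc involution)

lemma descent_exists:
  assumes "\<phi> \<in> G" "\<phi> \<noteq> id"
  obtains i where "len (\<phi> \<circ> f i) < len \<phi>"
proof -
  obtain w where w: "word_act f w = \<phi>" "length w = len \<phi>"
    using assms(1) by (rule len_word)
  with assms(2) obtain v i where vi: "w = v @ [i]"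
    by (cases w rule: rev_cases) auto
  then have "\<phi> \<circ> f i = word_act f v"
    using w(1) cancel[of "word_act f v" i] by (auto simp: word_act_append)
  then have "len (\<phi> \<circ> f i) < len \<phi>"
    using len_le[of v] w(2) vi by simp
  then show ?thesis
    by (rule that)
qed

lemma hom_G: "\<phi> \<in> G \<Longrightarrow> division_ring_hom \<phi>"
proof -
  have "division_ring_hom (word_act f w)" for w
  proof (induction w)
    case Nil
    show ?case
      by (simp add: division_ring_hom_def)
  next
    case (Cons i w)
    then show ?case
      unfolding word_act_Cons by (intro division_ring_hom_comp hom)
  qed
  then show "\<phi> \<in> G \<Longrightarrow> division_ring_hom \<phi>"
    by blast
qed

text \<open>Induction on the length: split off a right descent \<open>j\<close>, leaving
  \<open>v\<close>. If \<open>f i\<close> and \<open>f j\<close> commute, \<open>i\<close> is no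
  descent of \<open>v\<close>, and \<open>v\<close> has the same value at \<open>e i\<close>. In the
  braid case the root is \<open>v (e i) * v (e j)\<close> with positive second factor; should
  \<open>i\<close> be a descent of \<open>v\<close>, splitting off \<open>f i\<close> as well makes
  the product telescope to \<open>u (e j)\<close>.\<close>

lemma positive:
  assumes "\<phi> \<in> G" "len (\<phi> \<circ> f i) \<ge> len \<phi>"
  shows "\<phi> (e i) \<in> P"
  using assms
proof (induction "len \<phi>" arbitrary: \<phi> i rule: less_induct)
  case less
  show ?case
  proof (cases "\<phi> = id")
    case True
    then show ?thesis
      by (simp add: e_P)
  next
    case False
    with less.prems(1) obtain j where j: "len (\<phi> \<circ> f j) < len \<phi>"
      by (rule descent_exists)
    define v where "v = \<phi> \<circ> f j"
    have v: "v \<in> G" and \<phi>: "\<phi> = v \<circ> f j"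
      using less.prems(1) by (simp_all add: v_def comp_in_G cancel)
    have ij: "i \<noteq> j"
      using less.prems(2) j by auto
    have len_v: "len v < len \<phi>"
      using j by (simp add: v_def)
    interpret v: division_ring_hom v
      by (rule hom_G) (rule v)
    show ?thesis
    proof (cases "adj i j")
      case False
      have "len (v \<circ> f i) \<ge> len v"
      proof (rule ccontr)
        assume "\<not> len v \<le> len (v \<circ> f i)"
        moreover have "\<phi> \<circ> f i = (v \<circ> f i) \<circ> f j"
          using commute[OF False] by (simp add: \<phi> comp_assoc)
        ultimately show False
          using len_comp_le[OF comp_in_G[OF v], of i j] len_v less.prems(2) by simp
      qed
      then have "v (e i) \<in> P"
        using less.hyps len_v v by blast
      then show ?thesis
        using f_e_other[OF ij False] by (simp add: \<phi>)
    next
      case True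
      have "v (e j) \<in> P"
        using less.hyps[of v j] len_v v by (simp flip: \<phi>)
      have \<phi>_e: "\<phi> (e i) = v (e i) * v (e j)"
        using f_e_adj[OF True] by (simp add: \<phi> v.mult)
      show ?thesis
      proof (cases "len (v \<circ> f i) \<ge> len v")
        case True
        then have "v (e i) \<in> P"
          using less.hyps len_v v by blast
        then show ?thesis
          using \<phi>_e mult_P \<open>v (e j) \<in> P\<close> by simp
      next
        case False
        define u where "u = v \<circ> f i"
        have u: "u \<in> G" and vu: "v = u \<circ> f i"
          using v by (simp_all add: u_def comp_in_G cancel)
        interpret u: division_ring_hom u
          by (rule hom_G) (rule u)
        have "u (e j) \<in> P"
        proof (rule less.hyps)
          show "len u < len \<phi>"
            using False len_v by (simp add: u_def)
          show "len u \<le> len (u \<circ> f j)"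
          proof (rule ccontr)
            assume "\<not> len u \<le> len (u \<circ> f j)"
            \<comment> \<open>\<open>\<phi>\<close> ends in \<open>f i \<circ> f j\<close> after
              \<open>u\<close>; the braid relation rewrites the longer element so that a descent
              \<open>j\<close> of \<open>u\<close> would make it shorter than
              \<open>\<phi>\<close>.\<close>
            moreover have "\<phi> \<circ> f i = u \<circ> f j \<circ> f i \<circ> f j"
              using braid[OF \<open>adj i j\<close>] by (simp add: \<phi> vu comp_assoc)
            moreover have "len (u \<circ> f j \<circ> f i \<circ> f j) \<le> len (u \<circ> f j) + 2"
              using len_comp_le[OF comp_in_G[OF comp_in_G[OF u]], of j i j]
                len_comp_le[OF comp_in_G[OF u], of j i] by simp
            ultimately show False
              using less.prems(2) False len_v by (simp add: u_def)
          qed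
        qed (rule u)
        moreover have "\<phi> (e i) = u (e j)"
        proof -
          have "v (e i) = inverse (u (e i))"
            by (simp add: vu f_e_same u.inverse)
          moreover have "v (e j) = u (e i) * u (e j)"
            using f_e_adj[OF adj_sym[OF \<open>adj i j\<close>]] e_commute[of j i] by (simp add: vu u.mult)
          ultimately show ?thesis
            unfolding \<phi>_e using e_nonzero[of i] by (simp add: u.eq_0_iff flip: mult.assoc)
        qed
        ultimately show ?thesis
          by simp
      qed
    qed
  qed
qed

text \<open>A right descent \<open>i\<close> of \<open>\<phi>\<close> is an ascent of
  \<open>\<phi> \<circ> f i\<close>, and the value of the latter at \<open>e i\<close> is the
  inverse of \<open>\<phi> (e i)\<close>.\<close>

lemma negative_root_exists:
  assumes "\<phi> \<in> G" "\<phi> \<noteq> id"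
  obtains i where "inverse (\<phi> (e i)) \<in> P"
proof -
  obtain i where i: "len (\<phi> \<circ> f i) < len \<phi>"
    using assms by (rule descent_exists)
  have "(\<phi> \<circ> f i) (e i) \<in> P"
  proof (rule positive)
    show "len (\<phi> \<circ> f i) \<le> len (\<phi> \<circ> f i \<circ> f i)"
      unfolding cancel using i by simp
  qed (rule comp_in_G, fact)
  then have "inverse (\<phi> (e i)) \<in> P"
    by (simp add: f_e_same division_ring_hom.inverse[OF hom_G[OF assms(1)]])
  then show ?thesis
    by (rule that)
qed

end

section \<open>The extended Weyl group\<close>

text \<open>A common alphabet, so that one word can be read both on the parameters and on the skew
  field.\<close>

datatype generator = Reflection node | Diagram01 | Diagram45 | Diagram_reversal

primrec gen_K :: "generator \<Rightarrow> ratfun \<Rightarrow> ratfun" where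
  "gen_K (Reflection j) = s j"
| "gen_K Diagram01 = \<sigma>01"
| "gen_K Diagram45 = \<sigma>45"
| "gen_K Diagram_reversal = \<tau>"

lemma gen_K_gen_K: "gen_K x \<circ> gen_K x = id"
  by (cases x) (simp_all only: gen_K.simps s_s \<sigma>01_\<sigma>01 \<sigma>45_\<sigma>45 \<tau>_\<tau>)

lemma ring_automorphism_gen_K: "ring_automorphism (gen_K x)"
  by (cases x) (simp_all add: ring_automorphism_s ring_automorphism_\<sigma>01 ring_automorphism_\<sigma>45 ring_automorphism_\<tau>)

lemma ring_automorphism_id: "ring_automorphism id"
  by (simp add: ring_automorphism_def)

lemma ring_automorphism_comp:
  "ring_automorphism \<phi> \<Longrightarrow> ring_automorphism \<psi> \<Longrightarrow> ring_automorphism (\<phi> \<circ> \<psi>)"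
  unfolding ring_automorphism_def by (auto intro: bij_comp)

lemma ring_automorphism_word_act:
  assumes "\<And>i. ring_automorphism (g i)"
  shows "ring_automorphism (word_act g w)"
  by (induction w) (simp_all only: word_act_Nil word_act_Cons ring_automorphism_id ring_automorphism_comp assms)

lemma Aut_ring_simps:
  "\<phi> \<in> carrier Aut_ring \<longleftrightarrow> ring_automorphism \<phi>"
  "\<phi> \<otimes>\<^bsub>Aut_ring\<^esub> \<psi> = \<phi> \<circ> \<psi>" "\<one>\<^bsub>Aut_ring\<^esub> = id"
  by (simp_all add: Aut_ring_def comp_group_def)

lemma inv_Aut_ring:
  assumes "ring_automorphism \<phi>" "\<phi> \<circ> \<psi> = id" "\<psi> \<circ> \<phi> = id" "ring_automorphism \<psi>"
  shows "inv\<^bsub>Aut_ring\<^esub> \<phi> = \<psi>"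
proof -
  have "\<chi> = \<psi>" if "\<chi> \<circ> \<phi> = id" for \<chi>
    using that assms(2) by (metis comp_assoc comp_id id_comp)
  then show ?thesis
    unfolding m_inv_def Aut_ring_simps by (intro the_equality) (use assms in blast)+
qed

text \<open>The inverse of a word in involutions is the reversed word. The generating set may be
  larger than the set of letters, because \<open>W_ext\<close> is generated by the whole carrier of
  \<open>W\<close> together with the diagram maps.\<close>

lemma carrier_generated_by_involutions:
  fixes g :: "'i \<Rightarrow> 'r::division_ring \<Rightarrow> 'r"
  assumes aut: "\<And>i. ring_automorphism (g i)" and inv: "\<And>i. g i \<circ> g i = id"
    and "range g \<subseteq> A" "A \<subseteq> range (word_act g)"
  shows "carrier (subgroup_generated Aut_ring A) = range (word_act g)"
proof -
  have "ring_automorphism (word_act g w)" for w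
    by (rule ring_automorphism_word_act) (rule aut)
  then have "range (word_act g) \<subseteq> carrier Aut_ring"
    by (auto simp: Aut_ring_simps)
  then have A: "A \<inter> carrier Aut_ring = A"
    using assms(4) by blast
  have "\<phi> \<in> range (word_act g)" if "\<phi> \<in> generate Aut_ring A" for \<phi>
    using that
  proof induction
    case one
    have "\<one>\<^bsub>Aut_ring\<^esub> = word_act g []"
      by (simp only: Aut_ring_simps word_act_Nil)
    then show ?case
      by blast
  next
    case (incl h)
    then show ?case
      using assms(4) by blast
  next
    case (inv h)
    then obtain w where h: "h = word_act g w"
      using assms(4) by blast
    have "inv\<^bsub>Aut_ring\<^esub> h = word_act g (rev w)"
      unfolding h
    proof (rule inv_Aut_ring)
      show "word_act g (rev w) \<circ> word_act g w = id" "word_act g w \<circ> word_act g (rev w) = id"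
        using word_act_rev[of g w] word_act_rev[of g "rev w"] assms(2) by simp_all
    qed (rule ring_automorphism_word_act, rule aut)+
    then show ?case
      by blast
  next
    case (eng h1 h2)
    then obtain u v where "h1 = word_act g u" "h2 = word_act g v"
      by blast
    then have "h1 \<otimes>\<^bsub>Aut_ring\<^esub> h2 = word_act g (u @ v)"
      by (simp only: Aut_ring_simps word_act_append)
    then show ?case
      by blast
  qed
  moreover have "word_act g w \<in> generate Aut_ring A" for w
  proof (induction w)
    case Nil
    show ?case
      using generate.one[of Aut_ring A] by (simp only: Aut_ring_simps word_act_Nil)
  next
    case (Cons i w)
    have "g i \<in> generate Aut_ring A"
      using assms(3) by (intro generate.incl) blast
    from generate.eng[OF this Cons] show ?case
      by (simp only: Aut_ring_simps word_act_Cons)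
  qed
  ultimately show ?thesis
    unfolding carrier_subgroup_generated Int_commute[of "carrier Aut_ring"] A by blast
qed

lemma carrier_W: "carrier W = range (word_act s)"
  unfolding W_def
proof (rule carrier_generated_by_involutions)
  have "s i = word_act s [i]" for i
    by simp
  then show "range s \<subseteq> range (word_act s)"
    by blast
qed (simp_all only: ring_automorphism_s s_s subset_refl)

lemma word_act_s: "word_act s u = word_act gen_K (map Reflection u)"
proof -
  have "gen_K \<circ> Reflection = s"
    by (simp add: fun_eq_iff)
  then show ?thesis
    by (simp add: word_act_map)
qed

lemma carrier_W_ext: "carrier W_ext = range (word_act gen_K)"
  unfolding W_ext_def
proof (rule carrier_generated_by_involutions)
  have gen: "gen_K x = word_act gen_K [x]" for x
    by (simp only: word_act_Cons word_act_Nil comp_id)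
  have "s i \<in> carrier W" for i
    unfolding carrier_W by (rule range_eqI[of _ _ "[i]"]) simp
  then have "gen_K x \<in> carrier W \<union> {\<sigma>01, \<sigma>45, \<tau>}" for x
    by (cases x) simp_all
  then show "range gen_K \<subseteq> carrier W \<union> {\<sigma>01, \<sigma>45, \<tau>}"
    by blast
  have "carrier W \<subseteq> range (word_act gen_K)"
    unfolding carrier_W word_act_s by blast
  moreover have "{\<sigma>01, \<sigma>45, \<tau>} \<subseteq> range (word_act gen_K)"
    using gen[of Diagram01] gen[of Diagram45] gen[of Diagram_reversal] by (simp only: gen_K.simps) blast
  ultimately show "carrier W \<union> {\<sigma>01, \<sigma>45, \<tau>} \<subseteq> range (word_act gen_K)"
    by blast
qed (simp_all only: ring_automorphism_gen_K gen_K_gen_K)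

lemma diagram_\<delta>: "\<sigma>01 \<delta> = inverse \<delta>" "\<sigma>45 \<delta> = inverse \<delta>" "\<tau> \<delta> = inverse \<delta>"
proof -
  have *: "\<phi> \<delta> = \<phi> (a 0) * \<phi> (a 1) * (\<phi> (a 2))\<^sup>2 * (\<phi> (a 3))\<^sup>2 * \<phi> (a 4) * \<phi> (a 5)"
    if "division_ring_hom \<phi>" for \<phi>
    by (simp add: \<delta>_def division_ring_hom.mult[OF that] division_ring_hom.power[OF that])
  show "\<sigma>01 \<delta> = inverse \<delta>" "\<sigma>45 \<delta> = inverse \<delta>" "\<tau> \<delta> = inverse \<delta>"
    unfolding *[OF \<sigma>01_hom] *[OF \<sigma>45_hom] *[OF \<tau>_hom]
    by (simp_all add: \<sigma>01_a \<sigma>45_a \<tau>_a \<delta>_def power_inverse mult_ac)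
qed

lemma word_act_s_\<delta>: "word_act s u \<delta> = \<delta>"
  by (induction u) (simp_all add: s_\<delta>)

text \<open>Normal forms for a dihedral group of order eight: the reversal comes first, followed by
  the two commuting maps that it exchanges.\<close>

definition diagram_words :: "generator list set" where
  "diagram_words = {[], [Diagram01], [Diagram45], [Diagram01, Diagram45], [Diagram_reversal],
     [Diagram_reversal, Diagram01], [Diagram_reversal, Diagram45],
     [Diagram_reversal, Diagram01, Diagram45]}"

context skew_field
begin

primrec gen_F :: "generator \<Rightarrow> 'f \<Rightarrow> 'f" where
  "gen_F (Reflection j) = S j"
| "gen_F Diagram01 = S01"
| "gen_F Diagram45 = S45"
| "gen_F Diagram_reversal = T"

lemma gen_F_gen_F: "gen_F x \<circ> gen_F x = id"
  by (cases x) (simp_all only: gen_F.simps S_S S01_S01 S45_S45 T_T)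

lemma word_act_\<iota>: "word_act gen_F w (\<iota> k) = \<iota> (word_act gen_K w k)"
proof (induction w)
  case (Cons x w)
  then show ?case
    by (cases x) (simp_all add: S_\<iota> S01_\<iota> S45_\<iota> T_\<iota>)
qed simp

lemma word_act_K_eq: "word_act gen_F u = word_act gen_F v \<Longrightarrow> word_act gen_K u = word_act gen_K v"
proof
  fix k
  assume "word_act gen_F u = word_act gen_F v"
  then have "\<iota> (word_act gen_K u k) = \<iota> (word_act gen_K v k)"
    by (simp flip: word_act_\<iota>)
  then show "word_act gen_K u k = word_act gen_K v k"
    by (simp only: iota.eq_iff)
qed

text \<open>Positive elements are the monomials in the \<open>a i\<close> with natural exponents.
  The maps act on the skew field, but the roots are scalars, so a nontrivial lifted element is
  detected by its action on the parameters.\<close>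

sublocale W: simply_laced_action S "\<lambda>i. \<iota> (a i)" joined "range (\<lambda>m. \<iota> (meval a m))"
proof
  show "\<iota> (a i) \<in> range (\<lambda>m. \<iota> (meval a m))" for i
    by (rule range_eqI[of _ _ "Poly_Mapping.single i 1"]) simp
  show "x * y \<in> range (\<lambda>m. \<iota> (meval a m))"
    if "x \<in> range (\<lambda>m. \<iota> (meval a m))" "y \<in> range (\<lambda>m. \<iota> (meval a m))" for x y
    using that by (auto simp flip: embed_mult meval_add)
  show "S i (\<iota> (a i)) = inverse (\<iota> (a i))" for i
  proof -
    have "\<iota> (a i) * \<iota> (inverse (a i)) = 1"
      by (simp add: embed_one flip: embed_mult)
    then show ?thesis
      by (simp add: S_\<iota> s_a inverse_unique)
  qed
  show "S j (\<iota> (a i)) = \<iota> (a i) * \<iota> (a j)" if "joined i j" for i j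
  proof -
    have "joined j i" "i \<noteq> j"
      using that joined_sym joined_irrefl by blast+
    then show ?thesis
      by (simp add: S_\<iota> s_a mult.commute flip: embed_mult)
  qed
  show "S j (\<iota> (a i)) = \<iota> (a i)" if "i \<noteq> j" "\<not> joined i j" for i j
    using that joined_sym[of i j] by (simp add: S_\<iota> s_a)
  show "\<iota> (a i) \<noteq> 0" for i
    by (simp add: iota.eq_0_iff)
qed (rule division_ring_hom.one[OF S_hom] division_ring_hom.add[OF S_hom] S_mult S_S embed_central
    | erule S_commute S_braid joined_sym[THEN iffD1])+

lemma diagram_normal_form:
  assumes "d \<in> diagram_words" "x \<in> {Diagram01, Diagram45, Diagram_reversal}"
  shows "\<exists>d'\<in>diagram_words. gen_F x \<circ> word_act gen_F d = word_act gen_F d'"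
proof -
  have "S01 (S01 x) = x" "S45 (S45 x) = x" "T (T x) = x" "S45 (S01 x) = S01 (S45 x)"
    "S45 (T x) = T (S01 x)" "S01 (T x) = T (S45 x)" for x
  proof -
    show "S01 (S01 x) = x" "S45 (S45 x) = x" and TT: "T (T x) = x" for x
      using fun_cong[OF S01_S01] fun_cong[OF S45_S45] fun_cong[OF T_T] by simp_all
    show "S45 (S01 x) = S01 (S45 x)"
      using fun_cong[OF S01_S45] by simp
    show S45_T: "S45 (T x) = T (S01 x)" for x
      using fun_cong[OF T_S01] by simp
    show "S01 (T x) = T (S45 x)"
      using S45_T[of "T x"] by (simp add: TT)
  qed
  then show ?thesis
    using assms by (auto simp: diagram_words_def fun_eq_iff)
qed

lemma word_normal_form:
  "\<exists>u. \<exists>d\<in>diagram_words. word_act gen_F w = word_act gen_F (map Reflection u @ d)"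
proof (induction w)
  case Nil
  show ?case
    by (rule exI[of _ "[]"], rule bexI[of _ "[]"]) (simp_all add: diagram_words_def)
next
  case (Cons x w)
  then obtain u d where d: "d \<in> diagram_words"
    and w: "word_act gen_F w = word_act gen_F (map Reflection u @ d)"
    by blast
  show ?case
  proof (cases "\<exists>j. x = Reflection j")
    case True
    then obtain j where "x = Reflection j"
      by blast
    then have "word_act gen_F (x # w) = word_act gen_F (map Reflection (j # u) @ d)"
      by (simp add: w)
    then show ?thesis
      using d by blast
  next
    case False
    then have x: "x \<in> {Diagram01, Diagram45, Diagram_reversal}"
      by (cases x) auto
    then obtain \<pi> where \<pi>: "\<And>i. gen_F x \<circ> S i = S (\<pi> i) \<circ> gen_F x"
      using S01_S S45_S T_S by auto
    obtain d' where d': "d' \<in> diagram_words" "gen_F x \<circ> word_act gen_F d = word_act gen_F d'"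
      using diagram_normal_form[OF d x] by blast
    have S: "word_act gen_F (map Reflection u) = word_act S u" for u
    proof -
      have "gen_F \<circ> Reflection = S"
        by (simp add: fun_eq_iff)
      then show ?thesis
        by (simp add: word_act_map)
    qed
    have "word_act gen_F (x # w) = gen_F x \<circ> word_act S u \<circ> word_act gen_F d"
      by (simp only: word_act_Cons w word_act_append S comp_assoc)
    also have "gen_F x \<circ> word_act S u = word_act S (map \<pi> u) \<circ> gen_F x"
      by (rule word_act_intertwine) (rule \<pi>)
    finally have "word_act gen_F (x # w) = word_act gen_F (map Reflection (map \<pi> u) @ d')"
      by (simp only: word_act_append S comp_assoc d')
    then show ?thesis
      using d' by blast
  qed
qed

lemma gen_F_Reflection: "gen_F \<circ> Reflection = S"
  by (simp add: fun_eq_iff)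

lemma reflection_word_faithful:
  assumes "word_act gen_F (map Reflection u) \<noteq> id"
  obtains i m where "word_act s u (a i) = inverse (meval a m)"
proof -
  have S: "word_act gen_F (map Reflection u) = word_act S u"
    by (simp only: word_act_map gen_F_Reflection)
  with assms obtain i where "inverse (word_act S u (\<iota> (a i))) \<in> range (\<lambda>m. \<iota> (meval a m))"
    using W.negative_root_exists[of "word_act S u"] by auto
  then obtain m where "inverse (\<iota> (word_act s u (a i))) = \<iota> (meval a m)"
    by (auto simp: word_act_\<iota> word_act_s simp flip: S)
  moreover have "\<iota> (meval a m) \<noteq> 0"
    using meval_eq_0[of a m] by (auto simp: iota.eq_0_iff)
  ultimately have "\<iota> (word_act s u (a i)) * \<iota> (meval a m) = 1"
    by (metis inverse_zero right_inverse)
  then have "word_act s u (a i) * meval a m = 1"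
    using iota.eq_iff[of "word_act s u (a i) * meval a m" 1] by (simp only: embed_mult embed_one simp_thms)
  then have "word_act s u (a i) = inverse (meval a m)"
    by (metis inverse_inverse_eq inverse_unique)
  then show ?thesis
    by (rule that)
qed

lemma faithful:
  assumes "word_act gen_K w = id"
  shows "word_act gen_F w = id"
proof -
  obtain u d where d: "d \<in> diagram_words" and wF: "word_act gen_F w = word_act gen_F (map Reflection u @ d)"
    using word_normal_form by blast
  have wK: "word_act s u \<circ> word_act gen_K d = id"
    using word_act_K_eq[OF wF] assms by (simp only: word_act_append word_act_s)
  have wK_apply: "word_act s u (word_act gen_K d k) = k" for k
    using fun_cong[OF wK, of k] by (simp only: comp_apply id_apply)
  have \<sigma>_inv: "\<sigma>01 (inverse x) = inverse (\<sigma>01 x)" "\<sigma>45 (inverse x) = inverse (\<sigma>45 x)"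
    "\<tau> (inverse x) = inverse (\<tau> x)" for x
    using division_ring_hom.inverse \<sigma>01_hom \<sigma>45_hom \<tau>_hom by blast+
  have "word_act gen_K d \<delta> \<noteq> inverse \<delta>"
  proof
    assume "word_act gen_K d \<delta> = inverse \<delta>"
    then have "word_act s u (inverse \<delta>) = \<delta>"
      using wK_apply[of \<delta>] by simp
    moreover have "word_act s u (inverse \<delta>) = inverse \<delta>"
    proof -
      have "division_ring_hom (word_act s u)"
        using ring_automorphism_word_act[of s u] ring_automorphism_s by (simp add: ring_automorphism_iff_hom)
      then show ?thesis
        by (simp add: division_ring_hom.inverse word_act_s_\<delta>)
    qed
    ultimately show False
      using \<delta>_neq_inverse by simp
  qed
  \<comment> \<open>Each diagram letter inverts \<open>\<delta>\<close>, so exactly the words of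
    even length survive; in these the inversions cancel and a permutation of the variables
    remains.\<close>
  then have d': "d \<in> {[], [Diagram01, Diagram45], [Diagram_reversal, Diagram01], [Diagram_reversal, Diagram45]}"
    using d by (auto simp: diagram_words_def diagram_\<delta> \<sigma>_inv)
  have "\<exists>j. word_act gen_K d (a j) = a i" for i
  proof -
    consider "d = []" | "d = [Diagram01, Diagram45]" | "d = [Diagram_reversal, Diagram01]"
      | "d = [Diagram_reversal, Diagram45]"
      using d' by blast
    then show ?thesis
    proof cases
      case 1
      then show ?thesis by auto
    next
      case 2
      then show ?thesis
        by (intro exI[of _ "swap45 (swap01 i)"]) (auto simp: \<sigma>_inv \<sigma>01_a \<sigma>45_a swap01_def swap45_def)
    next
      case 3
      then show ?thesis
        by (intro exI[of _ "swap01 (5 - i)"]) (auto simp: \<sigma>_inv \<sigma>01_a \<tau>_a swap01_def)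
    next
      case 4
      then show ?thesis
        by (intro exI[of _ "swap45 (5 - i)"]) (auto simp: \<sigma>_inv \<sigma>45_a \<tau>_a swap45_def)
    qed
  qed
  \<comment> \<open>The reflection word undoes \<open>d\<close>, so it takes
    \<open>word_act gen_K d (a j)\<close> back to \<open>a j\<close>.\<close>
  then have pos: "\<exists>j. word_act s u (a i) = a j" for i
    using wK_apply by metis
  have uF: "word_act gen_F (map Reflection u) = id"
  proof (rule ccontr)
    assume "word_act gen_F (map Reflection u) \<noteq> id"
    then obtain i m where "word_act s u (a i) = inverse (meval a m)"
      by (rule reflection_word_faithful)
    then obtain j where "a j = inverse (meval a m)"
      using pos by metis
    then have "a j * meval a m = 1"
      using a_nonzero[of j] by (metis inverse_inverse_eq inverse_nonzero_iff_nonzero right_inverse)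
    then show False
      using a_mult_meval_neq_1 by blast
  qed
  then have "word_act gen_K (map Reflection u) = id"
    using word_act_K_eq[of "map Reflection u" "[]"] by (simp only: word_act_Nil)
  then have "word_act gen_K d = id"
    using wK by (simp only: word_act_s id_comp)
  then have "word_act gen_K d (a 0) = a 0"
    by simp
  \<comment> \<open>The three nonempty candidates send \<open>a 0\<close> to \<open>a 1\<close>,
    \<open>a 4\<close> and \<open>a 5\<close>.\<close>
  then have "d = []"
    using d' by (auto simp: \<sigma>_inv \<sigma>01_a \<sigma>45_a \<tau>_a)
  then show ?thesis
    using wF uF by simp
qed

section \<open>The homomorphisms from the groups of parameter maps\<close>

definition lift :: "(ratfun \<Rightarrow> ratfun) \<Rightarrow> 'f \<Rightarrow> 'f" where
  "lift \<phi> = word_act gen_F (SOME w. word_act gen_K w = \<phi>)"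

text \<open>The chosen word and \<open>w\<close> agree on the parameters, so the reverse of
  \<open>w\<close> followed by the chosen word is trivial there. By \<open>faithful\<close> it is
  trivial on the skew field, and the choice does not matter.\<close>

lemma lift_word_act: "lift (word_act gen_K w) = word_act gen_F w"
proof -
  define v where "v = (SOME v. word_act gen_K v = word_act gen_K w)"
  have "word_act gen_K v = word_act gen_K w"
    unfolding v_def by (rule someI) (rule refl)
  then have "word_act gen_K (rev w @ v) = id"
    by (simp only: word_act_append word_act_rev gen_K_gen_K)
  then have "word_act gen_F (rev w @ v) = id"
    by (rule faithful)
  then have "word_act gen_F w \<circ> word_act gen_F (rev w) \<circ> word_act gen_F v = word_act gen_F w"
    by (simp only: word_act_append comp_assoc comp_id)
  moreover have "word_act gen_F w \<circ> word_act gen_F (rev w) = id"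
    using word_act_rev[of gen_F "rev w"] gen_F_gen_F by (simp only: rev_rev_ident)
  ultimately show ?thesis
    by (simp only: lift_def v_def[symmetric] id_comp)
qed

lemma lift_comp:
  assumes "\<phi> \<in> range (word_act gen_K)" "\<psi> \<in> range (word_act gen_K)"
  shows "lift (\<phi> \<circ> \<psi>) = lift \<phi> \<circ> lift \<psi>"
  using assms by (auto simp only: word_act_append[symmetric] lift_word_act)

lemma lift_gen_K: "lift (gen_K x) = gen_F x"
  using lift_word_act[of "[x]"] by (simp only: word_act_Cons word_act_Nil comp_id)

lemma bij_gen_F: "bij (gen_F x)"
  using gen_F_gen_F by (rule o_bij) (rule gen_F_gen_F)

lemma ring_automorphism_S: "ring_automorphism (S j)"
  using S_hom bij_gen_F[of "Reflection j"] by (simp add: ring_automorphism_iff_hom)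

lemma ring_antiautomorphism_gen_F:
  "ring_antiautomorphism S01" "ring_antiautomorphism S45" "ring_antiautomorphism T"
  using S01_antihom S45_antihom T_antihom bij_gen_F[of Diagram01] bij_gen_F[of Diagram45]
    bij_gen_F[of Diagram_reversal]
  by (simp_all add: ring_antiautomorphism_def antihom_def)

lemma word_act_Aut_C_lin: "word_act gen_F w \<in> carrier (Aut_C_lin \<iota>)"
proof -
  have add: "gen_F x (y + z) = gen_F x y + gen_F x z" for x y z
    using S01_antihom S45_antihom T_antihom
    by (cases x) (simp_all add: antihom_def division_ring_hom.add[OF S_hom])
  have scale: "gen_F x (\<iota> (const c) * y) = \<iota> (const c) * gen_F x y" for x c y
    by (cases x) (simp_all add: S_mult S_\<iota> s_const antihom_mult[OF S01_antihom] S01_\<iota> \<sigma>01_const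
        antihom_mult[OF S45_antihom] S45_\<iota> \<sigma>45_const antihom_mult[OF T_antihom] T_\<iota> \<tau>_const
        embed_central[of "const c"])
  have "bij (word_act gen_F w)"
    by (induction w) (simp_all only: word_act_Nil word_act_Cons bij_id bij_comp bij_gen_F)
  moreover have "word_act gen_F w (y + z) = word_act gen_F w y + word_act gen_F w z" for y z
    by (induction w) (simp_all add: add)
  moreover have "word_act gen_F w (\<iota> (const c) * y) = \<iota> (const c) * word_act gen_F w y" for c y
    by (induction w) (simp_all add: scale)
  ultimately show ?thesis
    by (simp add: Aut_C_lin_def comp_group_def)
qed

lemma lift_hom_W: "lift \<in> hom W Aut_ring"
proof (rule homI)
  fix \<phi> assume "\<phi> \<in> carrier W"
  then obtain u where u: "\<phi> = word_act s u"
    unfolding carrier_W by blast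
  have "lift \<phi> = word_act S u"
    unfolding u word_act_s lift_word_act by (simp only: word_act_map gen_F_Reflection)
  then show "lift \<phi> \<in> carrier Aut_ring"
    using ring_automorphism_word_act[OF ring_automorphism_S] by (simp only: Aut_ring_simps)
next
  fix \<phi> \<psi> assume "\<phi> \<in> carrier W" "\<psi> \<in> carrier W"
  moreover have "carrier W \<subseteq> range (word_act gen_K)"
    unfolding carrier_W word_act_s by blast
  ultimately have "lift (\<phi> \<circ> \<psi>) = lift \<phi> \<circ> lift \<psi>"
    by (intro lift_comp) blast+
  then show "lift (\<phi> \<otimes>\<^bsub>W\<^esub> \<psi>) = lift \<phi> \<otimes>\<^bsub>Aut_ring\<^esub> lift \<psi>"
    by (simp add: W_def subgroup_generated_def Aut_ring_simps)
qed

lemma lift_hom_W_ext: "lift \<in> hom W_ext (Aut_C_lin \<iota>)"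
proof (rule homI)
  fix \<phi> assume "\<phi> \<in> carrier W_ext"
  then show "lift \<phi> \<in> carrier (Aut_C_lin \<iota>)"
    unfolding carrier_W_ext using word_act_Aut_C_lin lift_word_act by auto
next
  fix \<phi> \<psi> assume "\<phi> \<in> carrier W_ext" "\<psi> \<in> carrier W_ext"
  then have "lift (\<phi> \<circ> \<psi>) = lift \<phi> \<circ> lift \<psi>"
    unfolding carrier_W_ext by (rule lift_comp)
  then show "lift (\<phi> \<otimes>\<^bsub>W_ext\<^esub> \<psi>) = lift \<phi> \<otimes>\<^bsub>Aut_C_lin \<iota>\<^esub> lift \<psi>"
    by (simp add: W_ext_def subgroup_generated_def Aut_ring_simps Aut_C_lin_def comp_group_def)
qed

end

theorem theorem5:
  fixes \<kappa> :: q_kind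
    and \<iota> :: "ratfun \<Rightarrow> 'f::division_ring"
    and q F G :: 'f
  assumes skew_field: "quantum_skew_field \<kappa> \<iota> q F G"
    and q_small: "\<And>c. \<kappa> = Complex_parameter c \<Longrightarrow> norm c < 1"
  shows "\<exists>(S :: node \<Rightarrow> 'f \<Rightarrow> 'f) S01 S45 T.
    (\<forall>j. ring_automorphism (S j) \<and> extends \<iota> (S j) (s j) \<and> S j q = q \<and>
       S j F = (if j = 2
         then F * ((\<iota> (a 0 * inverse (a 1)) * G + \<iota> ((a 2)\<^sup>2)) /
                   (\<iota> (a 0 * inverse (a 1) * (a 2)\<^sup>2) * G + 1))
         else F) \<and>
       S j G = (if j = 3
         then ((\<iota> ((a 3)\<^sup>2 * a 4 * inverse (a 5)) * F + 1) /
               (\<iota> (a 4 * inverse (a 5)) * F + \<iota> ((a 3)\<^sup>2))) * G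
         else G)) \<and>
    (\<exists>h \<in> hom W Aut_ring. \<forall>j. h (s j) = S j) \<and>
    (ring_antiautomorphism S01 \<and> involutive S01 \<and> extends \<iota> S01 \<sigma>01 \<and>
       S01 q = q \<and> S01 F = inverse q * inverse F \<and> S01 G = G) \<and>
    (ring_antiautomorphism S45 \<and> involutive S45 \<and> extends \<iota> S45 \<sigma>45 \<and>
       S45 q = q \<and> S45 F = F \<and> S45 G = inverse q * inverse G) \<and>
    (ring_antiautomorphism T \<and> involutive T \<and> extends \<iota> T \<tau> \<and>
       T q = q \<and> T F = G \<and> T G = F) \<and>
    (\<exists>h \<in> hom W_ext (Aut_C_lin \<iota>).
       (\<forall>j. h (s j) = S j) \<and> h \<sigma>01 = S01 \<and> h \<sigma>45 = S45 \<and> h \<tau> = T)"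
proof -
  interpret skew_field \<kappa> \<iota> q F G
    using skew_field q_small by (simp add: skew_field_def skew_field_axioms_def)
  have L: "inverse L = (\<iota> ((a 3)\<^sup>2 * a 4 * inverse (a 5)) * F + 1) / (\<iota> (a 4 * inverse (a 5)) * F + \<iota> ((a 3)\<^sup>2))"
  proof -
    have "(a 3)\<^sup>2 * a 4 * inverse (a 5) = a 4 * inverse (a 5) * (a 3)\<^sup>2"
      by (simp add: mult_ac)
    then show ?thesis
      using linear_nonzero[OF FG_not_scalar(1), of "a 4 * inverse (a 5)" "(a 3)\<^sup>2"]
        linear_nonzero_1[OF FG_not_scalar(1), of "a 4 * inverse (a 5) * (a 3)\<^sup>2"]
      by (simp only: mob_def divide_inverse[where 'a = 'f])
        (simp add: nonzero_inverse_mult_distrib)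
  qed
  show ?thesis
  proof (intro exI conjI allI)
    show "\<exists>h\<in>hom W Aut_ring. \<forall>j. h (s j) = S j"
      using lift_hom_W lift_gen_K[of "Reflection _"] by auto
    show "\<exists>h\<in>hom W_ext (Aut_C_lin \<iota>). (\<forall>j. h (s j) = S j) \<and> h \<sigma>01 = S01 \<and> h \<sigma>45 = S45 \<and> h \<tau> = T"
      using lift_hom_W_ext lift_gen_K[of "Reflection _"] lift_gen_K[of Diagram01]
        lift_gen_K[of Diagram45] lift_gen_K[of Diagram_reversal] by auto
    show "S j F = (if j = 2
         then F * ((\<iota> (a 0 * inverse (a 1)) * G + \<iota> ((a 2)\<^sup>2)) /
                   (\<iota> (a 0 * inverse (a 1) * (a 2)\<^sup>2) * G + 1))
         else F)" for j
      by (simp only: S_F mob_def)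
    show "S j G = (if j = 3
         then ((\<iota> ((a 3)\<^sup>2 * a 4 * inverse (a 5)) * F + 1) /
               (\<iota> (a 4 * inverse (a 5)) * F + \<iota> ((a 3)\<^sup>2))) * G
         else G)" for j
      by (simp only: S_G L)
    show "involutive S01" "involutive S45" "involutive T"
      using fun_cong[OF S01_S01] fun_cong[OF S45_S45] fun_cong[OF T_T] by (simp_all add: involutive_def)
  qed (simp_all only: extends_def ring_automorphism_S ring_antiautomorphism_gen_F S_\<iota> S_q S01_\<iota> S01_q
      S01_F S01_G S45_\<iota> S45_q S45_F S45_G T_\<iota> T_q T_F T_G simp_thms)
qed

end
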